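(* Let $\rho_0,\rho_1\in\mathcal M_+(\bar\Omega)$, let $(\delta_n)_{n\in\mathbb N}$ be a sequence of positive real numbers, and for each $n$ let $(\rho^n,\omega^n,\zeta^n)$ be a minimizer of $D_{\delta_n}$ over $\mathcal{CE}_0^1(\rho_0,\rho_1)$ (i.e. a minimizer for the distance $WF_{\delta_n}(\rho_0,\rho_1)$). A. If $\delta_n\to+\infty$, then, up to a subsequence, $(\rho^n,\omega^n,\zeta^n)$ weak* converges to a minimizer for $d_{gBB}(\rho_0,\rho_1)$. B. If $\delta_n\to0$, then, up to a subsequence, $(\rho^n,\omega^n,\zeta^n)$ weak* converges to a minimizer for $d_{FR}(\rho_0,\rho_1)$.
   Context: Let $\Omega\subset\mathbb R^d$ ($d\ge 1$) be a nonempty open bounded convex set with closure $\bar\Omega$. For compact $X$, $\mathcal M(X)$ denotes the finite signed Radon measures on $X$ (the dual of $C(X)$ with the sup norm, which defines weak* convergence) and $\mathcal M_+(X)$ the nonnegative ones. For $\delta>0$ let $f_\delta:\mathbb R\times\mathbb R^d\times\mathbb R\to[0,+\infty]$ be $f_\delta(x,y,z)=\frac{|y|^2+\delta^2z^2}{2x}$ if $x>0$, $f_\delta(0,0,0)=0$, and $f_\delta=+\infty$ otherwise. For $\mu=(\rho,\omega,\zeta)\in\mathcal M([0,1]\times\bar\Omega)\times\mathcal M([0,1]\times\bar\Omega)^d\times\mathcal M([0,1]\times\bar\Omega)$ set $D_\delta(\mu)=\int_{[0,1]\times\bar\Omega}f_\delta\big(\frac{d\mu}{d\lambda}\big)\,d\lambda$,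 where $\lambda$ is any nonnegative measure with $|\mu|\ll\lambda$ (the value does not depend on $\lambda$). Put $D_{BB}(\rho,\omega)=D_\delta(\rho,\omega,0)$ and $D_{FR}(\rho,\zeta)=\delta^{-2}D_\delta(\rho,0,\zeta)$; these do not depend on $\delta$. $\mathcal{CE}_0^1(\rho_0,\rho_1)$ is the set of triples $(\rho,\omega,\zeta)\in\mathcal M([0,1]\times\bar\Omega)\times\mathcal M([0,1]\times\bar\Omega)^d\times\mathcal M([0,1]\times\bar\Omega)$ such that for all $\varphi\in C^1([0,1]\times\bar\Omega)$ $$\int\partial_t\varphi\,d\rho+\int\nabla\varphi\cdot d\omega+\int\varphi\,d\zeta=\int_{\bar\Omega}\varphi(1,\cdot)\,d\rho_1-\int_{\bar\Omega}\varphi(0,\cdot)\,d\rho_0 ,$$ and $WF_\delta(\rho_0,\rho_1)=\big(\inf_{\mathcal{CE}_0^1(\rho_0,\rho_1)}D_\delta\big)^{1/2}$. Rate of growth: $g(t,x)=0$ if $\rho_0(\bar\Omega)=\rho_1(\bar\Omega)$ and $g(t,x)=\frac{2}{t-t_0}$ otherwise, with $t_0=\sqrt{\rho_0(\bar\Omega)}\big(\sqrt{\rho_0(\bar\Omega)}-\sqrt{\rho_1(\bar\Omega)}\big)^{-1}$. $d_{gBB}(\rho_0,\rho_1)^2=\inf\{D_{BB}(\rho,\omega):(\rho,\omega,g\rho)\in\mathcal{CE}_0^1(\rho_0,\rho_1)\}$; a minimizer for $d_{gBB}$ is a triple $(\rho,\omega,\zeta)\in\mathcal{CE}_0^1(\rho_0,\rho_1)$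 with $\zeta=g\rho$ and $D_{BB}(\rho,\omega)=d_{gBB}(\rho_0,\rho_1)^2$. $d_{FR}(\rho_0,\rho_1)^2=\inf\{D_{FR}(\rho,\zeta):(\rho,0,\zeta)\in\mathcal{CE}_0^1(\rho_0,\rho_1)\}$; a minimizer for $d_{FR}$ is a triple $(\rho,0,\zeta)\in\mathcal{CE}_0^1(\rho_0,\rho_1)$ with $D_{FR}(\rho,\zeta)=d_{FR}(\rho_0,\rho_1)^2$. *)

theory Defs
  imports "HOL-Analysis.Analysis"
begin

section \<open>Finite signed Radon measures on a compact set\<close>

abbreviation borel_sets_on :: "'a::topological_space set \<Rightarrow> 'a set set" where
  "borel_sets_on X \<equiv> sets (restrict_space borel X)"

text \<open>A signed measure is a real-valued countably additive set function on the Borel subsets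
  of X, extended by 0 to all other sets so that equality of functions is equality of measures.
  It is only used for compact subsets X of Euclidean spaces, where every such set function is
  automatically Radon.\<close>

type_synonym 'a smeasure = "'a set \<Rightarrow> real"

definition signed_measures :: "'a::topological_space set \<Rightarrow> 'a smeasure set" where
  "signed_measures X =
     {\<mu>. (\<forall>A. A \<notin> borel_sets_on X \<longrightarrow> \<mu> A = 0) \<and>
         (\<forall>A::nat \<Rightarrow> 'a set. range A \<subseteq> borel_sets_on X \<longrightarrow> disjoint_family A \<longrightarrow>
            (\<lambda>i. \<mu> (A i)) sums \<mu> (\<Union>i. A i))}"

definition nonneg_measures :: "'a::topological_space set \<Rightarrow> 'a smeasure set" where
  "nonneg_measures X = {\<mu> \<in> signed_measures X. \<forall>A. 0 \<le> \<mu> A}"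

text \<open>Jordan decomposition. The coercion to the extended nonnegative reals sends negative
  numbers to 0, which is harmless because the empty set is among the competitors.\<close>

definition pos_part :: "'a::topological_space set \<Rightarrow> 'a smeasure \<Rightarrow> 'a measure" where
  "pos_part X \<mu> = measure_of X (borel_sets_on X)
     (\<lambda>A. SUP B\<in>{B \<in> borel_sets_on X. B \<subseteq> A}. ennreal (\<mu> B))"

definition neg_part :: "'a::topological_space set \<Rightarrow> 'a smeasure \<Rightarrow> 'a measure" where
  "neg_part X \<mu> = pos_part X (\<lambda>A. - \<mu> A)"

definition signed_integrable :: "'a::topological_space set \<Rightarrow> 'a smeasure \<Rightarrow> ('a \<Rightarrow> real) \<Rightarrow> bool" where
  "signed_integrable X \<mu> f \<longleftrightarrow> integrable (pos_part X \<mu>) f \<and> integrable (neg_part X \<mu>) f"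

definition signed_integral :: "'a::topological_space set \<Rightarrow> 'a smeasure \<Rightarrow> ('a \<Rightarrow> real) \<Rightarrow> real" where
  "signed_integral X \<mu> f = integral\<^sup>L (pos_part X \<mu>) f - integral\<^sup>L (neg_part X \<mu>) f"

text \<open>The relation \<open>\<nu> = g \<mu>\<close>, including that this product is a finite signed measure.\<close>

definition is_density_product ::
    "'a::topological_space set \<Rightarrow> 'a smeasure \<Rightarrow> ('a \<Rightarrow> real) \<Rightarrow> 'a smeasure \<Rightarrow> bool" where
  "is_density_product X \<nu> g \<mu> \<longleftrightarrow> signed_integrable X \<mu> g \<and>
     (\<forall>A\<in>borel_sets_on X. \<nu> A = signed_integral X \<mu> (\<lambda>p. indicator A p * g p))"

text \<open>The Radon-Nikodym derivative of \<open>\<mu>\<close> with respect to a nonnegative measure \<open>\<Lambda>\<close>.\<close>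

definition signed_RN_deriv ::
    "'a::topological_space set \<Rightarrow> 'a measure \<Rightarrow> 'a smeasure \<Rightarrow> 'a \<Rightarrow> real" where
  "signed_RN_deriv X \<Lambda> \<mu> p =
     enn2real (RN_deriv \<Lambda> (pos_part X \<mu>) p) - enn2real (RN_deriv \<Lambda> (neg_part X \<mu>) p)"

definition weak_star_tendsto ::
    "'a::topological_space set \<Rightarrow> (nat \<Rightarrow> 'a smeasure) \<Rightarrow> 'a smeasure \<Rightarrow> bool" where
  "weak_star_tendsto X \<mu>s \<mu> \<longleftrightarrow>
     (\<forall>f. continuous_on X f \<longrightarrow>
        (\<lambda>n. signed_integral X (\<mu>s n) f) \<longlonglongrightarrow> signed_integral X \<mu> f)"


section \<open>Triples of measures and the action functionals\<close>

type_synonym 'd spacetime = "real \<times> (real ^ 'd)"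

text \<open>Triples \<open>(\<rho>, \<omega>, \<zeta>)\<close>; the vector measure \<open>\<omega>\<close> is given by its components.\<close>

type_synonym 'd triple =
  "'d spacetime smeasure \<times> ('d \<Rightarrow> 'd spacetime smeasure) \<times> 'd spacetime smeasure"

abbreviation cylinder :: "(real ^ 'd) set \<Rightarrow> 'd spacetime set" where
  "cylinder \<Omega> \<equiv> {0..1} \<times> closure \<Omega>"

definition triples :: "(real ^ 'd) set \<Rightarrow> ('d::finite) triple set" where
  "triples \<Omega> = {(\<rho>, \<omega>, \<zeta>). \<rho> \<in> signed_measures (cylinder \<Omega>) \<and>
     (\<forall>i. \<omega> i \<in> signed_measures (cylinder \<Omega>)) \<and> \<zeta> \<in> signed_measures (cylinder \<Omega>)}"

definition f_delta :: "real \<Rightarrow> real \<Rightarrow> real ^ 'd \<Rightarrow> real \<Rightarrow> ennreal" where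
  "f_delta \<delta> x y z =
     (if x > 0 then ennreal (((norm y)\<^sup>2 + \<delta>\<^sup>2 * z\<^sup>2) / (2 * x))
      else if x = 0 \<and> y = 0 \<and> z = 0 then 0 else top)"

text \<open>The reference measure \<open>|\<rho>| + |\<omega>\<^sub>1| + \<dots> + |\<omega>\<^sub>d| + |\<zeta>|\<close>. Since \<open>f_delta\<close> is positively
  1-homogeneous, any other finite nonnegative measure dominating the triple yields the same
  action.\<close>

definition ref_measure :: "(real ^ 'd) set \<Rightarrow> ('d::finite) triple \<Rightarrow> 'd spacetime measure" where
  "ref_measure \<Omega> = (\<lambda>(\<rho>, \<omega>, \<zeta>).
     let X = cylinder \<Omega>;
         var = (\<lambda>\<mu> A. emeasure (pos_part X \<mu>) A + emeasure (neg_part X \<mu>) A)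
     in measure_of X (borel_sets_on X) (\<lambda>A. var \<rho> A + (\<Sum>i\<in>UNIV. var (\<omega> i) A) + var \<zeta> A))"

definition D_wrt ::
    "(real ^ 'd) set \<Rightarrow> 'd spacetime measure \<Rightarrow> real \<Rightarrow> ('d::finite) triple \<Rightarrow> ennreal" where
  "D_wrt \<Omega> \<Lambda> \<delta> = (\<lambda>(\<rho>, \<omega>, \<zeta>).
     \<integral>\<^sup>+ p. f_delta \<delta>
       (signed_RN_deriv (cylinder \<Omega>) \<Lambda> \<rho> p)
       (\<chi> i. signed_RN_deriv (cylinder \<Omega>) \<Lambda> (\<omega> i) p)
       (signed_RN_deriv (cylinder \<Omega>) \<Lambda> \<zeta> p) \<partial>\<Lambda>)"

definition D :: "(real ^ 'd) set \<Rightarrow> real \<Rightarrow> ('d::finite) triple \<Rightarrow> ennreal" where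
  "D \<Omega> \<delta> \<mu> = D_wrt \<Omega> (ref_measure \<Omega> \<mu>) \<delta> \<mu>"

text \<open>\<open>D \<Omega> \<delta> (\<rho>, \<omega>, 0)\<close> and \<open>D \<Omega> \<delta> (\<rho>, 0, \<zeta>) / \<delta>\<^sup>2\<close> do not depend on \<open>\<delta> > 0\<close>; the value
  \<open>\<delta> = 1\<close> is used.\<close>

definition D_BB ::
    "(real ^ 'd) set \<Rightarrow> 'd spacetime smeasure \<Rightarrow> ('d::finite \<Rightarrow> 'd spacetime smeasure) \<Rightarrow> ennreal" where
  "D_BB \<Omega> \<rho> \<omega> = D \<Omega> 1 (\<rho>, \<omega>, (\<lambda>A. 0))"

definition D_FR ::
    "(real ^ 'd) set \<Rightarrow> ('d::finite) spacetime smeasure \<Rightarrow> 'd spacetime smeasure \<Rightarrow> ennreal" where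
  "D_FR \<Omega> \<rho> \<zeta> = D \<Omega> 1 (\<rho>, (\<lambda>i A. 0), \<zeta>)"


section \<open>The continuity equation with source\<close>

text \<open>\<open>\<phi>\<close> is continuously differentiable up to the boundary, with time derivative \<open>\<phi>t\<close> and
  space gradient \<open>\<phi>x\<close>. For convex \<open>\<Omega>\<close> with nonempty interior the derivative within the
  cylinder is unique at every point, boundary included.\<close>

definition C1_on_cylinder ::
    "(real ^ 'd) set \<Rightarrow> ('d::finite spacetime \<Rightarrow> real) \<Rightarrow> ('d spacetime \<Rightarrow> real)
       \<Rightarrow> ('d spacetime \<Rightarrow> real ^ 'd) \<Rightarrow> bool" where
  "C1_on_cylinder \<Omega> \<phi> \<phi>t \<phi>x \<longleftrightarrow>
     (\<forall>p\<in>cylinder \<Omega>. (\<phi> has_derivative (\<lambda>(s, v). \<phi>t p * s + \<phi>x p \<bullet> v)) (at p within cylinder \<Omega>)) \<and>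
     continuous_on (cylinder \<Omega>) \<phi>t \<and> continuous_on (cylinder \<Omega>) \<phi>x"

definition CE ::
    "(real ^ 'd) set \<Rightarrow> (real ^ 'd) smeasure \<Rightarrow> (real ^ 'd) smeasure \<Rightarrow> ('d::finite) triple set" where
  "CE \<Omega> \<rho>0 \<rho>1 = {(\<rho>, \<omega>, \<zeta>). (\<rho>, \<omega>, \<zeta>) \<in> triples \<Omega> \<and>
     (\<forall>\<phi> \<phi>t \<phi>x. C1_on_cylinder \<Omega> \<phi> \<phi>t \<phi>x \<longrightarrow>
        signed_integral (cylinder \<Omega>) \<rho> \<phi>t
        + (\<Sum>i\<in>UNIV. signed_integral (cylinder \<Omega>) (\<omega> i) (\<lambda>p. \<phi>x p $ i))
        + signed_integral (cylinder \<Omega>) \<zeta> \<phi>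
        = signed_integral (closure \<Omega>) \<rho>1 (\<lambda>x. \<phi> (1, x))
          - signed_integral (closure \<Omega>) \<rho>0 (\<lambda>x. \<phi> (0, x)))}"


section \<open>Distances and their minimizers\<close>

text \<open>The squares of the distances are used, as extended nonnegative reals.\<close>

definition WF_sq ::
    "(real ^ 'd::finite) set \<Rightarrow> real \<Rightarrow> (real ^ 'd) smeasure \<Rightarrow> (real ^ 'd) smeasure \<Rightarrow> ennreal" where
  "WF_sq \<Omega> \<delta> \<rho>0 \<rho>1 = (INF \<mu>\<in>CE \<Omega> \<rho>0 \<rho>1. D \<Omega> \<delta> \<mu>)"

definition WF_minimizer ::
    "(real ^ 'd) set \<Rightarrow> real \<Rightarrow> (real ^ 'd) smeasure \<Rightarrow> (real ^ 'd) smeasure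
       \<Rightarrow> ('d::finite) triple \<Rightarrow> bool" where
  "WF_minimizer \<Omega> \<delta> \<rho>0 \<rho>1 \<mu> \<longleftrightarrow> \<mu> \<in> CE \<Omega> \<rho>0 \<rho>1 \<and> D \<Omega> \<delta> \<mu> = WF_sq \<Omega> \<delta> \<rho>0 \<rho>1"

text \<open>Rate of growth for total masses \<open>m0\<close> and \<open>m1\<close>. At \<open>t = t0\<close>, which can occur in \<open>[0, 1]\<close>
  only at an endpoint where the prescribed mass is 0, division by zero gives the value 0. This
  choice is immaterial: if \<open>(\<rho>, \<omega>, g \<rho>)\<close> satisfies the continuity equation, testing with
  functions of time alone shows that the time marginal of \<open>\<rho>\<close> has no atom.\<close>

definition growth_rate :: "real \<Rightarrow> real \<Rightarrow> ('d::finite) spacetime \<Rightarrow> real" where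
  "growth_rate m0 m1 = (\<lambda>(t, x).
     if m0 = m1 then 0 else (let t0 = sqrt m0 / (sqrt m0 - sqrt m1) in 2 / (t - t0)))"

definition CE_growth ::
    "(real ^ 'd) set \<Rightarrow> (real ^ 'd) smeasure \<Rightarrow> (real ^ 'd) smeasure \<Rightarrow> ('d::finite) triple set" where
  "CE_growth \<Omega> \<rho>0 \<rho>1 = {(\<rho>, \<omega>, \<zeta>). (\<rho>, \<omega>, \<zeta>) \<in> CE \<Omega> \<rho>0 \<rho>1 \<and>
     is_density_product (cylinder \<Omega>) \<zeta> (growth_rate (\<rho>0 (closure \<Omega>)) (\<rho>1 (closure \<Omega>))) \<rho>}"

definition d_gBB_sq ::
    "(real ^ 'd::finite) set \<Rightarrow> (real ^ 'd) smeasure \<Rightarrow> (real ^ 'd) smeasure \<Rightarrow> ennreal" where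
  "d_gBB_sq \<Omega> \<rho>0 \<rho>1 = (INF (\<rho>, \<omega>, \<zeta>)\<in>CE_growth \<Omega> \<rho>0 \<rho>1. D_BB \<Omega> \<rho> \<omega>)"

definition gBB_minimizer ::
    "(real ^ 'd) set \<Rightarrow> (real ^ 'd) smeasure \<Rightarrow> (real ^ 'd) smeasure \<Rightarrow> ('d::finite) triple \<Rightarrow> bool" where
  "gBB_minimizer \<Omega> \<rho>0 \<rho>1 = (\<lambda>(\<rho>, \<omega>, \<zeta>).
     (\<rho>, \<omega>, \<zeta>) \<in> CE_growth \<Omega> \<rho>0 \<rho>1 \<and> D_BB \<Omega> \<rho> \<omega> = d_gBB_sq \<Omega> \<rho>0 \<rho>1)"

definition CE_static ::
    "(real ^ 'd) set \<Rightarrow> (real ^ 'd) smeasure \<Rightarrow> (real ^ 'd) smeasure \<Rightarrow> ('d::finite) triple set" where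
  "CE_static \<Omega> \<rho>0 \<rho>1 = {(\<rho>, \<omega>, \<zeta>). (\<rho>, \<omega>, \<zeta>) \<in> CE \<Omega> \<rho>0 \<rho>1 \<and> \<omega> = (\<lambda>i A. 0)}"

definition d_FR_sq ::
    "(real ^ 'd::finite) set \<Rightarrow> (real ^ 'd) smeasure \<Rightarrow> (real ^ 'd) smeasure \<Rightarrow> ennreal" where
  "d_FR_sq \<Omega> \<rho>0 \<rho>1 = (INF (\<rho>, \<omega>, \<zeta>)\<in>CE_static \<Omega> \<rho>0 \<rho>1. D_FR \<Omega> \<rho> \<zeta>)"

definition FR_minimizer ::
    "(real ^ 'd) set \<Rightarrow> (real ^ 'd) smeasure \<Rightarrow> (real ^ 'd) smeasure \<Rightarrow> ('d::finite) triple \<Rightarrow> bool" where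
  "FR_minimizer \<Omega> \<rho>0 \<rho>1 = (\<lambda>(\<rho>, \<omega>, \<zeta>).
     (\<rho>, \<omega>, \<zeta>) \<in> CE_static \<Omega> \<rho>0 \<rho>1 \<and> D_FR \<Omega> \<rho> \<zeta> = d_FR_sq \<Omega> \<rho>0 \<rho>1)"

definition triple_weak_star_tendsto ::
    "(real ^ 'd) set \<Rightarrow> (nat \<Rightarrow> ('d::finite) triple) \<Rightarrow> 'd triple \<Rightarrow> bool" where
  "triple_weak_star_tendsto \<Omega> \<mu>s = (\<lambda>(\<rho>, \<omega>, \<zeta>).
     weak_star_tendsto (cylinder \<Omega>) (\<lambda>n. fst (\<mu>s n)) \<rho> \<and>
     (\<forall>i. weak_star_tendsto (cylinder \<Omega>) (\<lambda>n. fst (snd (\<mu>s n)) i) (\<omega> i)) \<and>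
     weak_star_tendsto (cylinder \<Omega>) (\<lambda>n. snd (snd (\<mu>s n))) \<zeta>)"

end

theory Submission
  imports Defs "HOL-Probability.Helly_Selection" "HOL-Probability.Giry_Monad"
begin

text \<open>
  Why the theorem is true. Let \<open>X\<close> be the space-time cylinder, \<open>s0\<close> and \<open>s1\<close> the square roots of
  the prescribed masses and \<open>K = 2 (s1 - s0)\<^sup>2\<close>. The action splits as a transport part plus
  \<open>\<delta>\<^sup>2\<close> times a growth part, and each part is a supremum of weak* continuous linear functionals.

  For large \<open>\<delta>\<close> the growth part has to be as small as possible, and its smallest value is \<open>K\<close>. To
  see this, test the continuity equation with the rate of growth \<open>g\<close>, a function of time alone
  that solves \<open>g' = - g\<^sup>2 / 2\<close>: every solution \<open>(\<rho>, \<omega>, \<zeta>)\<close> satisfies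
  \<open>\<integral> g d\<zeta> - 1/2 \<integral> g\<^sup>2 d\<rho> = K\<close>, and by Fenchel's inequality the left-hand side is at most the
  growth part. Equality forces \<open>\<zeta> = g \<rho>\<close> (\<open>growth_rigidity\<close>). Conversely the growth part of a
  competitor for \<open>d_gBB\<close> is exactly \<open>K\<close> (\<open>D_growth_le\<close>). Comparing a minimizer with all such
  competitors shows that its transport part is at most \<open>d_gBB\<^sup>2\<close> and its growth part at most
  \<open>K + d_gBB\<^sup>2 / \<delta>\<^sup>2\<close>; both bounds pass to a weak* limit, whose source is therefore \<open>g \<rho>\<close> and
  whose transport part is at most \<open>d_gBB\<^sup>2\<close>.

  For small \<open>\<delta>\<close> a comparison with the competitors for \<open>d_FR\<close> bounds the transport part by
  \<open>\<delta>\<^sup>2 d_FR\<^sup>2\<close> and the growth part by \<open>d_FR\<^sup>2\<close>. The first bound makes the momentum vanish in the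
  limit, the second one passes to the limit.

  If one of the two masses is zero, \<open>g\<close> is unbounded. It is therefore replaced by
  \<open>g\<^sub>e = 2 (s1 - s0) / (s + e)\<close>, where \<open>s\<close> interpolates linearly between \<open>s0\<close> and \<open>s1\<close>. This
  function solves the same differential equation, and \<open>e\<close> tends to 0 at the end
  (\<open>CE_reg_rate\<close>, \<open>reg_action_tendsto\<close>, \<open>rate_square_integrable\<close>).

  Three general facts carry the argument. The action is dual to the set of continuous admissible
  multipliers (\<open>D_le_iff\<close>), so that upper bounds on the action are families of linear inequalities
  between integrals of continuous functions: they are stable under weak* limits, and all
  comparisons above amount to a choice of multipliers. Bounded sequences of measures on a compact
  convex set have weak* convergent subsequences (\<open>weak_star_compact_signed\<close>); this is reduced to
  Helly's selection theorem on the real line. Finally, competitors of finite action exist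
  (\<open>growth_competitor\<close>, \<open>static_competitor\<close>): mass is moved along segments while it grows or
  shrinks like the square of an affine function of time.
\<close>

section \<open>Signed measures and the Jordan decomposition\<close>

lemma space_borel_on [simp]: "space (restrict_space borel X) = X"
  by (simp add: space_restrict_space)

lemma X_in_borel_on [simp]: "X \<in> borel_sets_on X"
  using sets.top[of "restrict_space borel X"] by simp

lemma sigma_sets_borel_on: "sigma_sets X (borel_sets_on X) = borel_sets_on X"
  using sets.sigma_sets_eq[of "restrict_space borel X"] by simp

lemma borel_on_Pow: "borel_sets_on X \<subseteq> Pow X"
  using sets.space_closed[of "restrict_space borel X"] by simp

lemma sigma_algebra_borel_on: "sigma_algebra X (borel_sets_on X)"
  using sets.sigma_algebra_axioms[of "restrict_space borel X"] by simp

lemma sets_pos_part [simp, measurable_cong]: "sets (pos_part X \<mu>) = borel_sets_on X"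
  unfolding pos_part_def by (simp add: sigma_sets_borel_on borel_on_Pow sets_measure_of)

lemma space_pos_part [simp]: "space (pos_part X \<mu>) = X"
  unfolding pos_part_def by (simp add: borel_on_Pow space_measure_of)

lemma sets_neg_part [simp, measurable_cong]: "sets (neg_part X \<mu>) = borel_sets_on X"
  unfolding neg_part_def by simp

lemma space_neg_part [simp]: "space (neg_part X \<mu>) = X"
  unfolding neg_part_def by simp

lemma signed_measures_sums:
  assumes "\<mu> \<in> signed_measures X" "range A \<subseteq> borel_sets_on X" "disjoint_family A"
  shows "(\<lambda>i. \<mu> (A i)) sums \<mu> (\<Union>i. A i)"
  using assms unfolding signed_measures_def by blast

lemma signed_measures_outside:
  "\<mu> \<in> signed_measures X \<Longrightarrow> A \<notin> borel_sets_on X \<Longrightarrow> \<mu> A = 0"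
  unfolding signed_measures_def by blast

lemma signed_measures_empty [simp]:
  assumes "\<mu> \<in> signed_measures X" shows "\<mu> {} = 0"
proof -
  have "(\<lambda>i::nat. \<mu> {}) sums \<mu> {}"
    using signed_measures_sums[OF assms, of "\<lambda>_. {}"] by (auto simp: disjoint_family_on_def)
  then have "(\<lambda>i::nat. \<mu> {}) \<longlonglongrightarrow> 0"
    by (intro summable_LIMSEQ_zero sums_summable)
  then show ?thesis by (simp add: LIMSEQ_const_iff)
qed

lemma signed_measures_Un:
  assumes "\<mu> \<in> signed_measures X" "A \<in> borel_sets_on X" "B \<in> borel_sets_on X" "A \<inter> B = {}"
  shows "\<mu> (A \<union> B) = \<mu> A + \<mu> B"
proof -
  have "(\<lambda>i. \<mu> (binaryset A B i)) sums \<mu> (\<Union>i. binaryset A B i)"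
    using assms by (intro signed_measures_sums[OF assms(1)])
      (auto simp: range_binaryset_eq disjoint_family_on_def binaryset_def)
  moreover have "(\<lambda>i. \<mu> (binaryset A B i)) sums (\<mu> A + \<mu> B)"
    using assms by (intro binaryset_sums) auto
  ultimately show ?thesis
    using sums_unique2 by (simp add: UN_binaryset_eq)
qed

lemma signed_measures_Diff:
  assumes "\<mu> \<in> signed_measures X" "A \<in> borel_sets_on X" "B \<in> borel_sets_on X" "B \<subseteq> A"
  shows "\<mu> (A - B) = \<mu> A - \<mu> B"
proof -
  have "A - B \<in> borel_sets_on X" using assms by auto
  moreover have "B \<union> (A - B) = A" using assms by auto
  ultimately show ?thesis
    using signed_measures_Un[OF assms(1,3), of "A - B"] by auto
qed

lemma signed_measures_uminus:
  assumes "\<mu> \<in> signed_measures X" shows "(\<lambda>A. - \<mu> A) \<in> signed_measures X"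
  using assms unfolding signed_measures_def by (auto intro: sums_minus)

definition upper_variation :: "'a::topological_space set \<Rightarrow> 'a smeasure \<Rightarrow> 'a set \<Rightarrow> ennreal" where
  "upper_variation X \<mu> A = (SUP B\<in>{B \<in> borel_sets_on X. B \<subseteq> A}. ennreal (\<mu> B))"

lemma upper_variation_mono: "A \<subseteq> A' \<Longrightarrow> upper_variation X \<mu> A \<le> upper_variation X \<mu> A'"
  unfolding upper_variation_def by (rule SUP_subset_mono) auto

lemma upper_variation_superadd:
  assumes "\<mu> \<in> signed_measures X" "A \<inter> B = {}"
  shows "upper_variation X \<mu> A + upper_variation X \<mu> B \<le> upper_variation X \<mu> (A \<union> B)"
proof -
  have *: "ennreal (\<mu> S) + ennreal (\<mu> T) \<le> upper_variation X \<mu> (A \<union> B)"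
    if S: "S \<in> borel_sets_on X" "S \<subseteq> A" and T: "T \<in> borel_sets_on X" "T \<subseteq> B" for S T
  proof -
    define S' where "S' = (if \<mu> S \<ge> 0 then S else {})"
    define T' where "T' = (if \<mu> T \<ge> 0 then T else {})"
    have S': "S' \<in> borel_sets_on X" "S' \<subseteq> A" "\<mu> S' \<ge> 0" "ennreal (\<mu> S) = ennreal (\<mu> S')"
      using S assms(1) by (auto simp: S'_def ennreal_neg)
    have T': "T' \<in> borel_sets_on X" "T' \<subseteq> B" "\<mu> T' \<ge> 0" "ennreal (\<mu> T) = ennreal (\<mu> T')"
      using T assms(1) by (auto simp: T'_def ennreal_neg)
    have "S' \<inter> T' = {}" using S' T' assms(2) by auto
    then have "\<mu> (S' \<union> T') = \<mu> S' + \<mu> T'"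
      by (intro signed_measures_Un[OF assms(1)] S' T')
    then have "ennreal (\<mu> S) + ennreal (\<mu> T) = ennreal (\<mu> (S' \<union> T'))"
      using S' T' by simp
    also have "\<dots> \<le> upper_variation X \<mu> (A \<union> B)"
      unfolding upper_variation_def using S' T' by (intro SUP_upper) auto
    finally show ?thesis .
  qed
  have ne: "{S \<in> borel_sets_on X. S \<subseteq> C} \<noteq> {}" for C
    by auto
  have "upper_variation X \<mu> A + upper_variation X \<mu> B
      = (SUP S\<in>{S \<in> borel_sets_on X. S \<subseteq> A}. ennreal (\<mu> S) + upper_variation X \<mu> B)"
    unfolding upper_variation_def[of X \<mu> A] by (rule ennreal_SUP_add_left[OF ne, symmetric])
  also have "\<dots> \<le> upper_variation X \<mu> (A \<union> B)"
  proof (rule SUP_least)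
    fix S assume S: "S \<in> {S \<in> borel_sets_on X. S \<subseteq> A}"
    have "ennreal (\<mu> S) + upper_variation X \<mu> B
        = (SUP T\<in>{T \<in> borel_sets_on X. T \<subseteq> B}. ennreal (\<mu> S) + ennreal (\<mu> T))"
      unfolding upper_variation_def[of X \<mu> B] by (rule ennreal_SUP_add_right[OF ne])
    also have "\<dots> \<le> upper_variation X \<mu> (A \<union> B)"
      using * S by (intro SUP_least) auto
    finally show "ennreal (\<mu> S) + upper_variation X \<mu> B \<le> upper_variation X \<mu> (A \<union> B)" .
  qed
  finally show ?thesis .
qed

text \<open>Splitting a competitor \<open>B\<close> along the sets \<open>A i\<close> and discarding the pieces of negative measure only
  increases the sum.\<close>

lemma upper_variation_subadd_suminf:
  assumes \<mu>: "\<mu> \<in> signed_measures X" and A: "range A \<subseteq> borel_sets_on X" "disjoint_family A"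
  shows "upper_variation X \<mu> (\<Union>i. A i) \<le> (\<Sum>i. upper_variation X \<mu> (A i))"
  unfolding upper_variation_def[of X \<mu> "\<Union>i. A i"]
proof (rule SUP_least)
  fix B assume B: "B \<in> {B \<in> borel_sets_on X. B \<subseteq> (\<Union>i. A i)}"
  have "B \<inter> A i \<in> borel_sets_on X" for i
    using A B by auto
  moreover have "disjoint_family (\<lambda>i. B \<inter> A i)"
    using A(2) by (fastforce simp: disjoint_family_on_def)
  ultimately have "(\<lambda>i. \<mu> (B \<inter> A i)) sums \<mu> (\<Union>i. B \<inter> A i)"
    by (intro signed_measures_sums[OF \<mu>]) auto
  moreover have "(\<Union>i. B \<inter> A i) = B" using B by auto
  ultimately have "(\<lambda>n. \<Sum>i<n. \<mu> (B \<inter> A i)) \<longlonglongrightarrow> \<mu> B"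
    by (simp add: sums_def)
  then have "(\<lambda>n. ennreal (\<Sum>i<n. \<mu> (B \<inter> A i))) \<longlonglongrightarrow> ennreal (\<mu> B)"
    by (rule tendsto_ennrealI)
  moreover have "ennreal (\<Sum>i<n. \<mu> (B \<inter> A i)) \<le> (\<Sum>i. upper_variation X \<mu> (A i))" for n
  proof -
    have "ennreal (\<Sum>i<n. \<mu> (B \<inter> A i)) \<le> ennreal (\<Sum>i<n. max 0 (\<mu> (B \<inter> A i)))"
      by (intro ennreal_leI sum_mono) auto
    also have "\<dots> = (\<Sum>i<n. ennreal (max 0 (\<mu> (B \<inter> A i))))"
      by (rule sum_ennreal[symmetric]) auto
    also have "\<dots> = (\<Sum>i<n. ennreal (\<mu> (B \<inter> A i)))"
      by (intro sum.cong refl) (auto simp: max_def ennreal_neg)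
    also have "\<dots> \<le> (\<Sum>i<n. upper_variation X \<mu> (A i))"
      unfolding upper_variation_def using A B
      by (intro sum_mono SUP_upper) auto
    also have "\<dots> \<le> (\<Sum>i. upper_variation X \<mu> (A i))"
      by (intro sum_le_suminf) auto
    finally show ?thesis .
  qed
  ultimately show "ennreal (\<mu> B) \<le> (\<Sum>i. upper_variation X \<mu> (A i))"
    by (intro LIMSEQ_le_const2) auto
qed

lemma upper_variation_empty:
  "\<mu> \<in> signed_measures X \<Longrightarrow> upper_variation X \<mu> {} = 0"
proof -
  assume "\<mu> \<in> signed_measures X"
  moreover have "{B \<in> borel_sets_on X. B \<subseteq> {}} = {{}}" by auto
  ultimately show ?thesis by (simp only: upper_variation_def) simp
qed

lemma upper_variation_countably_additive:
  assumes \<mu>: "\<mu> \<in> signed_measures X"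
  shows "countably_additive (borel_sets_on X) (upper_variation X \<mu>)"
  unfolding countably_additive_def
proof (intro allI impI)
  fix A :: "nat \<Rightarrow> _" assume A: "range A \<subseteq> borel_sets_on X" "disjoint_family A"
  have "(\<Sum>i<n. upper_variation X \<mu> (A i)) \<le> upper_variation X \<mu> (\<Union>i<n. A i)" for n
  proof (induction n)
    case 0 then show ?case by (simp add: upper_variation_empty[OF \<mu>])
  next
    case (Suc n)
    have "A i \<inter> A n = {}" if "i < n" for i
      using disjoint_family_onD[OF A(2), of i n] that by simp
    then have "(\<Union>i<n. A i) \<inter> A n = {}" by blast
    have "(\<Sum>i<Suc n. upper_variation X \<mu> (A i))
        \<le> upper_variation X \<mu> (\<Union>i<n. A i) + upper_variation X \<mu> (A n)"
      unfolding sum.lessThan_Suc by (rule add_right_mono[OF Suc])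
    also have "\<dots> \<le> upper_variation X \<mu> ((\<Union>i<n. A i) \<union> A n)"
      by (rule upper_variation_superadd[OF \<mu> \<open>(\<Union>i<n. A i) \<inter> A n = {}\<close>])
    also have "(\<Union>i<n. A i) \<union> A n = (\<Union>i<Suc n. A i)"
      by (auto simp: lessThan_Suc)
    finally show ?case .
  qed
  also have "upper_variation X \<mu> (\<Union>i<n. A i) \<le> upper_variation X \<mu> (\<Union>i. A i)" for n
    by (rule upper_variation_mono) auto
  finally have "(\<Sum>i. upper_variation X \<mu> (A i)) \<le> upper_variation X \<mu> (\<Union>i. A i)"
    by (intro suminf_le_const) auto
  with upper_variation_subadd_suminf[OF \<mu> A]
  show "(\<Sum>i. upper_variation X \<mu> (A i)) = upper_variation X \<mu> (\<Union> (range A))"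
    by (intro antisym) auto
qed

lemma emeasure_pos_part:
  assumes "\<mu> \<in> signed_measures X" "A \<in> borel_sets_on X"
  shows "emeasure (pos_part X \<mu>) A = upper_variation X \<mu> A"
proof -
  have "pos_part X \<mu> = measure_of X (borel_sets_on X) (upper_variation X \<mu>)"
    unfolding pos_part_def upper_variation_def ..
  then show ?thesis
    using assms upper_variation_countably_additive[OF assms(1)]
    by (auto intro!: emeasure_measure_of_sigma sigma_algebra_borel_on
        simp: positive_def upper_variation_empty)
qed

text \<open>A countably additive real-valued set function is automatically bounded: otherwise one could
  keep splitting off pieces of measure at least 1 in absolute value while leaving a remainder of
  infinite variation, which contradicts the convergence of the sum over the pieces.\<close>

lemma upper_variation_finite:
  assumes \<mu>: "\<mu> \<in> signed_measures X"
  shows "upper_variation X \<mu> X < \<infinity>"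
proof (rule ccontr)
  assume "\<not> ?thesis"
  then have inf: "upper_variation X \<mu> X = \<infinity>" by (simp add: not_less top_unique)
  define P where "P A \<longleftrightarrow> A \<in> borel_sets_on X \<and> upper_variation X \<mu> A = \<infinity>" for A
  have step: "\<exists>B. P B \<and> B \<subseteq> A \<and> 1 \<le> \<bar>\<mu> (A - B)\<bar>" if "P A" for A
  proof -
    have A: "A \<in> borel_sets_on X" "upper_variation X \<mu> A = \<infinity>" using that by (auto simp: P_def)
    then have "ennreal (\<bar>\<mu> A\<bar> + 1) < upper_variation X \<mu> A" by simp
    then obtain C where C: "C \<in> borel_sets_on X" "C \<subseteq> A" "ennreal (\<bar>\<mu> A\<bar> + 1) < ennreal (\<mu> C)"
      unfolding upper_variation_def less_SUP_iff by auto
    then have gt: "\<bar>\<mu> A\<bar> + 1 < \<mu> C" using ennreal_less_iff by (metis abs_ge_zero add_nonneg_nonneg zero_le_one)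
    have d: "\<mu> (A - C) = \<mu> A - \<mu> C" by (rule signed_measures_Diff[OF \<mu> A(1) C(1,2)])
    have "upper_variation X \<mu> A = emeasure (pos_part X \<mu>) A"
      using A by (simp add: emeasure_pos_part[OF \<mu>])
    also have "\<dots> = emeasure (pos_part X \<mu>) C + emeasure (pos_part X \<mu>) (A - C)"
      using A C by (subst plus_emeasure) (auto intro!: arg_cong[where f="emeasure _"])
    also have "\<dots> = upper_variation X \<mu> C + upper_variation X \<mu> (A - C)"
      using A C by (subst (1 2) emeasure_pos_part[OF \<mu>]) auto
    finally have "upper_variation X \<mu> C = \<infinity> \<or> upper_variation X \<mu> (A - C) = \<infinity>"
      using A(2) by (metis ennreal_add_eq_top infinity_ennreal_def)
    then show ?thesis
    proof
      assume "upper_variation X \<mu> C = \<infinity>"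
      then show ?thesis using C gt d by (intro exI[of _ C]) (auto simp: P_def)
    next
      assume "upper_variation X \<mu> (A - C) = \<infinity>"
      moreover have "A - (A - C) = C" using C by auto
      ultimately show ?thesis using A C gt by (intro exI[of _ "A - C"]) (auto simp: P_def)
    qed
  qed
  obtain A :: "nat \<Rightarrow> _" where A: "\<And>n. P (A n)" "\<And>n. A (Suc n) \<subseteq> A n" "\<And>n. 1 \<le> \<bar>\<mu> (A n - A (Suc n))\<bar>"
  proof -
    have "\<exists>A. \<forall>n::nat. P (A n) \<and> (A (Suc n) \<subseteq> A n \<and> 1 \<le> \<bar>\<mu> (A n - A (Suc n))\<bar>)"
      by (rule dependent_nat_choice) (use inf step in \<open>auto simp: P_def\<close>)
    then show thesis using that by blast
  qed
  have dec: "decseq A" using A(2) by (intro decseq_SucI)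
  have "disjoint_family (\<lambda>n. A n - A (Suc n))"
    unfolding disjoint_family_on_def
  proof (intro ballI impI)
    fix m n :: nat assume "m \<noteq> n"
    then consider "Suc m \<le> n" | "Suc n \<le> m" by linarith
    then show "(A m - A (Suc m)) \<inter> (A n - A (Suc n)) = {}"
      by cases (use decseqD[OF dec] in blast)+
  qed
  then have "(\<lambda>n. \<mu> (A n - A (Suc n))) sums \<mu> (\<Union>n. A n - A (Suc n))"
    using A(1) by (intro signed_measures_sums[OF \<mu>]) (auto simp: P_def)
  then have "(\<lambda>n. \<mu> (A n - A (Suc n))) \<longlonglongrightarrow> 0"
    by (intro summable_LIMSEQ_zero sums_summable)
  then have "eventually (\<lambda>n. \<bar>\<mu> (A n - A (Suc n))\<bar> < 1) sequentially"
    by (auto dest: tendstoD[where e=1])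
  then obtain n where "\<bar>\<mu> (A n - A (Suc n))\<bar> < 1"
    by (auto simp: eventually_sequentially)
  with A(3)[of n] show False by simp
qed

lemma finite_measure_pos_part:
  "\<mu> \<in> signed_measures X \<Longrightarrow> finite_measure (pos_part X \<mu>)"
  using upper_variation_finite[of \<mu> X] emeasure_pos_part[of \<mu> X X]
  by (intro finite_measureI) auto

lemma finite_measure_neg_part:
  "\<mu> \<in> signed_measures X \<Longrightarrow> finite_measure (neg_part X \<mu>)"
  unfolding neg_part_def by (intro finite_measure_pos_part signed_measures_uminus)

text \<open>Complementing within \<open>A\<close> turns the supremum of \<open>- \<mu>\<close> over the subsets of \<open>A\<close> into the
  supremum of \<open>\<mu>\<close> minus \<open>\<mu> A\<close>.\<close>

lemma Jordan_decomposition: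
  assumes \<mu>: "\<mu> \<in> signed_measures X" and A: "A \<in> borel_sets_on X"
  shows "\<mu> A = measure (pos_part X \<mu>) A - measure (neg_part X \<mu>) A"
proof -
  note um = signed_measures_uminus[OF \<mu>]
  have le: "measure (pos_part X \<nu>) A \<le> \<nu> A + measure (neg_part X \<nu>) A"
    if \<nu>: "\<nu> \<in> signed_measures X" for \<nu>
  proof -
    interpret p: finite_measure "pos_part X \<nu>" by (rule finite_measure_pos_part[OF \<nu>])
    interpret n: finite_measure "neg_part X \<nu>" by (rule finite_measure_neg_part[OF \<nu>])
    have *: "\<nu> B \<le> \<nu> A + measure (neg_part X \<nu>) A" if B: "B \<in> borel_sets_on X" "B \<subseteq> A" for B
    proof -
      have "\<nu> B - \<nu> A = - \<nu> (A - B)" using signed_measures_Diff[OF \<nu> A B] by simp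
      moreover have "ennreal (- \<nu> (A - B)) \<le> emeasure (neg_part X \<nu>) A"
        unfolding neg_part_def emeasure_pos_part[OF signed_measures_uminus[OF \<nu>] A] upper_variation_def
        using A B by (intro SUP_upper) auto
      then have "- \<nu> (A - B) \<le> measure (neg_part X \<nu>) A"
        by (simp add: n.emeasure_eq_measure)
      ultimately show ?thesis by simp
    qed
    have nn: "0 \<le> \<nu> A + measure (neg_part X \<nu>) A" using *[of "{}"] \<nu> by simp
    have "emeasure (pos_part X \<nu>) A \<le> ennreal (\<nu> A + measure (neg_part X \<nu>) A)"
      unfolding emeasure_pos_part[OF \<nu> A] upper_variation_def
      using * by (intro SUP_least ennreal_leI) auto
    then show ?thesis using nn by (simp add: p.emeasure_eq_measure)
  qed
  have nn: "neg_part X (\<lambda>A. - \<mu> A) = pos_part X \<mu>" "pos_part X (\<lambda>A. - \<mu> A) = neg_part X \<mu>"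
    unfolding neg_part_def by simp_all
  show ?thesis using le[OF \<mu>] le[OF um] unfolding nn by simp
qed


definition add_measure :: "'a measure \<Rightarrow> 'a measure \<Rightarrow> 'a measure" where
  "add_measure M N = measure_of (space M) (sets M) (\<lambda>A. emeasure M A + emeasure N A)"

lemma space_add_measure [simp]: "space (add_measure M N) = space M"
  and sets_add_measure [simp, measurable_cong]: "sets (add_measure M N) = sets M"
  unfolding add_measure_def by simp_all

lemma emeasure_add_measure:
  assumes "sets N = sets M" "A \<in> sets M"
  shows "emeasure (add_measure M N) A = emeasure M A + emeasure N A"
  unfolding add_measure_def
proof (rule emeasure_measure_of_sigma)
  show "sigma_algebra (space M) (sets M)" by (rule sets.sigma_algebra_axioms)
  show "positive (sets M) (\<lambda>A. emeasure M A + emeasure N A)" by (simp add: positive_def)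
  show "countably_additive (sets M) (\<lambda>A. emeasure M A + emeasure N A)"
    unfolding countably_additive_def
    using assms by (auto simp: suminf_add[symmetric] suminf_emeasure)
qed (use assms in auto)

lemma nn_integral_add_measure:
  assumes [measurable_cong]: "sets N = sets M" and "f \<in> borel_measurable M"
  shows "(\<integral>\<^sup>+x. f x \<partial>add_measure M N) = (\<integral>\<^sup>+x. f x \<partial>M) + (\<integral>\<^sup>+x. f x \<partial>N)"
  using assms(2)
proof (induction rule: borel_measurable_induct)
  case (cong f g)
  have "space N = space M" using assms(1) by (rule sets_eq_imp_space_eq)
  with cong show ?case by (simp cong: nn_integral_cong_simp)
next
  case (set A) then show ?case
    using assms(1) by (simp add: emeasure_add_measure)
next
  case (mult u c) 
  then have [measurable]: "u \<in> borel_measurable M" by simp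
  show ?case
    by (subst (1 2 3) nn_integral_cmult) (use mult in \<open>simp_all add: distrib_left\<close>)
next
  case (add u v)
  then have [measurable]: "u \<in> borel_measurable M" "v \<in> borel_measurable M" by simp_all
  show ?case
    by (subst (1 2 3) nn_integral_add) (use add in \<open>simp_all add: ac_simps\<close>)
next
  case (seq U)
  then have [measurable]: "\<And>i. U i \<in> borel_measurable M" by simp
  have "(\<integral>\<^sup>+x. (SUP i. U i) x \<partial>add_measure M N) = (SUP i. \<integral>\<^sup>+x. U i x \<partial>add_measure M N)"
    unfolding SUP_apply using seq by (intro nn_integral_monotone_convergence_SUP) auto
  also have "\<dots> = (SUP i. (\<integral>\<^sup>+x. U i x \<partial>M) + (\<integral>\<^sup>+x. U i x \<partial>N))"
    using seq by simp
  also have "\<dots> = (SUP i. \<integral>\<^sup>+x. U i x \<partial>M) + (SUP i. \<integral>\<^sup>+x. U i x \<partial>N)"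
    by (intro ennreal_SUP_add incseq_nn_integral seq)
  also have "(SUP i. \<integral>\<^sup>+x. U i x \<partial>M) = (\<integral>\<^sup>+x. (SUP i. U i) x \<partial>M)"
    unfolding SUP_apply using seq by (intro nn_integral_monotone_convergence_SUP[symmetric]) auto
  also have "(SUP i. \<integral>\<^sup>+x. U i x \<partial>N) = (\<integral>\<^sup>+x. (SUP i. U i) x \<partial>N)"
    unfolding SUP_apply using seq by (intro nn_integral_monotone_convergence_SUP[symmetric]) auto
  finally show ?case .
qed

lemma finite_measure_add_measure:
  assumes "sets N = sets M" "finite_measure M" "finite_measure N"
  shows "finite_measure (add_measure M N)"
proof (rule finite_measureI)
  have "space N = space M" using assms(1) by (rule sets_eq_imp_space_eq)
  then show "emeasure (add_measure M N) (space (add_measure M N)) \<noteq> \<infinity>"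
    using assms finite_measure.emeasure_finite[of M "space M"] finite_measure.emeasure_finite[of N "space N"]
    by (simp add: emeasure_add_measure)
qed

lemma
  fixes f :: "'a \<Rightarrow> real"
  assumes s [measurable_cong]: "sets N = sets M" and f: "integrable M f" "integrable N f"
  shows integrable_add_measure: "integrable (add_measure M N) f"
    and integral_add_measure: "(\<integral>x. f x \<partial>add_measure M N) = (\<integral>x. f x \<partial>M) + (\<integral>x. f x \<partial>N)"
proof -
  have fm [measurable]: "f \<in> borel_measurable M" using f(1) by simp
  have fin: "(\<integral>\<^sup>+x. norm (f x) \<partial>M) < \<infinity>" "(\<integral>\<^sup>+x. norm (f x) \<partial>N) < \<infinity>"
    using f by (simp_all add: integrable_iff_bounded)
  show 1: "integrable (add_measure M N) f"
    using fin by (intro integrableI_bounded) (simp_all add: nn_integral_add_measure[OF s])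
  have b: "(\<integral>\<^sup>+x. ennreal (f x) \<partial>M) < top" "(\<integral>\<^sup>+x. ennreal (f x) \<partial>N) < top"
     "(\<integral>\<^sup>+x. ennreal (- f x) \<partial>M) < top" "(\<integral>\<^sup>+x. ennreal (- f x) \<partial>N) < top"
    using f unfolding real_integrable_def by (simp_all add: less_top)
  show "(\<integral>x. f x \<partial>add_measure M N) = (\<integral>x. f x \<partial>M) + (\<integral>x. f x \<partial>N)"
    using b by (simp add: real_lebesgue_integral_def[OF 1] real_lebesgue_integral_def[OF f(1)]
        real_lebesgue_integral_def[OF f(2)] nn_integral_add_measure[OF s] enn2real_plus)
qed

lemma integrable_mono_measure:
  fixes f :: "'a \<Rightarrow> real"
  assumes "sets M = sets N" "\<And>A. A \<in> sets M \<Longrightarrow> emeasure M A \<le> emeasure N A" "integrable N f"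
  shows "integrable M f"
proof -
  have "M \<le> N" using assms(1,2) by (simp add: le_measure)
  then have "(\<integral>\<^sup>+x. norm (f x) \<partial>M) \<le> (\<integral>\<^sup>+x. norm (f x) \<partial>N)"
    by (intro nn_integral_mono_measure assms(1))
  moreover have "f \<in> borel_measurable M"
    using assms(3) measurable_cong_sets[OF assms(1) refl] by blast
  ultimately show ?thesis
    using assms(3) by (auto simp: integrable_iff_bounded intro: le_less_trans)
qed

text \<open>The positive and the negative part form the smallest pair of measures whose difference is \<open>\<mu>\<close>,
  hence integrability passes to them from any other pair. The two pairs give the same integral
  because adding the negative member of one to the positive member of the other yields the same
  measure.\<close>

lemma
  fixes M1 M2 :: "'a::topological_space measure"
  assumes \<mu>: "\<mu> \<in> signed_measures X"
    and s [simp, measurable_cong]: "sets M1 = borel_sets_on X" "sets M2 = borel_sets_on X"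
    and fin: "finite_measure M1" "finite_measure M2"
    and eq: "\<And>A. A \<in> borel_sets_on X \<Longrightarrow> \<mu> A = measure M1 A - measure M2 A"
    and f: "integrable M1 f" "integrable M2 f"
  shows signed_integrable_diff: "signed_integrable X \<mu> f"
    and signed_integral_diff: "signed_integral X \<mu> f = (\<integral>x. f x \<partial>M1) - (\<integral>x. f x \<partial>M2)"
proof -
  interpret M1: finite_measure M1 by fact
  interpret M2: finite_measure M2 by fact
  interpret p: finite_measure "pos_part X \<mu>" by (rule finite_measure_pos_part[OF \<mu>])
  interpret n: finite_measure "neg_part X \<mu>" by (rule finite_measure_neg_part[OF \<mu>])
  have p: "emeasure (pos_part X \<mu>) A \<le> emeasure M1 A" if "A \<in> borel_sets_on X" for A
    unfolding emeasure_pos_part[OF \<mu> that] upper_variation_def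
  proof (rule SUP_least)
    fix B assume B: "B \<in> {B \<in> borel_sets_on X. B \<subseteq> A}"
    then have "\<mu> B \<le> measure M1 B" by (simp add: eq)
    also have "\<dots> \<le> measure M1 A" using B that by (intro M1.finite_measure_mono) auto
    finally show "ennreal (\<mu> B) \<le> emeasure M1 A" by (simp add: M1.emeasure_eq_measure)
  qed
  have n: "emeasure (neg_part X \<mu>) A \<le> emeasure M2 A" if "A \<in> borel_sets_on X" for A
    unfolding neg_part_def emeasure_pos_part[OF signed_measures_uminus[OF \<mu>] that] upper_variation_def
  proof (rule SUP_least)
    fix B assume B: "B \<in> {B \<in> borel_sets_on X. B \<subseteq> A}"
    then have "- \<mu> B \<le> measure M2 B" by (simp add: eq)
    also have "\<dots> \<le> measure M2 A" using B that by (intro M2.finite_measure_mono) auto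
    finally show "ennreal (- \<mu> B) \<le> emeasure M2 A" by (simp add: M2.emeasure_eq_measure)
  qed
  have ip: "integrable (pos_part X \<mu>) f" by (rule integrable_mono_measure[OF _ _ f(1)]) (use p in auto)
  have "in": "integrable (neg_part X \<mu>) f" by (rule integrable_mono_measure[OF _ _ f(2)]) (use n in auto)
  show "signed_integrable X \<mu> f" using ip "in" by (simp add: signed_integrable_def)
  have "add_measure (pos_part X \<mu>) M2 = add_measure (neg_part X \<mu>) M1"
  proof (rule measure_eqI)
    fix A assume "A \<in> sets (add_measure (pos_part X \<mu>) M2)"
    then have A: "A \<in> borel_sets_on X" by simp
    then show "emeasure (add_measure (pos_part X \<mu>) M2) A = emeasure (add_measure (neg_part X \<mu>) M1) A"
      using Jordan_decomposition[OF \<mu> A] eq[OF A]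
      by (simp add: emeasure_add_measure p.emeasure_eq_measure n.emeasure_eq_measure
          M1.emeasure_eq_measure M2.emeasure_eq_measure flip: ennreal_plus)
  qed simp
  then have "(\<integral>x. f x \<partial>pos_part X \<mu>) + (\<integral>x. f x \<partial>M2) = (\<integral>x. f x \<partial>neg_part X \<mu>) + (\<integral>x. f x \<partial>M1)"
    using ip "in" f by (simp flip: integral_add_measure)
  then show "signed_integral X \<mu> f = (\<integral>x. f x \<partial>M1) - (\<integral>x. f x \<partial>M2)"
    by (simp add: signed_integral_def)
qed

lemma signed_measures_diff_measures:
  assumes "sets M1 = borel_sets_on X" "sets M2 = borel_sets_on X" "finite_measure M1" "finite_measure M2"
  shows "(\<lambda>A. if A \<in> borel_sets_on X then measure M1 A - measure M2 A else 0) \<in> signed_measures X"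
  unfolding signed_measures_def
proof (intro CollectI conjI allI impI)
  interpret M1: finite_measure M1 by fact
  interpret M2: finite_measure M2 by fact
  fix A :: "nat \<Rightarrow> _" assume A: "range A \<subseteq> borel_sets_on X" "disjoint_family A"
  then have "(\<lambda>i. measure M1 (A i) - measure M2 (A i)) sums (measure M1 (\<Union>i. A i) - measure M2 (\<Union>i. A i))"
    using assms by (intro sums_diff M1.finite_measure_UNION M2.finite_measure_UNION) auto
  moreover have "A i \<in> borel_sets_on X" "(\<Union>i. A i) \<in> borel_sets_on X" for i using A by auto
  ultimately show "(\<lambda>i. if A i \<in> borel_sets_on X then measure M1 (A i) - measure M2 (A i) else 0) sums
     (if (\<Union>i. A i) \<in> borel_sets_on X then measure M1 (\<Union>i. A i) - measure M2 (\<Union>i. A i) else 0)"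
    by simp
qed auto

text \<open>The image under \<open>T\<close> of the signed measure that has density \<open>k\<close> with respect to \<open>N\<close>.\<close>

definition push_density ::
    "'a::topological_space set \<Rightarrow> 'b measure \<Rightarrow> ('b \<Rightarrow> 'a) \<Rightarrow> ('b \<Rightarrow> real) \<Rightarrow> 'a smeasure" where
  "push_density X N T k A = (if A \<in> borel_sets_on X then \<integral>p. indicator A (T p) * k p \<partial>N else 0)"

lemma
  fixes X :: "'a::topological_space set" and N :: "'b measure"
  assumes T [measurable]: "T \<in> measurable N (restrict_space borel X)" and k: "integrable N k"
  shows push_density_signed: "push_density X N T k \<in> signed_measures X"
    and push_density_integrable: "f \<in> borel_measurable (restrict_space borel X) \<Longrightarrow>
      integrable N (\<lambda>p. f (T p) * k p) \<Longrightarrow> signed_integrable X (push_density X N T k) f"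
    and push_density_integral: "f \<in> borel_measurable (restrict_space borel X) \<Longrightarrow>
      integrable N (\<lambda>p. f (T p) * k p) \<Longrightarrow>
      signed_integral X (push_density X N T k) f = (\<integral>p. f (T p) * k p \<partial>N)"
proof -
  have [measurable]: "k \<in> borel_measurable N" using k by simp
  define M where "M s = distr (density N (\<lambda>p. ennreal (max 0 (s * k p)))) (restrict_space borel X) T" for s :: real
  have sM [simp, measurable_cong]: "sets (M s) = borel_sets_on X" for s by (simp add: M_def)
  have ik: "integrable N (\<lambda>p. max 0 (s * k p))" for s using k by simp
  have fM: "finite_measure (M s)" for s
  proof -
    have "(\<integral>\<^sup>+p. ennreal (max 0 (s * k p)) \<partial>N) < \<infinity>"
      using ik[of s] by (simp add: real_integrable_def less_top)
    then have "finite_measure (density N (\<lambda>p. ennreal (max 0 (s * k p))))"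
      by (intro finite_measureI) (simp add: emeasure_density cong: nn_integral_cong)
    then show ?thesis unfolding M_def by (intro finite_measure.finite_measure_distr) simp_all
  qed
  have int: "(\<integral>x. f x \<partial>M s) = (\<integral>p. max 0 (s * k p) * f (T p) \<partial>N)"
    if [measurable]: "f \<in> borel_measurable (restrict_space borel X)" for f :: "'a \<Rightarrow> real" and s
    unfolding M_def by (simp add: integral_distr integral_density)
  have mx: "max 0 (1 * x) * y - max 0 (-1 * x) * y = y * x" for x y :: real
    by (simp add: max_def algebra_simps)
  have ind: "integrable N (\<lambda>p. max 0 (s * k p) * f (T p))"
    if [measurable]: "f \<in> borel_measurable (restrict_space borel X)"
      and i: "integrable N (\<lambda>p. f (T p) * k p)" and s: "\<bar>s\<bar> = 1" for f :: "'a \<Rightarrow> real" and s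
  proof (rule Bochner_Integration.integrable_bound[OF i])
    have "norm (max 0 (s * x) * y) \<le> norm (y * x)" for x y
    proof -
      have "norm (max 0 (s * x) * y) = max 0 (s * x) * \<bar>y\<bar>" by (simp add: abs_mult)
      also have "\<dots> \<le> \<bar>s * x\<bar> * \<bar>y\<bar>" by (intro mult_right_mono) auto
      finally have "norm (max 0 (s * x) * y) \<le> \<bar>s * x\<bar> * \<bar>y\<bar>" .
      then show ?thesis using s by (simp add: abs_mult mult.commute)
    qed
    then show "AE p in N. norm (max 0 (s * k p) * f (T p)) \<le> norm (f (T p) * k p)" by simp
  qed simp
  have iM: "integrable (M s) f"
    if [measurable]: "f \<in> borel_measurable (restrict_space borel X)"
      and i: "integrable N (\<lambda>p. f (T p) * k p)" and s: "\<bar>s\<bar> = 1" for f :: "'a \<Rightarrow> real" and s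
    unfolding M_def using ind[OF that] by (simp add: integrable_distr_eq integrable_density)
  have d: "push_density X N T k = (\<lambda>A. if A \<in> borel_sets_on X then measure (M 1) A - measure (M (-1)) A else 0)"
  proof
    fix A
    show "push_density X N T k A = (if A \<in> borel_sets_on X then measure (M 1) A - measure (M (-1)) A else 0)"
    proof (cases "A \<in> borel_sets_on X")
      case True
      then have A [measurable]: "(indicator A :: 'a \<Rightarrow> real) \<in> borel_measurable (restrict_space borel X)" by simp
      have i: "integrable N (\<lambda>p. indicator A (T p) * k p)"
      proof (rule Bochner_Integration.integrable_bound[OF k])
        show "(\<lambda>p. indicator A (T p) * k p) \<in> borel_measurable N"
          using measurable_compose[OF T A] by (intro borel_measurable_times) simp_all
      qed (auto simp: indicator_def)
      interpret M1: finite_measure "M 1" by (rule fM)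
      interpret M2: finite_measure "M (-1)" by (rule fM)
      have "measure (M 1) A - measure (M (-1)) A = (\<integral>x. indicator A x \<partial>M 1) - (\<integral>x. indicator A x \<partial>M (-1))"
        using True by (simp add: M1.emeasure_eq_measure M2.emeasure_eq_measure)
      also have "\<dots> = (\<integral>p. max 0 (1 * k p) * indicator A (T p) \<partial>N) - (\<integral>p. max 0 (-1 * k p) * indicator A (T p) \<partial>N)"
        by (simp only: int[OF A])
      also have "\<dots> = (\<integral>p. indicator A (T p) * k p \<partial>N)"
        using ind[OF A i, of 1] ind[OF A i, of "-1"]
        by (subst Bochner_Integration.integral_diff[symmetric]) (simp_all only: mx abs_one abs_minus_cancel)
      finally show ?thesis using True by (simp add: push_density_def)
    qed (simp add: push_density_def)
  qed
  show P: "push_density X N T k \<in> signed_measures X"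
    unfolding d by (rule signed_measures_diff_measures[OF sM sM fM fM])
  have e: "push_density X N T k A = measure (M 1) A - measure (M (-1)) A" if "A \<in> borel_sets_on X" for A
    using that by (simp add: d)
  assume f: "f \<in> borel_measurable (restrict_space borel X)" and i: "integrable N (\<lambda>p. f (T p) * k p)"
  note j = iM[OF f i, of 1, simplified] iM[OF f i, of "-1", simplified]
  show "signed_integrable X (push_density X N T k) f"
    by (rule signed_integrable_diff[OF P sM sM fM fM e j])
  have "signed_integral X (push_density X N T k) f = (\<integral>x. f x \<partial>M 1) - (\<integral>x. f x \<partial>M (-1))"
    by (rule signed_integral_diff[OF P sM sM fM fM e j])
  also have "\<dots> = (\<integral>p. max 0 (1 * k p) * f (T p) \<partial>N) - (\<integral>p. max 0 (-1 * k p) * f (T p) \<partial>N)"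
    by (simp only: int[OF f])
  also have "\<dots> = (\<integral>p. f (T p) * k p \<partial>N)"
    using ind[OF f i, of 1] ind[OF f i, of "-1"]
    by (subst Bochner_Integration.integral_diff[symmetric]) (simp_all only: mx abs_one abs_minus_cancel)
  finally show "signed_integral X (push_density X N T k) f = (\<integral>p. f (T p) * k p \<partial>N)" .
qed


lemma integrable_continuous_on:
  fixes f :: "'a::topological_space \<Rightarrow> real"
  assumes "finite_measure M" and s: "sets M = borel_sets_on X" and X: "compact X" and f: "continuous_on X f"
  shows "integrable M f"
proof -
  interpret finite_measure M by fact
  have "bounded (f ` X)" using X f by (intro compact_imp_bounded compact_continuous_image)
  then obtain C where C: "\<And>x. x \<in> X \<Longrightarrow> norm (f x) \<le> C" unfolding bounded_iff by auto
  have "space M = X" using sets_eq_imp_space_eq[OF s] by simp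
  moreover have "f \<in> borel_measurable M"
    using borel_measurable_continuous_on_restrict[OF f] measurable_cong_sets[OF s refl] by blast
  ultimately show ?thesis using C by (intro integrable_const_bound[where B=C]) (auto intro!: AE_I2)
qed

lemma signed_integrable_continuous:
  "\<mu> \<in> signed_measures X \<Longrightarrow> compact X \<Longrightarrow> continuous_on X f \<Longrightarrow> signed_integrable X \<mu> f"
  unfolding signed_integrable_def
  by (auto intro!: integrable_continuous_on finite_measure_pos_part finite_measure_neg_part)

lemma signed_integrable_bounded:
  fixes f :: "'a::topological_space \<Rightarrow> real"
  assumes \<mu>: "\<mu> \<in> signed_measures X" and [measurable]: "f \<in> borel_measurable (restrict_space borel X)"
    and b: "\<And>x. x \<in> X \<Longrightarrow> \<bar>f x\<bar> \<le> C"
  shows "signed_integrable X \<mu> f"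
  unfolding signed_integrable_def
  using b finite_measure_pos_part[OF \<mu>] finite_measure_neg_part[OF \<mu>]
  by (auto intro!: finite_measure.integrable_const_bound[where B=C] AE_I2)

lemma
  assumes "signed_integrable X \<mu> f" "signed_integrable X \<mu> g"
  shows signed_integral_add: "signed_integral X \<mu> (\<lambda>x. f x + g x) = signed_integral X \<mu> f + signed_integral X \<mu> g"
    and signed_integrable_sub: "signed_integrable X \<mu> (\<lambda>x. f x - g x)"
    and signed_integral_sub: "signed_integral X \<mu> (\<lambda>x. f x - g x) = signed_integral X \<mu> f - signed_integral X \<mu> g"
  using assms by (auto simp: signed_integrable_def signed_integral_def)

lemma signed_integral_cmult: "signed_integral X \<mu> (\<lambda>x. c * f x) = c * signed_integral X \<mu> f"
  by (simp add: signed_integral_def algebra_simps)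

lemma signed_integral_uminus: "signed_integral X \<mu> (\<lambda>x. - f x) = - signed_integral X \<mu> f"
  by (simp add: signed_integral_def)

lemma signed_integral_zero_fun [simp]: "signed_integral X \<mu> (\<lambda>x. 0) = 0"
  by (simp add: signed_integral_def)

lemma signed_integral_cong:
  "(\<And>x. x \<in> X \<Longrightarrow> f x = g x) \<Longrightarrow> signed_integral X \<mu> f = signed_integral X \<mu> g"
  unfolding signed_integral_def by (auto intro!: arg_cong2[where f="(-)"] Bochner_Integration.integral_cong)

lemma signed_integral_indicator:
  assumes "\<mu> \<in> signed_measures X" "A \<in> borel_sets_on X"
  shows "signed_integral X \<mu> (indicator A) = \<mu> A"
proof -
  interpret p: finite_measure "pos_part X \<mu>" by (rule finite_measure_pos_part[OF assms(1)])
  interpret n: finite_measure "neg_part X \<mu>" by (rule finite_measure_neg_part[OF assms(1)])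
  have "A \<inter> X = A" using assms(2) borel_on_Pow[of X] by auto
  then show ?thesis
    using assms Jordan_decomposition[OF assms]
    by (simp add: signed_integral_def p.emeasure_eq_measure n.emeasure_eq_measure)
qed

lemma integral_null_space:
  "emeasure M (space M) = 0 \<Longrightarrow> (\<integral>x. f x \<partial>M) = (0::real)"
  by (rule integral_eq_zero_AE, rule emeasure_0_AE)

lemma zero_signed_measure [simp]: "(\<lambda>A. 0) \<in> signed_measures X"
  by (auto simp: signed_measures_def)

lemma signed_integral_zero_measure [simp]: "signed_integral X (\<lambda>A. 0) f = 0"
proof -
  have "emeasure (pos_part X (\<lambda>A. 0)) X = 0"
    by (subst emeasure_pos_part) (auto simp: upper_variation_def intro!: SUP_eq_const)
  then have "(\<integral>x. f x \<partial>pos_part X (\<lambda>A. 0)) = 0" by (intro integral_null_space) simp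
  then show ?thesis by (simp add: signed_integral_def neg_part_def)
qed

lemma signed_measures_add:
  "\<mu> \<in> signed_measures X \<Longrightarrow> \<nu> \<in> signed_measures X \<Longrightarrow> (\<lambda>A. \<mu> A + \<nu> A) \<in> signed_measures X"
  unfolding signed_measures_def by (auto intro: sums_add)

lemma signed_integral_measure_uminus:
  "signed_integral X (\<lambda>A. - \<mu> A) f = - signed_integral X \<mu> f"
  by (simp add: signed_integral_def neg_part_def)

lemma signed_integral_measure_add:
  assumes \<mu>: "\<mu> \<in> signed_measures X" and \<nu>: "\<nu> \<in> signed_measures X"
    and f: "signed_integrable X \<mu> f" "signed_integrable X \<nu> f"
  shows "signed_integral X (\<lambda>A. \<mu> A + \<nu> A) f = signed_integral X \<mu> f + signed_integral X \<nu> f"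
proof -
  note fin = finite_measure_pos_part[OF \<mu>] finite_measure_pos_part[OF \<nu>]
    finite_measure_neg_part[OF \<mu>] finite_measure_neg_part[OF \<nu>]
  interpret a: finite_measure "add_measure (pos_part X \<mu>) (pos_part X \<nu>)"
    by (rule finite_measure_add_measure) (use fin in auto)
  interpret b: finite_measure "add_measure (neg_part X \<mu>) (neg_part X \<nu>)"
    by (rule finite_measure_add_measure) (use fin in auto)
  note i = f[unfolded signed_integrable_def]
  have "signed_integral X (\<lambda>A. \<mu> A + \<nu> A) f = (\<integral>x. f x \<partial>add_measure (pos_part X \<mu>) (pos_part X \<nu>))
      - (\<integral>x. f x \<partial>add_measure (neg_part X \<mu>) (neg_part X \<nu>))"
  proof (rule signed_integral_diff[OF signed_measures_add[OF \<mu> \<nu>] _ _ a.finite_measure_axioms b.finite_measure_axioms])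
    fix A assume A: "A \<in> borel_sets_on X"
    have m: "measure (add_measure M N) A = measure M A + measure N A"
      if "finite_measure M" "finite_measure N" "sets M = borel_sets_on X" "sets N = borel_sets_on X" for M N
    proof -
      have "emeasure M A < top" "emeasure N A < top"
        using that by (auto simp: less_top[symmetric] finite_measure.emeasure_finite)
      then show ?thesis
        using that A emeasure_add_measure[of N M A] by (simp add: measure_def enn2real_plus)
    qed
    show "\<mu> A + \<nu> A = measure (add_measure (pos_part X \<mu>) (pos_part X \<nu>)) A
        - measure (add_measure (neg_part X \<mu>) (neg_part X \<nu>)) A"
      using Jordan_decomposition[OF \<mu> A] Jordan_decomposition[OF \<nu> A] fin by (simp add: m)
  qed (use i in \<open>auto intro!: integrable_add_measure\<close>)
  then show ?thesis using i by (simp add: signed_integral_def integral_add_measure)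
qed

lemma nonneg_measures_signed: "\<mu> \<in> nonneg_measures X \<Longrightarrow> \<mu> \<in> signed_measures X"
  by (simp add: nonneg_measures_def)

lemma
  assumes "\<mu> \<in> nonneg_measures X"
  shows integrable_neg_part_nonneg_measure: "f \<in> borel_measurable (restrict_space borel X) \<Longrightarrow> integrable (neg_part X \<mu>) f"
    and signed_integral_nonneg_measure: "signed_integral X \<mu> f = (\<integral>x. f x \<partial>pos_part X \<mu>)"
    and measure_pos_part_nonneg_measure: "A \<in> borel_sets_on X \<Longrightarrow> measure (pos_part X \<mu>) A = \<mu> A"
proof -
  have m: "\<mu> \<in> signed_measures X" and nn: "\<And>A. 0 \<le> \<mu> A" using assms by (auto simp: nonneg_measures_def)
  have 0: "emeasure (neg_part X \<mu>) A = 0" if "A \<in> borel_sets_on X" for A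
    unfolding neg_part_def using that nn
    by (subst emeasure_pos_part[OF signed_measures_uminus[OF m]])
       (auto simp: upper_variation_def ennreal_neg intro!: SUP_eq_const)
  then have "(\<integral>x. f x \<partial>neg_part X \<mu>) = 0" by (intro integral_null_space) simp
  then show "signed_integral X \<mu> f = (\<integral>x. f x \<partial>pos_part X \<mu>)" by (simp add: signed_integral_def)
  show "integrable (neg_part X \<mu>) f" if "f \<in> borel_measurable (restrict_space borel X)"
  proof -
    have "AE x in neg_part X \<mu>. f x = 0" by (rule emeasure_0_AE) (simp add: 0)
    with that show ?thesis by (subst integrable_cong_AE[where g="\<lambda>_. 0"]) auto
  qed
  show "measure (pos_part X \<mu>) A = \<mu> A" if "A \<in> borel_sets_on X"
    using Jordan_decomposition[OF m that] 0[OF that] by (simp add: measure_def)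
qed

abbreviation variation :: "'a::topological_space set \<Rightarrow> 'a smeasure \<Rightarrow> 'a measure" where
  "variation X \<mu> \<equiv> add_measure (pos_part X \<mu>) (neg_part X \<mu>)"

lemma abs_signed_integral_le:
  assumes "signed_integrable X \<mu> f"
  shows "\<bar>signed_integral X \<mu> f\<bar> \<le> (\<integral>x. \<bar>f x\<bar> \<partial>variation X \<mu>)"
proof -
  have i: "integrable (pos_part X \<mu>) f" "integrable (neg_part X \<mu>) f"
    using assms by (simp_all add: signed_integrable_def)
  have "\<bar>signed_integral X \<mu> f\<bar> \<le> \<bar>\<integral>x. f x \<partial>pos_part X \<mu>\<bar> + \<bar>\<integral>x. f x \<partial>neg_part X \<mu>\<bar>"
    unfolding signed_integral_def by (rule abs_triangle_ineq4)
  also have "\<dots> \<le> (\<integral>x. \<bar>f x\<bar> \<partial>pos_part X \<mu>) + (\<integral>x. \<bar>f x\<bar> \<partial>neg_part X \<mu>)"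
    by (intro add_mono integral_abs_bound)
  also have "\<dots> = (\<integral>x. \<bar>f x\<bar> \<partial>variation X \<mu>)"
    using i by (intro integral_add_measure[symmetric]) auto
  finally show ?thesis .
qed

lemma finite_measure_variation:
  "\<mu> \<in> signed_measures X \<Longrightarrow> finite_measure (variation X \<mu>)"
  by (intro finite_measure_add_measure finite_measure_pos_part finite_measure_neg_part) simp_all

section \<open>Approximation by continuous functions\<close>

text \<open>By regularity the Borel set lies between a compact and an open set of almost the same measure. A
  Urysohn function for this pair is the approximation.\<close>

lemma approx_indicator_by_continuous:
  fixes X :: "'a::euclidean_space set"
  assumes X: "closed X" and fin: "finite_measure M" and s: "sets M = borel_sets_on X"
    and A: "A \<in> borel_sets_on X" and e: "0 < e"
  shows "\<exists>h. continuous_on X h \<and> (\<forall>x. 0 \<le> h x \<and> h x \<le> 1) \<and> (\<integral>x. \<bar>indicator A x - h x\<bar> \<partial>M) < (e::real)"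
proof -
  interpret finite_measure M by fact
  have sp: "space M = X" using sets_eq_imp_space_eq[OF s] by simp
  have idm [measurable]: "(\<lambda>x. x) \<in> measurable M borel"
    by (subst measurable_cong_sets[OF s refl]) (rule measurable_restrict_space1, simp)
  define N where "N = distr M borel (\<lambda>x. x)"
  interpret N: finite_measure N unfolding N_def by (rule finite_measure_distr) measurable
  have sN: "sets N = sets borel" by (simp add: N_def)
  have AX: "A \<subseteq> X" using A borel_on_Pow by auto
  have Ab: "A \<in> sets borel"
    using A X by (subst (asm) sets_restrict_space_iff) auto
  have Nfin: "emeasure N (space N) \<noteq> \<infinity>" using N.emeasure_finite by simp
  have Afin: "emeasure N A \<noteq> \<infinity>" using N.emeasure_finite by simp
  obtain U where U: "A \<subseteq> U" "open U" "emeasure N U < emeasure N A + ennreal (e/2)"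
  proof -
    have "(INF U\<in>{U. A \<subseteq> U \<and> open U}. emeasure N U) < emeasure N A + ennreal (e/2)"
      using outer_regular[OF sN Nfin Ab] Afin e by (simp add: less_top[symmetric])
    then show thesis using that unfolding INF_less_iff by auto
  qed
  obtain K where K: "K \<subseteq> A" "compact K" "emeasure N A < emeasure N K + ennreal (e/2)"
  proof -
    have "emeasure N A < (SUP K\<in>{K. K \<subseteq> A \<and> compact K}. emeasure N K) + ennreal (e/2)"
      using inner_regular[OF sN Nfin Ab] Afin e by (simp add: less_top[symmetric])
    also have "\<dots> = (SUP K\<in>{K. K \<subseteq> A \<and> compact K}. emeasure N K + ennreal (e/2))"
      by (rule ennreal_SUP_add_left[symmetric]) auto
    finally show thesis using that unfolding less_SUP_iff by auto
  qed
  have [measurable]: "U \<in> sets borel" "K \<in> sets borel" using U K by (auto simp: compact_imp_closed)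
  obtain h :: "'a \<Rightarrow> real" where h: "continuous_on UNIV h" "\<And>x. h x \<in> closed_segment 1 0"
      "\<And>x. x \<in> K \<Longrightarrow> h x = 1" "\<And>x. x \<in> - U \<Longrightarrow> h x = 0"
  proof (rule Urysohn[of K "-U" 1 "0::real"])
    show "closed K" "closed (-U)" "K \<inter> -U = {}"
      using K U compact_imp_closed by (auto simp: closed_Compl)
  qed (use that in blast)
  have h01: "0 \<le> h x" "h x \<le> 1" for x using h(2)[of x] by (auto simp: closed_segment_eq_real_ivl split: if_splits)
  have [measurable]: "h \<in> borel_measurable borel" using h(1) by (rule borel_measurable_continuous_onI)
  have "(\<integral>x. \<bar>indicator A x - h x\<bar> \<partial>M) = (\<integral>x. \<bar>indicator A x - h x\<bar> \<partial>N)"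
    unfolding N_def using Ab by (subst integral_distr) auto
  also have "\<dots> \<le> (\<integral>x. indicator (U - K) x \<partial>N)"
  proof (rule integral_mono)
    show "integrable N (\<lambda>x. \<bar>indicator A x - h x\<bar>)"
    proof (rule N.integrable_const_bound[where B=1])
      have [measurable]: "A \<in> sets N" using Ab sN by simp
      have [measurable]: "h \<in> borel_measurable N"
        using \<open>h \<in> borel_measurable borel\<close> measurable_cong_sets[OF sN refl] by blast
      show "(\<lambda>x. \<bar>indicator A x - h x\<bar>) \<in> borel_measurable N" by measurable
    qed (use h01 in \<open>auto simp: indicator_def intro!: AE_I2\<close>)
    show "integrable N (indicator (U - K) :: 'a \<Rightarrow> real)"
      using sN by (intro integrable_real_indicator) (auto simp: less_top[symmetric])
    fix x
    show "\<bar>indicator A x - h x\<bar> \<le> indicator (U - K) x"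
      using h01[of x] h(3,4)[of x] U(1) K(1) by (auto simp: indicator_def)
  qed
  also have "\<dots> = measure N (U - K)"
    using sN by (simp add: N.emeasure_eq_measure N_def)
  also have "\<dots> = measure N U - measure N K"
    using U(1) K(1) sN by (intro N.finite_measure_Diff) auto
  also have "\<dots> < e"
  proof -
    have "measure N U < measure N A + e / 2" "measure N A < measure N K + e / 2"
      using U(3) K(3) e by (simp_all add: N.emeasure_eq_measure ennreal_less_iff flip: ennreal_plus)
    then show ?thesis by simp
  qed
  finally show ?thesis
    using h01 continuous_on_subset[OF h(1)] by (intro exI[of _ h]) auto
qed

lemma approx_integrable_by_continuous:
  fixes X :: "'a::euclidean_space set" and f :: "'a \<Rightarrow> real"
  assumes X: "compact X" and fin: "finite_measure M" and s: "sets M = borel_sets_on X"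
    and f: "integrable M f" and e: "0 < e"
  shows "\<exists>h. continuous_on X h \<and> (\<integral>x. \<bar>f x - h x\<bar> \<partial>M) < e"
  using f e
proof (induction arbitrary: e rule: integrable_induct)
  case (base A c)
  obtain h where h: "continuous_on X h" "(\<integral>x. \<bar>indicator A x - h x\<bar> \<partial>M) < e / (\<bar>c\<bar> + 1)"
    using approx_indicator_by_continuous[OF compact_imp_closed[OF X] fin s, of A "e / (\<bar>c\<bar> + 1)"] base s by auto
  have "(\<integral>x. \<bar>indicator A x *\<^sub>R c - c * h x\<bar> \<partial>M) = (\<integral>x. \<bar>c\<bar> * \<bar>indicator A x - h x\<bar> \<partial>M)"
    by (simp add: abs_mult[symmetric] algebra_simps)
  also have "\<dots> = \<bar>c\<bar> * (\<integral>x. \<bar>indicator A x - h x\<bar> \<partial>M)" by simp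
  also have "\<dots> \<le> \<bar>c\<bar> * (e / (\<bar>c\<bar> + 1))" using h(2) by (intro mult_left_mono) auto
  also have "\<dots> < e" using base by (simp add: field_simps)
  finally show ?case using h(1) by (intro exI[of _ "\<lambda>x. c * h x"]) (auto intro: continuous_intros)
next
  case (add f g)
  obtain h k where h: "continuous_on X h" "(\<integral>x. \<bar>f x - h x\<bar> \<partial>M) < e / 2"
    and k: "continuous_on X k" "(\<integral>x. \<bar>g x - k x\<bar> \<partial>M) < e / 2"
    using add.IH[of "e/2"] add.prems by auto
  note i = integrable_continuous_on[OF fin s X h(1)] integrable_continuous_on[OF fin s X k(1)]
  have "(\<integral>x. \<bar>(f x + g x) - (h x + k x)\<bar> \<partial>M) \<le> (\<integral>x. \<bar>f x - h x\<bar> + \<bar>g x - k x\<bar> \<partial>M)"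
    using add.hyps i by (intro integral_mono) auto
  also have "\<dots> = (\<integral>x. \<bar>f x - h x\<bar> \<partial>M) + (\<integral>x. \<bar>g x - k x\<bar> \<partial>M)"
    using add.hyps i by (intro Bochner_Integration.integral_add) auto
  also have "\<dots> < e" using h(2) k(2) by simp
  finally show ?case using h(1) k(1) by (intro exI[of _ "\<lambda>x. h x + k x"]) (auto intro: continuous_intros)
next
  case (lim f s')
  have "(\<lambda>n. \<integral>x. \<bar>f x - s' n x\<bar> \<partial>M) \<longlonglongrightarrow> (\<integral>x. 0 \<partial>M)"
  proof (rule integral_dominated_convergence[where w="\<lambda>x. 3 * \<bar>f x\<bar>"])
    show "AE x in M. (\<lambda>i. \<bar>f x - s' i x\<bar>) \<longlonglongrightarrow> 0"
    proof (intro AE_I2 tendsto_rabs_zero)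
      fix x assume "x \<in> space M"
      from tendsto_diff[OF tendsto_const lim.hyps(2)[OF this], of "f x"]
      show "(\<lambda>i. f x - s' i x) \<longlonglongrightarrow> 0" by simp
    qed
    show "AE x in M. norm \<bar>f x - s' i x\<bar> \<le> 3 * \<bar>f x\<bar>" for i
    proof (rule AE_I2)
      fix x assume "x \<in> space M"
      from lim.hyps(3)[OF this, of i] show "norm \<bar>f x - s' i x\<bar> \<le> 3 * \<bar>f x\<bar>" by simp
    qed
  qed (use lim.hyps in auto)
  then have "eventually (\<lambda>n. (\<integral>x. \<bar>f x - s' n x\<bar> \<partial>M) < e / 2) sequentially"
    using lim.prems by (intro order_tendstoD) auto
  then obtain n where n: "(\<integral>x. \<bar>f x - s' n x\<bar> \<partial>M) < e / 2" by (auto simp: eventually_sequentially)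
  obtain h where h: "continuous_on X h" "(\<integral>x. \<bar>s' n x - h x\<bar> \<partial>M) < e / 2"
    using lim.IH[of "e/2" n] lim.prems by auto
  note i = integrable_continuous_on[OF fin s X h(1)]
  have "(\<integral>x. \<bar>f x - h x\<bar> \<partial>M) \<le> (\<integral>x. \<bar>f x - s' n x\<bar> + \<bar>s' n x - h x\<bar> \<partial>M)"
    using lim.hyps(1)[of n] lim.hyps(4) i by (intro integral_mono) auto
  also have "\<dots> = (\<integral>x. \<bar>f x - s' n x\<bar> \<partial>M) + (\<integral>x. \<bar>s' n x - h x\<bar> \<partial>M)"
    using lim.hyps(1)[of n] lim.hyps(4) i by (intro Bochner_Integration.integral_add) auto
  also have "\<dots> < e" using n h(2) by simp
  finally show ?case using h(1) by auto
qed

lemma approx_bounded_by_continuous: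
  fixes X :: "'a::euclidean_space set" and f :: "'a \<Rightarrow> real"
  assumes X: "compact X" and fin: "finite_measure M" and s: "sets M = borel_sets_on X"
    and f: "f \<in> borel_measurable (restrict_space borel X)" "\<And>x. x \<in> X \<Longrightarrow> f x \<in> {a..b}"
    and ab: "a \<le> b" and e: "0 < e"
  obtains h where "continuous_on X h" "\<And>x. h x \<in> {a..b}" "(\<integral>x. \<bar>f x - h x\<bar> \<partial>M) < e"
proof -
  interpret finite_measure M by fact
  have sp: "space M = X" using sets_eq_imp_space_eq[OF s] by simp
  have fi: "integrable M f"
  proof (rule integrable_const_bound[where B="max \<bar>a\<bar> \<bar>b\<bar>"])
    show "AE x in M. norm (f x) \<le> max \<bar>a\<bar> \<bar>b\<bar>"
      using f(2) by (intro AE_I2) (fastforce simp: sp)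
    show "f \<in> borel_measurable M" using f(1) measurable_cong_sets[OF s refl] by blast
  qed
  obtain h where h: "continuous_on X h" "(\<integral>x. \<bar>f x - h x\<bar> \<partial>M) < e"
    using approx_integrable_by_continuous[OF X fin s fi e] by auto
  let ?k = "\<lambda>x. max a (min b (h x))"
  have c: "continuous_on X ?k" using h(1) by (intro continuous_intros)
  have "(\<integral>x. \<bar>f x - ?k x\<bar> \<partial>M) \<le> (\<integral>x. \<bar>f x - h x\<bar> \<partial>M)"
  proof (rule integral_mono)
    fix x assume "x \<in> space M"
    then show "\<bar>f x - ?k x\<bar> \<le> \<bar>f x - h x\<bar>" using f(2)[of x] sp by (auto simp: max_def min_def)
  qed (use fi integrable_continuous_on[OF fin s X h(1)] integrable_continuous_on[OF fin s X c] in auto)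
  with h(2) c ab show thesis by (intro that[of ?k]) auto
qed

text \<open>Weak* limits only retain the integrals of continuous functions. This lemma and the next ones
  recover information on Borel sets from them.\<close>

lemma signed_measure_le_of_integrals:
  fixes X :: "'a::euclidean_space set"
  assumes X: "compact X" and \<mu>: "\<mu> \<in> signed_measures X" and A: "A \<in> borel_sets_on X"
    and le: "\<And>h. continuous_on X h \<Longrightarrow> (\<And>x. 0 \<le> h x \<and> h x \<le> 1) \<Longrightarrow> signed_integral X \<mu> h \<le> C"
  shows "\<mu> A \<le> C"
proof (rule field_le_epsilon)
  fix e :: real assume e: "0 < e"
  obtain h where h: "continuous_on X h" "\<forall>x. 0 \<le> h x \<and> h x \<le> 1" "(\<integral>x. \<bar>indicator A x - h x\<bar> \<partial>variation X \<mu>) < e"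
    using approx_indicator_by_continuous[OF compact_imp_closed[OF X] finite_measure_variation[OF \<mu>] _ A e] by auto
  have i: "signed_integrable X \<mu> h" by (rule signed_integrable_continuous[OF \<mu> X h(1)])
  have j: "signed_integrable X \<mu> (indicator A)"
    by (rule signed_integrable_bounded[OF \<mu>, where C=1]) (use A in \<open>auto simp: indicator_def\<close>)
  have "\<mu> A - signed_integral X \<mu> h = signed_integral X \<mu> (\<lambda>x. indicator A x - h x)"
    by (simp add: signed_integral_sub[OF j i] signed_integral_indicator[OF \<mu> A])
  also have "\<dots> \<le> e"
    using abs_signed_integral_le[OF signed_integrable_sub[OF j i]] h(3) by simp
  finally show "\<mu> A \<le> C + e" using le[OF h(1)] h(2) by simp
qed

lemma signed_measure_eqI:
  fixes X :: "'a::euclidean_space set"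
  assumes X: "compact X" and \<mu>: "\<mu> \<in> signed_measures X" and \<nu>: "\<nu> \<in> signed_measures X"
    and eq: "\<And>h. continuous_on X h \<Longrightarrow> signed_integral X \<mu> h = signed_integral X \<nu> h"
  shows "\<mu> = \<nu>"
proof
  fix A
  have le: "\<mu> A \<le> \<nu> A" if A: "A \<in> borel_sets_on X" and \<mu>: "\<mu> \<in> signed_measures X" and \<nu>: "\<nu> \<in> signed_measures X"
    and eq: "\<And>h. continuous_on X h \<Longrightarrow> signed_integral X \<mu> h = signed_integral X \<nu> h" for \<mu> \<nu> :: "'a smeasure"
  proof -
    have "\<mu> A + (- \<nu> A) \<le> 0"
    proof (rule signed_measure_le_of_integrals[OF X signed_measures_add[OF \<mu> signed_measures_uminus[OF \<nu>]] A])
      fix h :: "'a \<Rightarrow> real" assume h: "continuous_on X h"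
      show "signed_integral X (\<lambda>A. \<mu> A + (- \<nu> A)) h \<le> 0"
        by (subst signed_integral_measure_add)
           (use h eq[OF h] \<mu> \<nu> X in \<open>auto intro: signed_measures_uminus signed_integrable_continuous
             simp: signed_integral_measure_uminus\<close>)
    qed
    then show ?thesis by simp
  qed
  show "\<mu> A = \<nu> A"
  proof (cases "A \<in> borel_sets_on X")
    case True then show ?thesis using le[OF True \<mu> \<nu> eq] le[OF True \<nu> \<mu> eq[symmetric]] by auto
  next
    case False then show ?thesis using \<mu> \<nu> by (simp add: signed_measures_outside)
  qed
qed

lemma nonneg_measureI:
  fixes X :: "'a::euclidean_space set"
  assumes X: "compact X" and \<mu>: "\<mu> \<in> signed_measures X"
    and nn: "\<And>h. continuous_on X h \<Longrightarrow> (\<And>x. 0 \<le> h x) \<Longrightarrow> 0 \<le> signed_integral X \<mu> h"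
  shows "\<mu> \<in> nonneg_measures X"
  unfolding nonneg_measures_def
proof (intro CollectI conjI allI \<mu>)
  fix A show "0 \<le> \<mu> A"
  proof (cases "A \<in> borel_sets_on X")
    case True
    have "- \<mu> A \<le> 0"
      by (rule signed_measure_le_of_integrals[OF X signed_measures_uminus[OF \<mu>] True])
        (use nn in \<open>auto simp: signed_integral_measure_uminus\<close>)
    then show ?thesis by simp
  qed (use \<mu> in \<open>simp add: signed_measures_outside\<close>)
qed

lemma emeasure_pos_part_le_of_integrals:
  fixes X :: "'a::euclidean_space set"
  assumes X: "compact X" and \<mu>: "\<mu> \<in> signed_measures X"
    and le: "\<And>h. continuous_on X h \<Longrightarrow> (\<And>x. 0 \<le> h x \<and> h x \<le> 1) \<Longrightarrow> signed_integral X \<mu> h \<le> C"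
  shows "emeasure (pos_part X \<mu>) X \<le> ennreal C"
  unfolding emeasure_pos_part[OF \<mu> X_in_borel_on] upper_variation_def
  by (intro SUP_least ennreal_leI signed_measure_le_of_integrals[OF X \<mu>] le) auto

section \<open>The dual description of the action\<close>

lemma
  fixes X :: "'a::topological_space set"
  assumes \<mu>: "\<mu> \<in> signed_measures X" and fin: "finite_measure M" and s: "sets M = borel_sets_on X"
    and dom: "\<And>A. A \<in> borel_sets_on X \<Longrightarrow> emeasure (variation X \<mu>) A \<le> emeasure M A"
  shows borel_measurable_signed_RN_deriv: "signed_RN_deriv X M \<mu> \<in> borel_measurable M"
    and integrable_signed_RN_deriv:
      "signed_integrable X \<mu> h \<Longrightarrow> h \<in> borel_measurable M \<Longrightarrow> integrable M (\<lambda>p. h p * signed_RN_deriv X M \<mu> p)"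
    and signed_integral_RN_deriv: "signed_integrable X \<mu> h \<Longrightarrow> h \<in> borel_measurable M \<Longrightarrow>
      signed_integral X \<mu> h = (\<integral>p. h p * signed_RN_deriv X M \<mu> p \<partial>M)"
proof -
  interpret finite_measure M by fact
  interpret p: finite_measure "pos_part X \<mu>" by (rule finite_measure_pos_part[OF \<mu>])
  interpret n: finite_measure "neg_part X \<mu>" by (rule finite_measure_neg_part[OF \<mu>])
  have le: "emeasure (pos_part X \<mu>) A + emeasure (neg_part X \<mu>) A \<le> emeasure M A" if "A \<in> borel_sets_on X" for A
    using dom[OF that] that by (simp add: emeasure_add_measure)
  have ac: "absolutely_continuous M (pos_part X \<mu>)" "absolutely_continuous M (neg_part X \<mu>)"
    unfolding absolutely_continuous_def using le s
    by (force simp: null_sets_def)+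
  note rp = p.sigma_finite_measure_axioms ac(1)
  note rn = n.sigma_finite_measure_axioms ac(2)
  show "signed_RN_deriv X M \<mu> \<in> borel_measurable M"
    unfolding signed_RN_deriv_def by measurable
  assume "signed_integrable X \<mu> h" and h: "h \<in> borel_measurable M"
  then have i: "integrable (pos_part X \<mu>) h" "integrable (neg_part X \<mu>) h" by (auto simp: signed_integrable_def)
  have ip: "integrable M (\<lambda>x. enn2real (RN_deriv M (pos_part X \<mu>) x) * h x)"
    using RN_deriv_integrable[OF rp _ h] i s by simp
  have "in": "integrable M (\<lambda>x. enn2real (RN_deriv M (neg_part X \<mu>) x) * h x)"
    using RN_deriv_integrable[OF rn _ h] i s by simp
  show "integrable M (\<lambda>p. h p * signed_RN_deriv X M \<mu> p)"
    using Bochner_Integration.integrable_diff[OF ip "in"] by (simp add: signed_RN_deriv_def algebra_simps)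
  have "signed_integral X \<mu> h = (\<integral>x. enn2real (RN_deriv M (pos_part X \<mu>) x) * h x \<partial>M)
     - (\<integral>x. enn2real (RN_deriv M (neg_part X \<mu>) x) * h x \<partial>M)"
    unfolding signed_integral_def using RN_deriv_integral[OF rp _ h] RN_deriv_integral[OF rn _ h] s by simp
  also have "\<dots> = (\<integral>p. h p * signed_RN_deriv X M \<mu> p \<partial>M)"
    using ip "in" by (simp add: signed_RN_deriv_def algebra_simps flip: Bochner_Integration.integral_diff)
  finally show "signed_integral X \<mu> h = (\<integral>p. h p * signed_RN_deriv X M \<mu> p \<partial>M)" .
qed

text \<open>Applied with the reference measure of the action as dominating measure, this controls the error
  made when Borel functions are replaced by continuous ones.\<close>

lemma abs_signed_integral_le_dominating:
  fixes X :: "'a::topological_space set"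
  assumes \<mu>: "\<mu> \<in> signed_measures X" and s: "sets M = borel_sets_on X"
    and dom: "\<And>A. A \<in> borel_sets_on X \<Longrightarrow> emeasure (variation X \<mu>) A \<le> emeasure M A"
    and f: "integrable M f" 
  shows "\<bar>signed_integral X \<mu> f\<bar> \<le> (\<integral>x. \<bar>f x\<bar> \<partial>M)"
proof -
  have iv: "integrable (variation X \<mu>) f"
    by (rule integrable_mono_measure[OF _ _ f]) (use s dom in auto)
  have m: "f \<in> borel_measurable (restrict_space borel X)" using f measurable_cong_sets[OF s refl] by blast
  have "integrable (pos_part X \<mu>) f"
    by (rule integrable_mono_measure[OF _ _ iv]) (auto simp: emeasure_add_measure)
  moreover have "integrable (neg_part X \<mu>) f"
    by (rule integrable_mono_measure[OF _ _ iv]) (auto simp: emeasure_add_measure)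
  ultimately have "\<bar>signed_integral X \<mu> f\<bar> \<le> (\<integral>x. \<bar>f x\<bar> \<partial>variation X \<mu>)"
    by (intro abs_signed_integral_le) (simp add: signed_integrable_def)
  also have "\<dots> = enn2real (\<integral>\<^sup>+x. \<bar>f x\<bar> \<partial>variation X \<mu>)"
    using iv by (intro integral_eq_nn_integral) auto
  also have "\<dots> \<le> enn2real (\<integral>\<^sup>+x. \<bar>f x\<bar> \<partial>M)"
  proof (rule enn2real_mono)
    show "(\<integral>\<^sup>+x. \<bar>f x\<bar> \<partial>variation X \<mu>) \<le> (\<integral>\<^sup>+x. \<bar>f x\<bar> \<partial>M)"
      using s dom by (intro nn_integral_mono_measure) (auto simp: le_measure)
    show "(\<integral>\<^sup>+x. \<bar>f x\<bar> \<partial>M) < top" using f by (simp add: integrable_iff_bounded)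
  qed
  also have "\<dots> = (\<integral>x. \<bar>f x\<bar> \<partial>M)"
    using f by (intro integral_eq_nn_integral[symmetric]) auto
  finally show ?thesis .
qed

lemma
  fixes \<Omega> :: "(real ^ 'd::finite) set"
  assumes "(\<rho>, \<omega>, \<zeta>) \<in> triples \<Omega>"
  shows sets_ref_measure: "sets (ref_measure \<Omega> (\<rho>, \<omega>, \<zeta>)) = borel_sets_on (cylinder \<Omega>)"
    and finite_ref_measure: "finite_measure (ref_measure \<Omega> (\<rho>, \<omega>, \<zeta>))"
    and variation_le_ref_measure: "A \<in> borel_sets_on (cylinder \<Omega>) \<Longrightarrow> \<mu> \<in> insert \<rho> (insert \<zeta> (range \<omega>)) \<Longrightarrow>
      emeasure (variation (cylinder \<Omega>) \<mu>) A \<le> emeasure (ref_measure \<Omega> (\<rho>, \<omega>, \<zeta>)) A"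
proof -
  define X where "X = cylinder \<Omega>"
  have m: "\<rho> \<in> signed_measures X" "\<And>i. \<omega> i \<in> signed_measures X" "\<zeta> \<in> signed_measures X"
    using assms by (auto simp: triples_def X_def)
  define v where "v \<mu> A = emeasure (pos_part X \<mu>) A + emeasure (neg_part X \<mu>) A" for \<mu> and A :: "'d spacetime set"
  define F where "F A = v \<rho> A + (\<Sum>i\<in>UNIV. v (\<omega> i) A) + v \<zeta> A" for A
  have ref: "ref_measure \<Omega> (\<rho>, \<omega>, \<zeta>) = measure_of X (borel_sets_on X) F"
    unfolding ref_measure_def F_def v_def X_def[symmetric] Let_def by simp
  show s: "sets (ref_measure \<Omega> (\<rho>, \<omega>, \<zeta>)) = borel_sets_on (cylinder \<Omega>)"
    unfolding ref X_def[symmetric] by (simp add: sigma_sets_borel_on borel_on_Pow sets_measure_of)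
  have sp: "space (ref_measure \<Omega> (\<rho>, \<omega>, \<zeta>)) = X"
    unfolding ref by (simp add: borel_on_Pow space_measure_of)
  have v: "v \<mu> A = emeasure (variation X \<mu>) A" if "A \<in> borel_sets_on X" for A \<mu>
    using that by (simp add: v_def emeasure_add_measure)
  have ca: "countably_additive (borel_sets_on X) F"
    unfolding countably_additive_def
  proof (intro allI impI)
    fix A :: "nat \<Rightarrow> _" assume A: "range A \<subseteq> borel_sets_on X" "disjoint_family A"
    have vA: "(\<Sum>n. v \<mu> (A n)) = v \<mu> (\<Union>n. A n)" for \<mu>
      using A by (simp add: v_def suminf_add[symmetric] suminf_emeasure)
    have "(\<Sum>n. F (A n)) = (\<Sum>n. v \<rho> (A n)) + (\<Sum>i\<in>UNIV. (\<Sum>n. v (\<omega> i) (A n))) + (\<Sum>n. v \<zeta> (A n))"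
      unfolding F_def by (simp add: suminf_add[symmetric] suminf_sum)
    then show "(\<Sum>n. F (A n)) = F (\<Union>n. A n)" by (simp only: vA F_def)
  qed
  have em: "emeasure (ref_measure \<Omega> (\<rho>, \<omega>, \<zeta>)) A = F A" if "A \<in> borel_sets_on X" for A
    unfolding ref using that ca
    by (intro emeasure_measure_of_sigma sigma_algebra_borel_on) (auto simp: positive_def F_def v_def)
  have fv: "v \<mu> X \<noteq> top" if "\<mu> \<in> signed_measures X" for \<mu>
    using finite_measure.emeasure_finite[OF finite_measure_variation[OF that]] by (simp add: v)
  show "finite_measure (ref_measure \<Omega> (\<rho>, \<omega>, \<zeta>))"
    using fv m by (intro finite_measureI) (auto simp: sp em F_def)
  assume A: "A \<in> borel_sets_on (cylinder \<Omega>)" and \<mu>: "\<mu> \<in> insert \<rho> (insert \<zeta> (range \<omega>))"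
  have sm: "v (\<omega> i) A \<le> (\<Sum>i\<in>UNIV. v (\<omega> i) A)" for i
    by (rule member_le_sum) auto
  have "v \<mu> A \<le> F A"
    using \<mu> order_trans[OF sm] by (auto simp: F_def intro: add_increasing add_increasing2)
  then show "emeasure (variation (cylinder \<Omega>) \<mu>) A \<le> emeasure (ref_measure \<Omega> (\<rho>, \<omega>, \<zeta>)) A"
    using A by (simp add: em v X_def)
qed

definition pairing :: "'a::topological_space set \<Rightarrow> 'a smeasure \<Rightarrow> ('d::finite \<Rightarrow> 'a smeasure) \<Rightarrow> 'a smeasure
    \<Rightarrow> ('a \<Rightarrow> real) \<Rightarrow> ('d \<Rightarrow> 'a \<Rightarrow> real) \<Rightarrow> ('a \<Rightarrow> real) \<Rightarrow> real" where
  "pairing X \<rho> \<omega> \<zeta> a b c = signed_integral X \<rho> a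
     + (\<Sum>i\<in>UNIV. signed_integral X (\<omega> i) (b i)) + signed_integral X \<zeta> c"

text \<open>The multipliers take their values in the paraboloid whose support function is \<open>f_delta\<close>.\<close>

definition admissible :: "'a::topological_space set \<Rightarrow> real \<Rightarrow> ('a \<Rightarrow> real) \<Rightarrow> ('d::finite \<Rightarrow> 'a \<Rightarrow> real)
    \<Rightarrow> ('a \<Rightarrow> real) \<Rightarrow> bool" where
  "admissible X \<delta> a b c \<longleftrightarrow> continuous_on X a \<and> (\<forall>i. continuous_on X (b i)) \<and> continuous_on X c \<and>
     (\<forall>p\<in>X. a p + ((\<Sum>i\<in>UNIV. (b i p)\<^sup>2) + (c p)\<^sup>2 / \<delta>\<^sup>2) / 2 \<le> 0)"

lemma abs_half_sum_le:
  fixes S T u :: real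
  assumes "S \<le> S'" "T \<le> T'" "0 \<le> S" "0 \<le> T" "0 \<le> u \<and> u \<le> u'"
  shows "\<bar>- ((S + T) / 2) - u\<bar> \<le> S' + T' + u'"
  unfolding add_divide_distrib using assms by (intro abs_leI) linarith+

text \<open>A bound that holds for continuous admissible multipliers extends to bounded Borel ones. The
  components \<open>b\<close>, \<open>c\<close> and the slack \<open>e\<close> are approximated separately, with the same bounds, and \<open>a\<close>
  is recomputed from them, so that the approximations stay admissible.\<close>

lemma admissible_pairing_le_Borel:
  fixes X :: "'a::euclidean_space set" and \<omega> :: "'d::finite \<Rightarrow> 'a smeasure"
  assumes X: "compact X" and \<delta>: "\<delta> > 0"
    and fin: "finite_measure M" and s: "sets M = borel_sets_on X"
    and \<mu>: "\<rho> \<in> signed_measures X" "\<And>i. \<omega> i \<in> signed_measures X" "\<zeta> \<in> signed_measures X"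
    and dom: "\<And>A \<mu>. A \<in> borel_sets_on X \<Longrightarrow> \<mu> \<in> insert \<rho> (insert \<zeta> (range \<omega>)) \<Longrightarrow>
      emeasure (variation X \<mu>) A \<le> emeasure M A"
    and le: "\<And>a b c. admissible X \<delta> a b c \<Longrightarrow> pairing X \<rho> \<omega> \<zeta> a b c \<le> C"
    and mb: "\<And>i. b i \<in> borel_measurable (restrict_space borel X)" "c \<in> borel_measurable (restrict_space borel X)"
       "e \<in> borel_measurable (restrict_space borel X)"
    and bd: "\<And>i x. x \<in> X \<Longrightarrow> \<bar>b i x\<bar> \<le> B" "\<And>x. x \<in> X \<Longrightarrow> \<bar>c x\<bar> \<le> B"
       "\<And>x. x \<in> X \<Longrightarrow> 0 \<le> e x \<and> e x \<le> B"
    and B: "0 \<le> B"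
  shows "pairing X \<rho> \<omega> \<zeta> (\<lambda>x. - (((\<Sum>i\<in>UNIV. (b i x)\<^sup>2) + (c x)\<^sup>2 / \<delta>\<^sup>2) / 2) - e x) b c \<le> C"
proof -
  note mb[measurable]
  define N where "N = real CARD('d)"
  define K where "K = (N * B + B / \<delta>\<^sup>2 + 1) + N + 1"
  have K: "K > 0" using B by (auto simp: K_def N_def intro!: add_nonneg_pos add_nonneg_nonneg)
  define P where "P b c e = (\<lambda>x. - (((\<Sum>i\<in>UNIV. (b i x)\<^sup>2) + (c x)\<^sup>2 / \<delta>\<^sup>2) / 2) - e x)"
    for b :: "'d \<Rightarrow> 'a \<Rightarrow> real" and c e :: "'a \<Rightarrow> real"
  interpret finite_measure M by fact
  have sp: "space M = X" using sets_eq_imp_space_eq[OF s] by simp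
  have ms: "borel_measurable M = borel_measurable (restrict_space borel X)" 
    by (rule measurable_cong_sets[OF s refl])
  have ib: "integrable M f" if "f \<in> borel_measurable (restrict_space borel X)" "\<And>x. x \<in> X \<Longrightarrow> \<bar>f x\<bar> \<le> D"
    for f :: "'a \<Rightarrow> real" and D
    using that by (intro integrable_const_bound[where B=D]) (auto simp: sp ms intro!: AE_I2)
  have "pairing X \<rho> \<omega> \<zeta> (P b c e) b c \<le> C + \<eta>" if \<eta>: "\<eta> > 0" for \<eta>
  proof -
    define \<epsilon> where "\<epsilon> = \<eta> / K"
    have \<epsilon>: "\<epsilon> > 0" using \<eta> K by (simp add: \<epsilon>_def)
    have BB: "- B \<le> B" using B by simp
    have "\<exists>h. continuous_on X h \<and> (\<forall>x. h x \<in> {-B..B}) \<and> (\<integral>x. \<bar>b i x - h x\<bar> \<partial>M) < \<epsilon>" for i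
    proof -
      have "b i x \<in> {-B..B}" if "x \<in> X" for x using bd(1)[OF that, of i] by auto
      from approx_bounded_by_continuous[OF X fin s mb(1) this BB \<epsilon>] show ?thesis by metis
    qed
    then obtain b' where b': "\<And>i. continuous_on X (b' i)" "\<And>i x. b' i x \<in> {-B..B}" "\<And>i. (\<integral>x. \<bar>b i x - b' i x\<bar> \<partial>M) < \<epsilon>"
      by metis
    have cB: "c x \<in> {-B..B}" if "x \<in> X" for x using bd(2)[OF that] by auto
    obtain c' where c': "continuous_on X c'" "\<And>x. c' x \<in> {-B..B}" "(\<integral>x. \<bar>c x - c' x\<bar> \<partial>M) < \<epsilon>"
      using approx_bounded_by_continuous[OF X fin s mb(2) cB BB \<epsilon>] by metis
    have eB: "e x \<in> {0..B}" if "x \<in> X" for x using bd(3)[OF that] by auto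
    obtain e' where e': "continuous_on X e'" "\<And>x. e' x \<in> {0..B}" "(\<integral>x. \<bar>e x - e' x\<bar> \<partial>M) < \<epsilon>"
      using approx_bounded_by_continuous[OF X fin s mb(3) eB B \<epsilon>] by metis
    have cP: "continuous_on X (P b' c' e')" unfolding P_def using b'(1) c'(1) e'(1) \<delta> by (intro continuous_intros) auto
    have "P b' c' e' p + ((\<Sum>i\<in>UNIV. (b' i p)\<^sup>2) + (c' p)\<^sup>2 / \<delta>\<^sup>2) / 2 \<le> 0" for p
      using e'(2)[of p] unfolding P_def atLeastAtMost_iff by linarith
    then have "admissible X \<delta> (P b' c' e') b' c'"
      using b'(1) c'(1) cP by (simp add: admissible_def)
    then have main: "pairing X \<rho> \<omega> \<zeta> (P b' c' e') b' c' \<le> C" by (rule le)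
    have i_c: "integrable M f" if "continuous_on X f" for f :: "'a \<Rightarrow> real"
      by (rule integrable_continuous_on[OF fin s X that])
    have i_b: "integrable M (b i)" "integrable M c" "integrable M e" for i
      using ib[OF mb(1) bd(1)] ib[OF mb(2) bd(2)] ib[OF mb(3), of B] bd(3) by auto
    have sq: "\<bar>u\<^sup>2 - v\<^sup>2\<bar> \<le> 2 * B * \<bar>u - v\<bar>" if "\<bar>u\<bar> \<le> B" "\<bar>v\<bar> \<le> B" for u v
    proof -
      have "\<bar>u\<^sup>2 - v\<^sup>2\<bar> = \<bar>u + v\<bar> * \<bar>u - v\<bar>" by (simp add: abs_mult[symmetric] algebra_simps power2_eq_square)
      also have "\<dots> \<le> (2 * B) * \<bar>u - v\<bar>" using that by (intro mult_right_mono) auto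
      finally show ?thesis .
    qed
    have diffP: "\<bar>P b c e x - P b' c' e' x\<bar> \<le> (\<Sum>i\<in>UNIV. B * \<bar>b i x - b' i x\<bar>) + B / \<delta>\<^sup>2 * \<bar>c x - c' x\<bar> + \<bar>e x - e' x\<bar>"
      if x: "x \<in> X" for x
    proof -
      have 1: "\<bar>(\<Sum>i\<in>UNIV. (b i x)\<^sup>2) - (\<Sum>i\<in>UNIV. (b' i x)\<^sup>2)\<bar> \<le> (\<Sum>i\<in>UNIV. 2 * B * \<bar>b i x - b' i x\<bar>)"
        unfolding sum_subtractf[symmetric] using bd(1)[OF x] b'(2)
        by (intro order_trans[OF sum_abs] sum_mono sq) (auto simp: abs_le_iff minus_le_iff)
      have "\<bar>(c x)\<^sup>2 - (c' x)\<^sup>2\<bar> \<le> 2 * B * \<bar>c x - c' x\<bar>"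
        using bd(2)[OF x] c'(2)[of x] by (intro sq) auto
      then have "\<bar>(c x)\<^sup>2 - (c' x)\<^sup>2\<bar> / \<delta>\<^sup>2 \<le> (2 * B * \<bar>c x - c' x\<bar>) / \<delta>\<^sup>2"
        by (intro divide_right_mono) auto
      then have 2: "\<bar>(c x)\<^sup>2 / \<delta>\<^sup>2 - (c' x)\<^sup>2 / \<delta>\<^sup>2\<bar> \<le> 2 * (B / \<delta>\<^sup>2 * \<bar>c x - c' x\<bar>)"
        by (simp add: diff_divide_distrib[symmetric])
      have 3: "(\<Sum>i\<in>UNIV. 2 * B * \<bar>b i x - b' i x\<bar>) = 2 * (\<Sum>i\<in>UNIV. B * \<bar>b i x - b' i x\<bar>)"
        by (simp add: sum_distrib_left mult.assoc)
      have lin: "\<bar>(- ((S + T) / 2) - u) - (- ((S' + T') / 2) - u')\<bar> \<le> s + t + \<bar>u - u'\<bar>"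
        if "\<bar>S - S'\<bar> \<le> 2 * s" "\<bar>T - T'\<bar> \<le> 2 * t" for S S' T T' s t u u' :: real
        using that unfolding add_divide_distrib by linarith
      show ?thesis unfolding P_def by (rule lin[OF 1[unfolded 3] 2])
    qed
    have iP: "integrable M (P b c e)"
    proof (rule ib)
      show "P b c e \<in> borel_measurable (restrict_space borel X)" unfolding P_def by measurable
      fix x assume x: "x \<in> X"
      have "(\<Sum>i\<in>UNIV. (b i x)\<^sup>2) \<le> (\<Sum>i\<in>(UNIV::'d set). B\<^sup>2)"
        using bd(1)[OF x] B by (intro sum_mono) (simp add: abs_le_square_iff[symmetric])
      moreover have "(c x)\<^sup>2 / \<delta>\<^sup>2 \<le> B\<^sup>2 / \<delta>\<^sup>2"
        using bd(2)[OF x] B by (intro divide_right_mono) (simp_all add: abs_le_square_iff[symmetric])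
      moreover have "0 \<le> (\<Sum>i\<in>UNIV. (b i x)\<^sup>2)" "0 \<le> (c x)\<^sup>2 / \<delta>\<^sup>2" by (auto intro: sum_nonneg)
      ultimately show "\<bar>P b c e x\<bar> \<le> (\<Sum>i\<in>(UNIV::'d set). B\<^sup>2) + B\<^sup>2 / \<delta>\<^sup>2 + B"
        using bd(3)[OF x] unfolding P_def by (intro abs_half_sum_le)
    qed
    have d1: "\<bar>signed_integral X \<rho> (\<lambda>x. P b c e x - P b' c' e' x)\<bar> \<le> (N * B + B / \<delta>\<^sup>2 + 1) * \<epsilon>"
    proof -
      have "\<bar>signed_integral X \<rho> (\<lambda>x. P b c e x - P b' c' e' x)\<bar> \<le> (\<integral>x. \<bar>P b c e x - P b' c' e' x\<bar> \<partial>M)"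
        by (intro abs_signed_integral_le_dominating[OF \<mu>(1) s dom] Bochner_Integration.integrable_diff iP i_c cP) auto
      also have "\<dots> \<le> (\<integral>x. (\<Sum>i\<in>UNIV. B * \<bar>b i x - b' i x\<bar>) + B / \<delta>\<^sup>2 * \<bar>c x - c' x\<bar> + \<bar>e x - e' x\<bar> \<partial>M)"
        by (intro integral_mono diffP)
          (use iP i_c[OF cP] i_b i_c[OF b'(1)] i_c[OF c'(1)] i_c[OF e'(1)] sp in auto)
      also have "\<dots> = (\<Sum>i\<in>UNIV. B * (\<integral>x. \<bar>b i x - b' i x\<bar> \<partial>M)) + B / \<delta>\<^sup>2 * (\<integral>x. \<bar>c x - c' x\<bar> \<partial>M) + (\<integral>x. \<bar>e x - e' x\<bar> \<partial>M)"
        using i_b i_c[OF b'(1)] i_c[OF c'(1)] i_c[OF e'(1)]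
        by (simp add: Bochner_Integration.integral_sum)
      also have "\<dots> \<le> (\<Sum>i\<in>(UNIV::'d set). B * \<epsilon>) + B / \<delta>\<^sup>2 * \<epsilon> + \<epsilon>"
        using b'(3) c'(3) e'(3) B by (intro add_mono sum_mono mult_left_mono) (auto simp: less_imp_le)
      also have "\<dots> = (N * B + B / \<delta>\<^sup>2 + 1) * \<epsilon>" by (simp add: N_def algebra_simps)
      finally show ?thesis .
    qed
    have d2: "\<bar>signed_integral X (\<omega> i) (\<lambda>x. b i x - b' i x)\<bar> \<le> \<epsilon>" for i
      by (rule order_trans[OF abs_signed_integral_le_dominating[OF \<mu>(2) s dom]])
        (use i_b i_c[OF b'(1)] b'(3)[of i] in auto)
    have d3: "\<bar>signed_integral X \<zeta> (\<lambda>x. c x - c' x)\<bar> \<le> \<epsilon>"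
      by (rule order_trans[OF abs_signed_integral_le_dominating[OF \<mu>(3) s dom]])
        (use i_b i_c[OF c'(1)] c'(3) in auto)
    have si: "signed_integrable X \<mu>' f" if f: "integrable M f" and \<mu>': "\<mu>' \<in> insert \<rho> (insert \<zeta> (range \<omega>))" for f \<mu>'
    proof -
      have iv: "integrable (variation X \<mu>') f"
        by (rule integrable_mono_measure[OF _ _ f]) (use s dom \<mu>' in auto)
      show ?thesis unfolding signed_integrable_def
        by (intro conjI integrable_mono_measure[OF _ _ iv]) (auto simp: emeasure_add_measure)
    qed
    have "pairing X \<rho> \<omega> \<zeta> (P b c e) b c - pairing X \<rho> \<omega> \<zeta> (P b' c' e') b' c'
      = signed_integral X \<rho> (\<lambda>x. P b c e x - P b' c' e' x)
        + (\<Sum>i\<in>UNIV. signed_integral X (\<omega> i) (\<lambda>x. b i x - b' i x)) + signed_integral X \<zeta> (\<lambda>x. c x - c' x)"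
      using iP i_b i_c[OF cP] i_c[OF b'(1)] i_c[OF c'(1)]
      by (simp add: pairing_def si signed_integral_sub sum_subtractf)
    also have "\<dots> \<le> (N * B + B / \<delta>\<^sup>2 + 1) * \<epsilon> + (\<Sum>i\<in>(UNIV::'d set). \<epsilon>) + \<epsilon>"
      using d1 d2 d3 by (intro add_mono sum_mono) (auto simp: abs_le_iff)
    also have "\<dots> = K * \<epsilon>" by (simp add: K_def N_def algebra_simps)
    also have "\<dots> = \<eta>" using K by (simp add: \<epsilon>_def)
    finally show ?thesis using main by linarith
  qed
  then show ?thesis unfolding P_def[symmetric] by (rule field_le_epsilon)
qed


text \<open>Multipliers can be scaled arbitrarily where this costs nothing; an integral that stays bounded
  under such a scaling vanishes.\<close>

lemma AE_zero_of_scaled_integral_bounded: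
  fixes g :: "'a \<Rightarrow> real"
  assumes g: "integrable M g" and nn: "\<And>x. x \<in> space M \<Longrightarrow> 0 \<le> g x" and le: "\<And>t. 0 < t \<Longrightarrow> t * (\<integral>x. g x \<partial>M) \<le> C"
  shows "AE x in M. g x = 0"
proof -
  have "(\<integral>x. g x \<partial>M) \<le> 0"
  proof (rule ccontr)
    assume "\<not> ?thesis"
    then have p: "0 < (\<integral>x. g x \<partial>M)" by simp
    have "(\<bar>C\<bar> + 1) / (\<integral>x. g x \<partial>M) * (\<integral>x. g x \<partial>M) \<le> C"
      using p by (intro le) auto
    then show False using p by simp
  qed
  moreover have "0 \<le> (\<integral>x. g x \<partial>M)" using nn by (intro integral_nonneg_AE AE_I2)
  ultimately have "(\<integral>x. g x \<partial>M) = 0" by simp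
  then show ?thesis using integral_nonneg_eq_0_iff_AE[OF g] nn by (auto intro: AE_I2)
qed

lemma norm_vec_lambda_power2: "(norm ((\<chi> i. w i) :: real ^ _))\<^sup>2 = (\<Sum>i\<in>UNIV. (w i)\<^sup>2)"
  by (simp add: norm_vec_def L2_set_def sum_nonneg)

lemma f_delta_vec_lambda:
  assumes "\<delta> > 0"
  shows "f_delta \<delta> x (\<chi> i. w i) z = (if x > 0 then ennreal (((\<Sum>i\<in>UNIV. (w i)\<^sup>2) + \<delta>\<^sup>2 * z\<^sup>2) / (2 * x))
     else if x = 0 \<and> (\<Sum>i\<in>UNIV. (w i)\<^sup>2) + \<delta>\<^sup>2 * z\<^sup>2 = 0 then 0 else top)"
proof -
  have "(\<chi> i. w i) = 0 \<and> z = 0 \<longleftrightarrow> (\<Sum>i\<in>UNIV. (w i)\<^sup>2) + \<delta>\<^sup>2 * z\<^sup>2 = 0"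
    using assms by (simp add: vec_eq_iff add_nonneg_eq_0_iff sum_nonneg sum_nonneg_eq_0_iff)
  then show ?thesis unfolding f_delta_def norm_vec_lambda_power2 by auto
qed

text \<open>The convex conjugate of \<open>f_delta\<close> is the indicator function of the set of admissible
  multipliers, so that Fenchel's inequality takes the following form.\<close>

lemma Fenchel_f_delta:
  fixes \<beta> w :: "'d::finite \<Rightarrow> real"
  assumes \<delta>: "\<delta> > 0" and adm: "\<alpha> + ((\<Sum>i\<in>UNIV. (\<beta> i)\<^sup>2) + \<gamma>\<^sup>2 / \<delta>\<^sup>2) / 2 \<le> 0"
  shows "ennreal (\<alpha> * x + (\<Sum>i\<in>UNIV. \<beta> i * w i) + \<gamma> * z) \<le> f_delta \<delta> x (\<chi> i. w i) z"
proof -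
  have "f_delta \<delta> x (\<chi> i. w i) z = top" if "\<not> x > 0" "\<not> (x = 0 \<and> (\<forall>i. w i = 0) \<and> z = 0)"
    using that by (auto simp: f_delta_def vec_eq_iff)
  then consider "x > 0" | "x = 0" "\<And>i. w i = 0" "z = 0" | "f_delta \<delta> x (\<chi> i. w i) z = top"
    by blast
  then show ?thesis
  proof cases
    case 1
    have 2: "\<beta> i * w i \<le> (\<beta> i)\<^sup>2 / 2 * x + (w i)\<^sup>2 / (2 * x)" for i
    proof -
      have "0 \<le> (\<beta> i * x - w i)\<^sup>2 / (2 * x)" using 1 by simp
      also have "\<dots> = (\<beta> i)\<^sup>2 / 2 * x + (w i)\<^sup>2 / (2 * x) - \<beta> i * w i"
        using 1 by (simp add: power2_eq_square field_simps)
      finally show ?thesis by simp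
    qed
    have 3: "\<gamma> * z \<le> \<gamma>\<^sup>2 / \<delta>\<^sup>2 / 2 * x + \<delta>\<^sup>2 * z\<^sup>2 / (2 * x)"
    proof -
      have "0 \<le> (\<gamma> / \<delta> * x - \<delta> * z)\<^sup>2 / (2 * x)" using 1 by simp
      also have "\<dots> = \<gamma>\<^sup>2 / \<delta>\<^sup>2 / 2 * x + \<delta>\<^sup>2 * z\<^sup>2 / (2 * x) - \<gamma> * z"
        using 1 \<delta> by (simp add: power2_eq_square field_simps)
      finally show ?thesis by simp
    qed
    have "\<alpha> * x + (\<Sum>i\<in>UNIV. \<beta> i * w i) + \<gamma> * z
        \<le> - (((\<Sum>i\<in>UNIV. (\<beta> i)\<^sup>2) + \<gamma>\<^sup>2 / \<delta>\<^sup>2) / 2) * x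
          + (\<Sum>i\<in>UNIV. (\<beta> i)\<^sup>2 / 2 * x + (w i)\<^sup>2 / (2 * x)) + (\<gamma>\<^sup>2 / \<delta>\<^sup>2 / 2 * x + \<delta>\<^sup>2 * z\<^sup>2 / (2 * x))"
      using adm 1 by (intro add_mono sum_mono 2 3 mult_right_mono) auto
    also have "(\<Sum>i\<in>UNIV. (\<beta> i)\<^sup>2 / 2 * x + (w i)\<^sup>2 / (2 * x))
        = (\<Sum>i\<in>UNIV. (\<beta> i)\<^sup>2) / 2 * x + (\<Sum>i\<in>UNIV. (w i)\<^sup>2) / (2 * x)"
      by (simp add: sum.distrib sum_divide_distrib sum_distrib_right)
    also have "- (((\<Sum>i\<in>UNIV. (\<beta> i)\<^sup>2) + \<gamma>\<^sup>2 / \<delta>\<^sup>2) / 2) * x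
          + ((\<Sum>i\<in>UNIV. (\<beta> i)\<^sup>2) / 2 * x + (\<Sum>i\<in>UNIV. (w i)\<^sup>2) / (2 * x))
          + (\<gamma>\<^sup>2 / \<delta>\<^sup>2 / 2 * x + \<delta>\<^sup>2 * z\<^sup>2 / (2 * x))
        = ((\<Sum>i\<in>UNIV. (w i)\<^sup>2) + \<delta>\<^sup>2 * z\<^sup>2) / (2 * x)"
      by (simp add: add_divide_distrib algebra_simps)
    finally show ?thesis using 1 by (simp add: f_delta_vec_lambda[OF \<delta>] ennreal_leI)
  qed simp_all
qed

text \<open>The dual description of the action. The implication from left to right is Fenchel's inequality.
  For the converse, bounded Borel multipliers that live where the density \<open>r\<close> of \<open>\<rho>\<close> is negative
  show that \<open>r\<close> is nonnegative, those that live where \<open>r = 0\<close> show that the other densities vanish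
  there, and where \<open>r\<close> is positive the optimal multipliers, truncated to be bounded, attain the
  integrand; the truncation is removed by Fatou's lemma.\<close>

lemma D_le_iff:
  fixes \<Omega> :: "(real ^ 'd::finite) set"
  assumes \<Omega>: "bounded \<Omega>" and tr: "(\<rho>, \<omega>, \<zeta>) \<in> triples \<Omega>" and \<delta>: "\<delta> > 0" and C: "0 \<le> C"
  shows "D \<Omega> \<delta> (\<rho>, \<omega>, \<zeta>) \<le> ennreal C \<longleftrightarrow>
    (\<forall>a b c. admissible (cylinder \<Omega>) \<delta> a b c \<longrightarrow> pairing (cylinder \<Omega>) \<rho> \<omega> \<zeta> a b c \<le> C)"
proof -
  define X where "X = cylinder \<Omega>"
  have X: "compact X" unfolding X_def using \<Omega> by (intro compact_Times) auto
  define M where "M = ref_measure \<Omega> (\<rho>, \<omega>, \<zeta>)"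
  have s: "sets M = borel_sets_on X" and fin: "finite_measure M"
    and dom: "\<And>A \<mu>. A \<in> borel_sets_on X \<Longrightarrow> \<mu> \<in> insert \<rho> (insert \<zeta> (range \<omega>)) \<Longrightarrow>
      emeasure (variation X \<mu>) A \<le> emeasure M A"
    unfolding M_def X_def by (rule sets_ref_measure[OF tr] finite_ref_measure[OF tr] variation_le_ref_measure[OF tr])+
  interpret finite_measure M by (rule fin)
  have sp: "space M = X" using sets_eq_imp_space_eq[OF s] by simp
  have ms: "borel_measurable M = borel_measurable (restrict_space borel X)" 
    by (rule measurable_cong_sets[OF s refl])
  have \<mu>: "\<rho> \<in> signed_measures X" "\<And>i. \<omega> i \<in> signed_measures X" "\<zeta> \<in> signed_measures X"
    using tr by (auto simp: triples_def X_def)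
  define r where "r = signed_RN_deriv X M \<rho>"
  define w where "w i = signed_RN_deriv X M (\<omega> i)" for i
  define z where "z = signed_RN_deriv X M \<zeta>"
  have [measurable]: "r \<in> borel_measurable M" "\<And>i. w i \<in> borel_measurable M" "z \<in> borel_measurable M"
    unfolding r_def w_def z_def using \<mu> by (auto intro!: borel_measurable_signed_RN_deriv[OF _ fin s dom])
  have bint: "signed_integrable X \<mu>' f" "f \<in> borel_measurable M"
    if "\<mu>' \<in> signed_measures X" "f \<in> borel_measurable M" "\<And>x. x \<in> X \<Longrightarrow> \<bar>f x\<bar> \<le> B" for f \<mu>' and B :: real
    using that signed_integrable_bounded[OF that(1) _ that(3)] by (auto simp: ms)
  have dens: "integrable M (\<lambda>p. f p * r p) \<and> signed_integral X \<rho> f = (\<integral>p. f p * r p \<partial>M)"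
    "integrable M (\<lambda>p. f p * w i p) \<and> signed_integral X (\<omega> i) f = (\<integral>p. f p * w i p \<partial>M)"
    "integrable M (\<lambda>p. f p * z p) \<and> signed_integral X \<zeta> f = (\<integral>p. f p * z p \<partial>M)"
    if "f \<in> borel_measurable M" "\<And>x. x \<in> X \<Longrightarrow> \<bar>f x\<bar> \<le> B" for f i and B :: real
    unfolding r_def w_def z_def
    using bint[OF \<mu>(1) that] bint[OF \<mu>(2)[of i] that] bint[OF \<mu>(3) that] \<mu>
    by (auto intro!: integrable_signed_RN_deriv[OF _ fin s dom] signed_integral_RN_deriv[OF _ fin s dom])
  have pair_dens: "integrable M (\<lambda>p. a p * r p + (\<Sum>i\<in>UNIV. b i p * w i p) + c p * z p)"
      "pairing X \<rho> \<omega> \<zeta> a b c = (\<integral>p. a p * r p + (\<Sum>i\<in>UNIV. b i p * w i p) + c p * z p \<partial>M)"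
    if "a \<in> borel_measurable M" "\<And>i. b i \<in> borel_measurable M" "c \<in> borel_measurable M"
       "\<And>x. x \<in> X \<Longrightarrow> \<bar>a x\<bar> \<le> B" "\<And>i x. x \<in> X \<Longrightarrow> \<bar>b i x\<bar> \<le> B" "\<And>x. x \<in> X \<Longrightarrow> \<bar>c x\<bar> \<le> B"
    for a b c and B :: real
    using dens(1)[OF that(1,4)] dens(2)[OF that(2,5)] dens(3)[OF that(3,6)]
    by (auto simp: pairing_def Bochner_Integration.integral_sum)
  define Q where "Q p = (\<Sum>i\<in>UNIV. (w i p)\<^sup>2) + \<delta>\<^sup>2 * (z p)\<^sup>2" for p
  have Q0: "0 \<le> Q p" for p by (auto simp: Q_def intro!: add_nonneg_nonneg sum_nonneg)
  have [measurable]: "Q \<in> borel_measurable M" unfolding Q_def by measurable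
  define F where "F p = f_delta \<delta> (r p) (\<chi> i. w i p) (z p)" for p
  have F: "F p = (if r p > 0 then ennreal (Q p / (2 * r p)) else if r p = 0 \<and> Q p = 0 then 0 else top)" for p
    unfolding F_def Q_def by (rule f_delta_vec_lambda[OF \<delta>])
  have [measurable]: "F \<in> borel_measurable M" unfolding F[abs_def] by measurable
  have D: "D \<Omega> \<delta> (\<rho>, \<omega>, \<zeta>) = (\<integral>\<^sup>+p. F p \<partial>M)"
    by (simp add: D_def D_wrt_def M_def F_def r_def w_def z_def X_def)
  show ?thesis unfolding X_def[symmetric]
  proof (intro iffI allI impI)
    fix a c and b :: "'d \<Rightarrow> 'd spacetime \<Rightarrow> real"
    assume le: "D \<Omega> \<delta> (\<rho>, \<omega>, \<zeta>) \<le> ennreal C" and adm: "admissible X \<delta> a b c"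
    let ?g = "\<lambda>p. a p * r p + (\<Sum>i\<in>UNIV. b i p * w i p) + c p * z p"
    have cont: "continuous_on X a" "\<And>i. continuous_on X (b i)" "continuous_on X c"
      using adm by (auto simp: admissible_def)
    have bdd: "\<exists>B. \<forall>x\<in>X. \<bar>h x\<bar> \<le> B" if "continuous_on X h" for h :: "'d spacetime \<Rightarrow> real"
      using compact_imp_bounded[OF compact_continuous_image[OF that X]] by (auto simp: bounded_iff)
    obtain Ba Bb Bc where B: "\<And>x. x \<in> X \<Longrightarrow> \<bar>a x\<bar> \<le> Ba" "\<And>i x. x \<in> X \<Longrightarrow> \<bar>b i x\<bar> \<le> Bb i" "\<And>x. x \<in> X \<Longrightarrow> \<bar>c x\<bar> \<le> Bc"
      using bdd[OF cont(1)] bdd[OF cont(2)] bdd[OF cont(3)] by metis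
    have meas: "a \<in> borel_measurable M" "\<And>i. b i \<in> borel_measurable M" "c \<in> borel_measurable M"
      unfolding ms using cont by (auto intro: borel_measurable_continuous_on_restrict)
    have g: "integrable M ?g" "pairing X \<rho> \<omega> \<zeta> a b c = (\<integral>p. ?g p \<partial>M)"
      using dens(1)[OF meas(1) B(1)] dens(2)[OF meas(2) B(2)] dens(3)[OF meas(3) B(3)]
      by (auto simp: pairing_def Bochner_Integration.integral_sum)
    have "(\<integral>\<^sup>+p. ennreal (?g p) \<partial>M) \<le> (\<integral>\<^sup>+p. F p \<partial>M)"
      unfolding F_def using adm sp by (intro nn_integral_mono Fenchel_f_delta[OF \<delta>]) (auto simp: admissible_def)
    also have "\<dots> \<le> ennreal C" using le D by simp
    finally have "enn2real (\<integral>\<^sup>+p. ennreal (?g p) \<partial>M) \<le> enn2real (ennreal C)"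
      by (rule enn2real_mono) simp
    then have "enn2real (\<integral>\<^sup>+p. ennreal (?g p) \<partial>M) \<le> C" using C by simp
    moreover have "(\<integral>p. ?g p \<partial>M) \<le> enn2real (\<integral>\<^sup>+p. ennreal (?g p) \<partial>M)"
      by (subst real_lebesgue_integral_def[OF g(1)]) simp
    ultimately show "pairing X \<rho> \<omega> \<zeta> a b c \<le> C" using g(2) by simp
  next
    assume "\<forall>a b c. admissible X \<delta> a b c \<longrightarrow> pairing X \<rho> \<omega> \<zeta> a b c \<le> C"
    note le = this[rule_format]
    \<comment> \<open>All multipliers below have the form \<open>b = s w\<close>, \<open>c = \<delta>\<^sup>2 s z\<close>, with \<open>a\<close> equal to the largest
      admissible value minus \<open>e\<close>. Maximising the resulting integrand over \<open>s\<close> gives \<open>s = 1 / r\<close>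
      and the value \<open>Q / (2 r)\<close> of \<open>f_delta\<close>.\<close>
    have test: "integrable M (\<lambda>p. s p * Q p * (1 - s p * r p / 2) - e p * r p)"
        "(\<integral>p. s p * Q p * (1 - s p * r p / 2) - e p * r p \<partial>M) \<le> C"
      if s: "s \<in> borel_measurable M" and e: "e \<in> borel_measurable M"
        and bd: "\<And>i x. x \<in> X \<Longrightarrow> \<bar>s x * w i x\<bar> \<le> B" "\<And>x. x \<in> X \<Longrightarrow> \<bar>s x * z x\<bar> \<le> B"
          "\<And>x. x \<in> X \<Longrightarrow> 0 \<le> e x \<and> e x \<le> B" and B: "0 \<le> B" for s e B
    proof -
      note [measurable] = s e
      let ?b = "\<lambda>i x. s x * w i x" and ?c = "\<lambda>x. \<delta>\<^sup>2 * (s x * z x)"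
      let ?a = "\<lambda>x. - (((\<Sum>i\<in>UNIV. (?b i x)\<^sup>2) + (?c x)\<^sup>2 / \<delta>\<^sup>2) / 2) - e x"
      define B' where "B' = B + \<delta>\<^sup>2 * B"
      have B': "B \<le> B'" "\<delta>\<^sup>2 * B \<le> B'" "0 \<le> B'" using B by (auto simp: B'_def)
      have bb: "\<bar>?b i x\<bar> \<le> B'" "\<bar>?c x\<bar> \<le> B'" "0 \<le> e x \<and> e x \<le> B'" if "x \<in> X" for i x
      proof -
        have "\<bar>?c x\<bar> = \<delta>\<^sup>2 * \<bar>s x * z x\<bar>" by (simp add: abs_mult)
        also have "\<dots> \<le> \<delta>\<^sup>2 * B" using bd(2)[OF that] by (intro mult_left_mono) auto
        finally show "\<bar>?c x\<bar> \<le> B'" using B' by simp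
        show "\<bar>?b i x\<bar> \<le> B'" "0 \<le> e x \<and> e x \<le> B'" using bd(1)[OF that, of i] bd(3)[OF that] B' by auto
      qed
      have m: "?b i \<in> borel_measurable M" "?c \<in> borel_measurable M" "?a \<in> borel_measurable M" for i by measurable
      have p: "pairing X \<rho> \<omega> \<zeta> ?a ?b ?c \<le> C"
        by (rule admissible_pairing_le_Borel[OF X \<delta> fin \<open>sets M = borel_sets_on X\<close> \<mu> dom le _ _ _ bb B'(3)])
          (use m e in \<open>simp_all add: ms\<close>)
      have ab: "\<bar>?a x\<bar> \<le> (\<Sum>i\<in>(UNIV::'d set). B'\<^sup>2) + B'\<^sup>2 / \<delta>\<^sup>2 + B'" if x: "x \<in> X" for x
      proof -
        have "(\<Sum>i\<in>UNIV. (?b i x)\<^sup>2) \<le> (\<Sum>i\<in>(UNIV::'d set). B'\<^sup>2)"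
          using bb(1)[OF x] B' by (intro sum_mono) (simp only: abs_le_square_iff[symmetric] abs_of_nonneg)
        moreover have "(?c x)\<^sup>2 / \<delta>\<^sup>2 \<le> B'\<^sup>2 / \<delta>\<^sup>2"
          using bb(2)[OF x] B' by (intro divide_right_mono) (simp_all only: abs_le_square_iff[symmetric] abs_of_nonneg zero_le_power2)
        moreover have "0 \<le> (\<Sum>i\<in>UNIV. (?b i x)\<^sup>2)" "0 \<le> (?c x)\<^sup>2 / \<delta>\<^sup>2" by (auto intro: sum_nonneg)
        ultimately show ?thesis
          by (intro abs_half_sum_le bb(3)[OF x])
      qed
      let ?B = "(\<Sum>i\<in>(UNIV::'d set). B'\<^sup>2) + B'\<^sup>2 / \<delta>\<^sup>2 + B'"
      have "B' \<le> ?B" by (auto intro!: add_nonneg_nonneg sum_nonneg)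
      then have bb': "\<bar>?b i x\<bar> \<le> ?B" "\<bar>?c x\<bar> \<le> ?B" if "x \<in> X" for i x
        using bb(1)[OF that, of i] bb(2)[OF that] by linarith+
      have eq: "?a x * r x + (\<Sum>i\<in>UNIV. ?b i x * w i x) + ?c x * z x = s x * Q x * (1 - s x * r x / 2) - e x * r x" for x
      proof -
        have 1: "(\<Sum>i\<in>UNIV. (?b i x)\<^sup>2) = (s x)\<^sup>2 * (\<Sum>i\<in>UNIV. (w i x)\<^sup>2)"
          by (simp add: power_mult_distrib sum_distrib_left)
        have 2: "(\<Sum>i\<in>UNIV. ?b i x * w i x) = s x * (\<Sum>i\<in>UNIV. (w i x)\<^sup>2)"
          by (simp add: power2_eq_square sum_distrib_left mult.assoc)
        have 3: "(?c x)\<^sup>2 / \<delta>\<^sup>2 = (s x)\<^sup>2 * (\<delta>\<^sup>2 * (z x)\<^sup>2)"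
          using \<delta> by (simp add: power2_eq_square)
        show ?thesis unfolding 1 2 3 Q_def by (simp add: power2_eq_square algebra_simps add_divide_distrib)
      qed
      show "integrable M (\<lambda>p. s p * Q p * (1 - s p * r p / 2) - e p * r p)"
        unfolding eq[symmetric]
        by (rule pair_dens(1); (rule m | erule ab bb'))
      have "pairing X \<rho> \<omega> \<zeta> ?a ?b ?c = (\<integral>p. s p * Q p * (1 - s p * r p / 2) - e p * r p \<partial>M)"
        unfolding eq[symmetric]
        by (rule pair_dens(2); (rule m | erule ab bb'))
      then show "(\<integral>p. s p * Q p * (1 - s p * r p / 2) - e p * r p \<partial>M) \<le> C"
        using p by simp
    qed
    have "AE p in M. indicator {p. r p < 0} p * - r p = 0"
    proof (rule AE_zero_of_scaled_integral_bounded)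
      show "integrable M (\<lambda>p. indicator {p. r p < 0} p * - r p)"
        using test(1)[of "\<lambda>_. 0" "\<lambda>p. indicator {p. r p < 0} p" 1] by (auto simp: indicator_def)
      fix t :: real assume t: "0 < t"
      show "t * (\<integral>p. indicator {p. r p < 0} p * - r p \<partial>M) \<le> C"
        using test(2)[of "\<lambda>_. 0" "\<lambda>p. t * indicator {p. r p < 0} p" t] t
        by (simp add: mult.assoc indicator_def)
    qed (auto simp: indicator_def)
    then have AE1: "AE p in M. 0 \<le> r p" by eventually_elim (auto simp: indicator_def split: if_splits)
    define H where "H n = {p. \<bar>z p\<bar> \<le> real n \<and> (\<forall>i. \<bar>w i p\<bar> \<le> real n)}" for n
    have H_ev: "\<exists>n. \<forall>m\<ge>n. p \<in> H m" for p
    proof -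
      obtain n where "\<bar>z p\<bar> + (\<Sum>i\<in>UNIV. \<bar>w i p\<bar>) \<le> real n" using real_arch_simple by blast
      moreover have "\<bar>w i p\<bar> \<le> (\<Sum>i\<in>UNIV. \<bar>w i p\<bar>)" for i by (rule member_le_sum) auto
      moreover have "0 \<le> (\<Sum>i\<in>UNIV. \<bar>w i p\<bar>)" by (rule sum_nonneg) auto
      ultimately have "p \<in> H m" if "m \<ge> n" for m using that unfolding H_def
        by simp (smt (verit) of_nat_mono)
      then show ?thesis by blast
    qed
    have [measurable]: "Measurable.pred M (\<lambda>p. p \<in> H n)" for n unfolding H_def by measurable
    have "AE p in M. \<forall>n. indicator {p. r p = 0 \<and> p \<in> H n} p * Q p = 0"
      unfolding AE_all_countable
    proof
      fix n
      let ?s = "\<lambda>p. indicator {p. r p = 0 \<and> p \<in> H n} p :: real"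
      have eq: "t * ?s p * Q p * (1 - t * ?s p * r p / 2) - 0 * r p = t * (?s p * Q p)" for t p
        by (simp add: indicator_def)
      have bd: "\<bar>t * ?s p * w i p\<bar> \<le> t * real n" "\<bar>t * ?s p * z p\<bar> \<le> t * real n" if "0 < t" for t p i
        using that by (auto simp: indicator_def H_def abs_mult)
      have t1: "integrable M (\<lambda>p. t * (?s p * Q p))" "(\<integral>p. t * (?s p * Q p) \<partial>M) \<le> C" if t: "0 < t" for t
      proof -
        show "integrable M (\<lambda>p. t * (?s p * Q p))"
          unfolding eq[symmetric] by (rule test(1)[where B1="t * real n"]) (use bd[OF t] t in simp_all)
        show "(\<integral>p. t * (?s p * Q p) \<partial>M) \<le> C"
          unfolding eq[symmetric] by (rule test(2)[where B1="t * real n"]) (use bd[OF t] t in simp_all)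
      qed
      show "AE p in M. ?s p * Q p = 0"
      proof (rule AE_zero_of_scaled_integral_bounded)
        show "integrable M (\<lambda>p. ?s p * Q p)" using t1(1)[of 1] by simp
        show "t * (\<integral>p. ?s p * Q p \<partial>M) \<le> C" if "0 < t" for t using t1(2)[OF that] by simp
      qed (auto simp: indicator_def Q0)
    qed
    then have AE2: "AE p in M. r p = 0 \<longrightarrow> Q p = 0"
    proof eventually_elim
      case (elim p)
      then show ?case using H_ev[of p] by (auto simp: indicator_def split: if_splits)
    qed
    \<comment> \<open>On \<open>E n\<close> the optimal multipliers are bounded, and the sets \<open>E n\<close> exhaust \<open>{r > 0}\<close>.\<close>
    define E where "E n = {p. 1 / real (Suc n) \<le> r p \<and> p \<in> H n}" for n
    have [measurable]: "Measurable.pred M (\<lambda>p. p \<in> E n)" for n unfolding E_def by measurable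
    have En: "(\<integral>\<^sup>+p. ennreal (indicator (E n) p * (Q p / (2 * r p))) \<partial>M) \<le> ennreal C" for n
    proof -
      let ?s = "\<lambda>p. indicator (E n) p / r p :: real"
      have rpos: "p \<in> E n \<Longrightarrow> 0 < r p" for p unfolding E_def by (auto intro: less_le_trans[rotated])
      have eq: "?s p * Q p * (1 - ?s p * r p / 2) - 0 * r p = indicator (E n) p * (Q p / (2 * r p))" for p
        using rpos[of p] by (auto simp: indicator_def field_simps)
      have bd: "\<bar>?s p * y\<bar> \<le> real (Suc n) * real n" if "\<bar>y\<bar> \<le> real n \<or> p \<notin> E n" for p y
      proof (cases "p \<in> E n")
        case True
        have "1 / r p \<le> real (Suc n)"
          using True rpos[OF True] by (simp add: E_def field_simps del: of_nat_Suc)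
        then have "1 / r p * \<bar>y\<bar> \<le> real (Suc n) * real n"
          using that True rpos[OF True] by (intro mult_mono) auto
        then show ?thesis using True rpos[OF True] by (simp add: abs_mult)
      qed simp
      have bw: "\<bar>?s p * w i p\<bar> \<le> real (Suc n) * real n" "\<bar>?s p * z p\<bar> \<le> real (Suc n) * real n" for p i
        by (rule bd; auto simp: E_def H_def)+
      have i: "integrable M (\<lambda>p. indicator (E n) p * (Q p / (2 * r p)))"
        unfolding eq[symmetric] by (rule test(1)[where B1="real (Suc n) * real n"]) (use bw in simp_all)
      have "(\<integral>p. indicator (E n) p * (Q p / (2 * r p)) \<partial>M) \<le> C"
        unfolding eq[symmetric] by (rule test(2)[where B1="real (Suc n) * real n"]) (use bw in simp_all)
      note i = i this
      have "(\<integral>\<^sup>+p. ennreal (indicator (E n) p * (Q p / (2 * r p))) \<partial>M)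
          = ennreal (\<integral>p. indicator (E n) p * (Q p / (2 * r p)) \<partial>M)"
        using i(1) rpos Q0 by (intro nn_integral_eq_integral AE_I2) (auto simp: indicator_def less_imp_le)
      then show ?thesis using i(2) by (simp add: ennreal_leI)
    qed
    have "(\<integral>\<^sup>+p. F p \<partial>M) = (\<integral>\<^sup>+p. liminf (\<lambda>n. ennreal (indicator (E n) p * (Q p / (2 * r p)))) \<partial>M)"
    proof (rule nn_integral_cong_AE)
      show "AE p in M. F p = liminf (\<lambda>n. ennreal (indicator (E n) p * (Q p / (2 * r p))))"
        using AE1 AE2
      proof eventually_elim
        case (elim p)
        show ?case
        proof (cases "r p = 0")
          case True
          then show ?thesis using elim by (simp add: F Liminf_const)
        next
          case False
          then have rp: "r p > 0" using elim by simp
          obtain n where n: "\<forall>m\<ge>n. p \<in> H m" using H_ev by blast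
          obtain k where k: "1 / r p \<le> real k" using real_arch_simple by blast
          have "\<forall>m\<ge>max n k. p \<in> E m"
          proof (intro allI impI)
            fix m assume m: "max n k \<le> m"
            then have "1 / r p \<le> real (Suc m)" using k by simp
            then have "1 / real (Suc m) \<le> r p" using rp by (simp add: field_simps del: of_nat_Suc)
            then show "p \<in> E m" using n m by (simp add: E_def)
          qed
          then have "eventually (\<lambda>m. ennreal (indicator (E m) p * (Q p / (2 * r p))) = F p) sequentially"
            using rp unfolding eventually_sequentially by (intro exI[of _ "max n k"]) (simp add: F)
          then have "(\<lambda>m. ennreal (indicator (E m) p * (Q p / (2 * r p)))) \<longlonglongrightarrow> F p"
            by (rule tendsto_eventually)
          then show ?thesis by (intro lim_imp_Liminf[symmetric]) simp_all
        qed
      qed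
    qed
    also have "\<dots> \<le> liminf (\<lambda>n. \<integral>\<^sup>+p. ennreal (indicator (E n) p * (Q p / (2 * r p))) \<partial>M)"
      by (rule nn_integral_liminf) measurable
    also have "\<dots> \<le> limsup (\<lambda>n. \<integral>\<^sup>+p. ennreal (indicator (E n) p * (Q p / (2 * r p))) \<partial>M)"
      by (rule Liminf_le_Limsup) simp
    also have "\<dots> \<le> ennreal C" by (intro Limsup_bounded always_eventually allI En)
    finally show "D \<Omega> \<delta> (\<rho>, \<omega>, \<zeta>) \<le> ennreal C" by (simp add: D)
  qed
qed

section \<open>Weak* sequential compactness\<close>

text \<open>The ternary digits of the code of a point record to which of the sets \<open>A k\<close> it belongs. They are 0 or
  2, so that the code lies in the Cantor set and is determined by its digits in a stable way.\<close>

definition basis_code :: "(nat \<Rightarrow> 'a set) \<Rightarrow> 'a \<Rightarrow> real" where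
  "basis_code A x = (\<Sum>k. 2 * indicator (A k) x / 3 ^ Suc k)"

lemma summable_basis_code: "summable (\<lambda>k. 2 * indicator (A k) x / 3 ^ Suc k :: real)"
proof (rule summable_comparison_test')
  show "summable (\<lambda>k. 2 * (1/3) ^ Suc k :: real)"
    by (intro summable_mult) (simp add: summable_geometric)
  show "norm (2 * indicator (A n) x / 3 ^ Suc n :: real) \<le> 2 * (1 / 3) ^ Suc n" for n
    by (auto simp: indicator_def power_divide)
qed

lemma sums_tail: "(\<lambda>j. 2 / 3 ^ Suc (j + n) :: real) sums (1 / 3 ^ n)"
proof -
  have "(\<lambda>j. (2 / 3 ^ Suc n) * (1/3) ^ j :: real) sums ((2 / 3 ^ Suc n) * (1 / (1 - 1/3)))"
    by (intro sums_mult geometric_sums) simp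
  then show ?thesis by (simp add: power_add power_divide field_simps)
qed

lemma basis_code_bounds: "0 \<le> basis_code A x" "basis_code A x \<le> 1"
proof -
  show "0 \<le> basis_code A x" unfolding basis_code_def
    by (intro suminf_nonneg summable_basis_code) auto
  have "basis_code A x \<le> (\<Sum>j. 2 / 3 ^ Suc (j + 0))" unfolding basis_code_def
    by (intro suminf_le summable_basis_code sums_summable[OF sums_tail]) (auto simp: indicator_def)
  then show "basis_code A x \<le> 1" using sums_unique[OF sums_tail, of 0] by simp
qed

text \<open>At the first digit where two codes differ they are at least as far apart as the remaining digits
  can compensate plus the weight of one unit of that digit.\<close>

lemma basis_code_close:
  assumes "\<bar>basis_code A x - basis_code A y\<bar> < 1 / 3 ^ n" "k < n"
  shows "x \<in> A k \<longleftrightarrow> y \<in> A k"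
proof (rule ccontr)
  define d where "d j = 2 * indicator (A j) x / 3 ^ Suc j - (2 * indicator (A j) y / 3 ^ Suc j :: real)" for j
  assume ne: "\<not> ?thesis"
  define m where "m = (LEAST k. (x \<in> A k) \<noteq> (y \<in> A k))"
  have m: "(x \<in> A m) \<noteq> (y \<in> A m)" unfolding m_def by (rule LeastI) (use ne in auto)
  have "m \<le> k" unfolding m_def by (rule Least_le) (use ne in auto)
  have low: "d j = 0" if "j < m" for j
    using not_less_Least[of j "\<lambda>k. (x \<in> A k) \<noteq> (y \<in> A k)"] that by (auto simp: d_def m_def indicator_def)
  have dm: "\<bar>d m\<bar> = 2 / 3 ^ Suc m" using m by (auto simp: d_def indicator_def)
  have sd: "summable d" unfolding d_def by (intro summable_diff summable_basis_code)
  have "basis_code A x - basis_code A y = suminf d"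
    unfolding basis_code_def d_def by (intro suminf_diff summable_basis_code)
  also have "\<dots> = (\<Sum>j. d (j + Suc m)) + (\<Sum>j<Suc m. d j)" by (rule suminf_split_initial_segment[OF sd])
  also have "(\<Sum>j<Suc m. d j) = d m" using low by simp
  finally have e: "basis_code A x - basis_code A y = (\<Sum>j. d (j + Suc m)) + d m" .
  have "\<bar>\<Sum>j. d (j + Suc m)\<bar> \<le> (\<Sum>j. 2 / 3 ^ Suc (j + Suc m))"
  proof -
    have b: "\<bar>d (j + Suc m)\<bar> \<le> 2 / 3 ^ Suc (j + Suc m)" for j by (auto simp: d_def indicator_def)
    have s: "summable (\<lambda>j. \<bar>d (j + Suc m)\<bar>)"
      by (rule summable_comparison_test'[OF sums_summable[OF sums_tail[of "Suc m"]]]) (use b in auto)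
    have "\<bar>\<Sum>j. d (j + Suc m)\<bar> \<le> (\<Sum>j. \<bar>d (j + Suc m)\<bar>)" by (rule summable_rabs[OF s])
    also have "\<dots> \<le> (\<Sum>j. 2 / 3 ^ Suc (j + Suc m))"
      by (intro suminf_le b s sums_summable[OF sums_tail])
    finally show ?thesis .
  qed
  also have "\<dots> = 1 / 3 ^ Suc m" by (rule sums_unique[OF sums_tail, symmetric])
  finally have "1 / 3 ^ Suc m \<le> \<bar>basis_code A x - basis_code A y\<bar>" using dm e by linarith
  moreover have "(1::real) / 3 ^ n \<le> 1 / 3 ^ Suc m"
    using \<open>m \<le> k\<close> \<open>k < n\<close> by (intro divide_left_mono power_increasing) auto
  ultimately show False using assms(1) by simp
qed

text \<open>A compact convex set is a continuous image of the real line in such a way that a Borel map \<open>s\<close>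
  selects preimages. For \<open>s\<close> one takes the code with respect to a countable basis. If the codes of
  two points agree up to a high digit, compactness gives a basic set of small diameter that
  contains both, so the inverse of \<open>s\<close> is uniformly continuous on the range of \<open>s\<close>. It extends to
  the closure of the range, and by Dugundji's theorem to the whole line with values in the convex
  set.\<close>

lemma compact_convex_code:
  fixes X :: "'a::euclidean_space set"
  assumes X: "compact X" "convex X" "X \<noteq> {}"
  obtains s :: "'a \<Rightarrow> real" and p :: "real \<Rightarrow> 'a"
  where "s \<in> borel_measurable borel" "\<And>x. s x \<in> {0..1}"
    "continuous_on UNIV p" "range p \<subseteq> X" "\<And>x. x \<in> X \<Longrightarrow> p (s x) = x"
proof -
  obtain A :: "nat \<Rightarrow> 'a set" where "inj A"
    and A: "\<And>n. open (A n)" "\<And>S. open S \<Longrightarrow> \<exists>k. S = \<Union>{A n |n. n \<in> k}"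
    by (rule univ_second_countable_sequence[where 'a='a]) (rule that)
  define s where "s = basis_code A"
  have sm: "s \<in> borel_measurable borel"
    unfolding s_def basis_code_def
    by (intro borel_measurable_suminf borel_measurable_divide borel_measurable_times
        borel_measurable_indicator borel_measurable_const) (use A(1) in auto)
  have close: "\<exists>d>0. \<forall>x\<in>X. \<forall>y\<in>X. \<bar>s x - s y\<bar> < d \<longrightarrow> dist x y < e" if e: "e > 0" for e
  proof -
    define I where "I = {n. \<forall>u\<in>A n. \<forall>v\<in>A n. dist u v < e}"
    have "\<exists>n\<in>I. x \<in> A n" for x
    proof -
      obtain k where k: "ball x (e/2) = \<Union>{A n |n. n \<in> k}" using A(2)[OF open_ball, of x "e/2"] ..
      have "x \<in> ball x (e/2)" using e by simp
      then obtain n where n: "n \<in> k" "x \<in> A n" unfolding k by blast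
      have b: "dist x u < e/2" if "u \<in> A n" for u
      proof -
        have "u \<in> ball x (e/2)" unfolding k using n that by blast
        then show ?thesis by simp
      qed
      have "n \<in> I" unfolding I_def
      proof (intro CollectI ballI)
        fix u v assume "u \<in> A n" "v \<in> A n"
        from b[OF this(1)] b[OF this(2)] show "dist u v < e" by (metis dist_commute dist_triangle_half_l)
      qed
      then show ?thesis using n by blast
    qed
    then have "X \<subseteq> (\<Union>n\<in>I. A n)" by auto
    then obtain J where J: "J \<subseteq> I" "finite J" "X \<subseteq> (\<Union>n\<in>J. A n)"
      using compactE_image[OF X(1), of I A] A(1) by metis
    obtain n where n: "\<And>j. j \<in> J \<Longrightarrow> j < n" using J(2) unfolding finite_nat_set_iff_bounded by auto
    have "dist x y < e" if xy: "x \<in> X" "y \<in> X" "\<bar>s x - s y\<bar> < 1 / 3 ^ n" for x y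
    proof -
      obtain j where j: "j \<in> J" "x \<in> A j" using J(3) xy by auto
      then have "y \<in> A j" using basis_code_close[OF xy(3)[unfolded s_def], of j] n by auto
      then show ?thesis using j J(1) by (auto simp: I_def)
    qed
    then show ?thesis by (intro exI[of _ "1 / 3 ^ n"]) auto
  qed
  have inj: "inj_on s X"
  proof (rule inj_onI)
    fix x y assume "x \<in> X" "y \<in> X" "s x = s y"
    then have "dist x y < e" if "e > 0" for e using close[OF that] by auto
    then show "x = y" by (metis dist_pos_lt less_irrefl)
  qed
  define t where "t = inv_into X s"
  have t: "t (s x) = x" if "x \<in> X" for x unfolding t_def by (rule inv_into_f_f[OF inj that])
  have "uniformly_continuous_on (s ` X) t"
    unfolding uniformly_continuous_on_def
  proof (intro allI impI)
    fix e :: real assume "e > 0"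
    then obtain d where "d > 0" "\<forall>x\<in>X. \<forall>y\<in>X. \<bar>s x - s y\<bar> < d \<longrightarrow> dist x y < e" using close by blast
    then show "\<exists>d>0. \<forall>x\<in>s ` X. \<forall>x'\<in>s ` X. dist x' x < d \<longrightarrow> dist (t x') (t x) < e"
      by (intro exI[of _ d]) (auto simp: t dist_real_def)
  qed
  then obtain g where g: "uniformly_continuous_on (closure (s ` X)) g" "\<And>u. u \<in> s ` X \<Longrightarrow> t u = g u"
    by (rule uniformly_continuous_on_extension_on_closure) blast
  have cg: "continuous_on (closure (s ` X)) g" using g(1) by (rule uniformly_continuous_imp_continuous)
  have gX: "g ` closure (s ` X) \<subseteq> X"
    using cg compact_imp_closed[OF X(1)] by (rule image_closure_subset) (auto simp: g(2)[symmetric] t)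
  obtain p where p: "continuous_on UNIV p" "p ` UNIV \<subseteq> X" "\<And>u. u \<in> closure (s ` X) \<Longrightarrow> p u = g u"
    by (rule Dugundji[OF X(2,3) _ cg gX, of UNIV])
      (simp add: closed_closedin[symmetric], rule that)
  have "p (s x) = x" if "x \<in> X" for x
  proof -
    have "s x \<in> s ` X" using that by simp
    moreover from this have "s x \<in> closure (s ` X)" using closure_subset by (rule rev_subsetD)
    ultimately show ?thesis using p(3) g(2)[of "s x"] t[OF that] by simp
  qed
  moreover have "s x \<in> {0..1}" for x using basis_code_bounds[of A x] by (simp add: s_def)
  ultimately show thesis by (intro that[of s p] sm p(1,2))
qed

text \<open>The factorization into mass and probability includes measures of mass zero, for which a Dirac
  measure serves as \<open>Q\<close>.\<close>

lemma probability_multiple: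
  fixes M :: "'a::topological_space measure"
  assumes "finite_measure M" and s: "sets M = borel_sets_on X" and ne: "X \<noteq> {}"
  obtains Q where "prob_space Q" "sets Q = borel_sets_on X"
    "\<And>f :: 'a \<Rightarrow> real. f \<in> borel_measurable (restrict_space borel X) \<Longrightarrow>
      (\<integral>x. f x \<partial>M) = measure M X * (\<integral>x. f x \<partial>Q)"
proof -
  interpret finite_measure M by fact
  obtain x0 where x0: "x0 \<in> X" using ne by blast
  have sp: "space M = X" using sets_eq_imp_space_eq[OF s] by simp
  show thesis
  proof (cases "measure M X > 0")
    case True
    define Q where "Q = density M (\<lambda>_. ennreal (1 / measure M X))"
    have "emeasure Q (space Q) = ennreal (1 / measure M X) * emeasure M X"
      using s by (simp add: Q_def emeasure_density sp nn_integral_cmult_indicator)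
    also have "\<dots> = 1" using True by (simp add: emeasure_eq_measure ennreal_mult'[symmetric])
    finally have "prob_space Q" by (rule prob_spaceI)
    moreover have "(\<integral>x. f x \<partial>M) = measure M X * (\<integral>x. f x \<partial>Q)"
      if "f \<in> borel_measurable (restrict_space borel X)" for f :: "'a \<Rightarrow> real"
    proof -
      have [measurable]: "f \<in> borel_measurable M" using that measurable_cong_sets[OF s refl] by blast
      show ?thesis using True by (simp add: Q_def integral_density)
    qed
    ultimately show thesis by (intro that[of Q]) (simp_all add: Q_def s)
  next
    case False
    then have 0: "measure M X = 0" by (simp add: measure_le_0_iff not_less)
    then have "(\<integral>x. f x \<partial>M) = 0" for f :: "'a \<Rightarrow> real"
      by (intro integral_null_space) (simp add: sp emeasure_eq_measure)
    with 0 x0 show thesis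
      by (intro that[of "return (restrict_space borel X) x0"]) (simp_all add: prob_space_return)
  qed
qed

text \<open>Measures on \<open>X\<close> are transported by \<open>s\<close> to the unit interval, where they are tight. Helly's theorem
  provides a weak limit on the line, and its image under \<open>p\<close> is the limit on \<open>X\<close>, because \<open>p\<close> is
  continuous and inverts \<open>s\<close>.\<close>

lemma weak_star_compact_nonneg:
  fixes X :: "'a::euclidean_space set" and M :: "nat \<Rightarrow> 'a measure"
  assumes X: "compact X" "convex X" "X \<noteq> {}"
    and s: "\<And>n. sets (M n) = borel_sets_on X" and fin: "\<And>n. finite_measure (M n)"
    and bd: "\<And>n. emeasure (M n) X \<le> ennreal C"
  obtains r N where "strict_mono r" "finite_measure N" "sets N = borel_sets_on X"
    "\<And>f :: 'a \<Rightarrow> real. continuous_on X f \<Longrightarrow> (\<lambda>k. \<integral>x. f x \<partial>M (r k)) \<longlonglongrightarrow> (\<integral>x. f x \<partial>N)"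
proof -
  obtain s :: "'a \<Rightarrow> real" and p where sp: "s \<in> borel_measurable borel" "\<And>x. s x \<in> {0..1}"
    "continuous_on UNIV p" "range p \<subseteq> X" "\<And>x. x \<in> X \<Longrightarrow> p (s x) = x"
    by (rule compact_convex_code[OF X]) (rule that)
  define c where "c n = measure (M n) X" for n
  have c: "0 \<le> c n" "c n \<le> max 0 C" for n
  proof -
    have "ennreal (c n) = emeasure (M n) X"
      unfolding c_def using fin[of n] by (simp add: finite_measure.emeasure_eq_measure)
    also have "\<dots> \<le> ennreal (max 0 C)"
      using bd[of n] by (rule order_trans) (simp add: ennreal_leI)
    finally show "c n \<le> max 0 C" by (subst (asm) ennreal_le_iff) auto
  qed (simp add: c_def)
  have [measurable]: "s \<in> borel_measurable (restrict_space borel X)" using sp(1) by (rule measurable_restrict_space1)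
  have pm [measurable]: "p \<in> measurable borel (restrict_space borel X)"
    using sp(3,4) by (intro measurable_restrict_space2 borel_measurable_continuous_onI) auto
  have "\<exists>Q. prob_space Q \<and> sets Q = borel_sets_on X \<and>
      (\<forall>f :: 'a \<Rightarrow> real. f \<in> borel_measurable (restrict_space borel X) \<longrightarrow> (\<integral>x. f x \<partial>M n) = c n * (\<integral>x. f x \<partial>Q))" for n
    unfolding c_def by (rule probability_multiple[OF fin s X(3), of n]) blast
  then obtain Q where Q: "\<And>n. prob_space (Q n)" and sQ [simp, measurable_cong]: "\<And>n. sets (Q n) = borel_sets_on X"
    and MQ': "\<And>n. \<forall>f :: 'a \<Rightarrow> real. f \<in> borel_measurable (restrict_space borel X) \<longrightarrow> (\<integral>x. f x \<partial>M n) = c n * (\<integral>x. f x \<partial>Q n)"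
    by metis
  have spQ: "space (Q n) = X" for n using sets_eq_imp_space_eq[OF sQ] by simp
  interpret Q: prob_space "Q n" for n by (rule Q)
  have MQ: "(\<integral>x. f x \<partial>M n) = c n * (\<integral>x. f x \<partial>Q n)" if f: "continuous_on X f" for f :: "'a \<Rightarrow> real" and n
    using MQ' borel_measurable_continuous_on_restrict[OF f] by blast
  have "compact {0..max 0 C}" by simp
  then have "seq_compact {0..max 0 C}" by (simp add: compact_eq_seq_compact_metric)
  then obtain l r1 where r1: "strict_mono r1" "(c \<circ> r1) \<longlonglongrightarrow> l"
    by (rule seq_compactE[of _ c]) (use c that in auto)
  have l: "0 \<le> l" by (rule LIMSEQ_le_const[OF r1(2)]) (use c in auto)
  define \<nu> where "\<nu> n = distr (Q n) borel s" for n
  have rd: "real_distribution (\<nu> n)" for n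
  proof -
    have "prob_space (\<nu> n)" unfolding \<nu>_def by (rule Q.prob_space_distr) measurable
    then show ?thesis by (simp add: real_distribution_def real_distribution_axioms_def \<nu>_def)
  qed
  have "tight \<nu>"
    unfolding tight_def
  proof (intro conjI allI impI rd)
    fix \<epsilon> :: real assume "0 < \<epsilon>"
    have "s -` {-1<..2} \<inter> space (Q n) = space (Q n)" for n
    proof -
      have "-1 < s x \<and> s x \<le> 2" for x using sp(2)[of x] by auto
      then show ?thesis by auto
    qed
    then have "measure (\<nu> n) {-1<..2} = 1" for n
      unfolding \<nu>_def by (subst measure_distr) (auto simp: Q.prob_space)
    then show "\<exists>a b. a < b \<and> (\<forall>n. 1 - \<epsilon> < measure (\<nu> n) {a<..b})"
      using \<open>0 < \<epsilon>\<close> by (intro exI[of _ "-1"] exI[of _ 2]) auto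
  qed
  then obtain r2 N where N: "strict_mono r2" "real_distribution N" "weak_conv_m (\<nu> \<circ> r1 \<circ> r2) N"
    using tight_imp_convergent_subsubsequence[OF _ r1(1)] by blast
  interpret N: real_distribution N by (rule N(2))
  define P where "P = density (distr N (restrict_space borel X) p) (\<lambda>_. ennreal l)"
  have sP [simp]: "sets P = borel_sets_on X" by (simp add: P_def)
  have "finite_measure (distr N (restrict_space borel X) p)"
    by (rule N.finite_measure_distr) (simp add: measurable_cong_sets[OF N.events_eq_borel refl] pm)
  then have "emeasure (distr N (restrict_space borel X) p) X < top"
    by (simp add: finite_measure.emeasure_finite less_top[symmetric])
  moreover have "emeasure P (space P) = ennreal l * emeasure (distr N (restrict_space borel X) p) X"
    by (simp add: P_def emeasure_density nn_integral_cmult_indicator)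
  ultimately have fP: "finite_measure P"
    by (intro finite_measureI) (simp add: ennreal_mult_eq_top_iff)
  have conv: "(\<lambda>k. \<integral>x. f x \<partial>M (r1 (r2 k))) \<longlonglongrightarrow> (\<integral>x. f x \<partial>P)" if f: "continuous_on X f" for f :: "'a \<Rightarrow> real"
  proof -
    have fm [measurable]: "f \<in> borel_measurable (restrict_space borel X)" by (rule borel_measurable_continuous_on_restrict[OF f])
    have cfp: "continuous_on UNIV (\<lambda>u. f (p u))"
      by (rule continuous_on_compose2[OF f sp(3)]) (use sp(4) in auto)
    obtain B where B: "\<And>x. x \<in> X \<Longrightarrow> \<bar>f x\<bar> \<le> B"
      using compact_imp_bounded[OF compact_continuous_image[OF f X(1)]] by (auto simp: bounded_iff)
    have "(\<lambda>k. \<integral>u. f (p u) \<partial>(\<nu> \<circ> r1 \<circ> r2) k) \<longlonglongrightarrow> (\<integral>u. f (p u) \<partial>N)"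
    proof (rule weak_conv_imp_integral_bdd_continuous_conv[where B=B])
      show "real_distribution ((\<nu> \<circ> r1 \<circ> r2) n)" for n using rd by simp
      show "isCont (\<lambda>u. f (p u)) x" for x using cfp by (simp add: continuous_on_eq_continuous_at)
      show "norm (f (p x)) \<le> B" for x using B[of "p x"] sp(4) by auto
    qed (rule N)+
    moreover have "(\<integral>u. f (p u) \<partial>(\<nu> \<circ> r1 \<circ> r2) k) = (\<integral>x. f x \<partial>Q (r1 (r2 k)))" for k
    proof -
      have "(\<integral>u. f (p u) \<partial>(\<nu> \<circ> r1 \<circ> r2) k) = (\<integral>x. f (p (s x)) \<partial>Q (r1 (r2 k)))"
        unfolding comp_def \<nu>_def by (rule integral_distr) measurable
      also have "\<dots> = (\<integral>x. f x \<partial>Q (r1 (r2 k)))"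
        by (intro Bochner_Integration.integral_cong) (auto simp: spQ sp(5))
      finally show ?thesis .
    qed
    ultimately have "(\<lambda>k. \<integral>x. f x \<partial>Q (r1 (r2 k))) \<longlonglongrightarrow> (\<integral>u. f (p u) \<partial>N)" by simp
    moreover have "(\<lambda>k. c (r1 (r2 k))) \<longlonglongrightarrow> l"
      using LIMSEQ_subseq_LIMSEQ[OF r1(2) N(1)] by (simp add: comp_def)
    ultimately have "(\<lambda>k. c (r1 (r2 k)) * (\<integral>x. f x \<partial>Q (r1 (r2 k)))) \<longlonglongrightarrow> l * (\<integral>u. f (p u) \<partial>N)"
      by (intro tendsto_mult)
    moreover have "l * (\<integral>u. f (p u) \<partial>N) = (\<integral>x. f x \<partial>P)"
      using l by (simp add: P_def integral_density integral_distr)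
    ultimately show ?thesis by (simp add: MQ[OF f])
  qed
  show thesis
    by (rule that[of "r1 \<circ> r2" P]) (use conv fP strict_mono_o[OF r1(1) N(1)] in \<open>auto simp: comp_def\<close>)
qed

lemma weak_star_compact_signed:
  fixes X :: "'a::euclidean_space set" and \<mu> :: "nat \<Rightarrow> 'a smeasure"
  assumes X: "compact X" "convex X" "X \<noteq> {}"
    and \<mu>: "\<And>n. \<mu> n \<in> signed_measures X"
    and bd: "\<And>n h. continuous_on X h \<Longrightarrow> (\<And>x. 0 \<le> h x \<and> h x \<le> 1) \<Longrightarrow> \<bar>signed_integral X (\<mu> n) h\<bar> \<le> C"
  obtains r \<nu> where "strict_mono r" "\<nu> \<in> signed_measures X" "weak_star_tendsto X (\<lambda>k. \<mu> (r k)) \<nu>"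
proof -
  have bp: "emeasure (pos_part X (\<mu> n)) X \<le> ennreal C" for n
    by (rule emeasure_pos_part_le_of_integrals[OF X(1) \<mu>]) (use bd[of _ n] in \<open>auto simp: abs_le_iff\<close>)
  obtain r1 N1 where 1: "strict_mono r1" "finite_measure N1" "sets N1 = borel_sets_on X"
    "\<And>f :: 'a \<Rightarrow> real. continuous_on X f \<Longrightarrow> (\<lambda>k. \<integral>x. f x \<partial>pos_part X (\<mu> (r1 k))) \<longlonglongrightarrow> (\<integral>x. f x \<partial>N1)"
    by (rule weak_star_compact_nonneg[OF X, of "\<lambda>n. pos_part X (\<mu> n)" C])
      (use finite_measure_pos_part[OF \<mu>] bp that in auto)
  have bn: "emeasure (neg_part X (\<mu> n)) X \<le> ennreal C" for n
    unfolding neg_part_def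
    by (rule emeasure_pos_part_le_of_integrals[OF X(1) signed_measures_uminus[OF \<mu>]])
      (use bd[of _ n] in \<open>auto simp: abs_le_iff signed_integral_measure_uminus\<close>)
  obtain r2 N2 where 2: "strict_mono r2" "finite_measure N2" "sets N2 = borel_sets_on X"
    "\<And>f :: 'a \<Rightarrow> real. continuous_on X f \<Longrightarrow> (\<lambda>k. \<integral>x. f x \<partial>neg_part X (\<mu> (r1 (r2 k)))) \<longlonglongrightarrow> (\<integral>x. f x \<partial>N2)"
    by (rule weak_star_compact_nonneg[OF X, of "\<lambda>n. neg_part X (\<mu> (r1 n))" C])
      (use finite_measure_neg_part[OF \<mu>] bn that in auto)
  define \<nu> where "\<nu> = (\<lambda>A. if A \<in> borel_sets_on X then measure N1 A - measure N2 A else 0)"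
  have \<nu>: "\<nu> \<in> signed_measures X" unfolding \<nu>_def by (rule signed_measures_diff_measures[OF 1(3) 2(3) 1(2) 2(2)])
  have "(\<lambda>k. signed_integral X (\<mu> (r1 (r2 k))) f) \<longlonglongrightarrow> signed_integral X \<nu> f" if f: "continuous_on X f" for f
  proof -
    have "signed_integral X \<nu> f = (\<integral>x. f x \<partial>N1) - (\<integral>x. f x \<partial>N2)"
      by (rule signed_integral_diff[OF \<nu> 1(3) 2(3) 1(2) 2(2)])
        (auto simp: \<nu>_def intro!: integrable_continuous_on[OF 1(2,3) X(1) f] integrable_continuous_on[OF 2(2,3) X(1) f])
    then show ?thesis
      unfolding signed_integral_def
      using tendsto_diff[OF LIMSEQ_subseq_LIMSEQ[OF 1(4)[OF f] 2(1)] 2(4)[OF f]] by (simp add: comp_def)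
  qed
  then show thesis
    by (intro that[of "r1 \<circ> r2" \<nu>] strict_mono_o[OF 1(1) 2(1)] \<nu>) (simp add: weak_star_tendsto_def)
qed

lemma weak_star_tendsto_subseq:
  "weak_star_tendsto X \<mu> \<nu> \<Longrightarrow> strict_mono r \<Longrightarrow> weak_star_tendsto X (\<lambda>k. \<mu> (r k)) \<nu>"
  unfolding weak_star_tendsto_def
  by (intro allI impI) (erule allE, drule (1) mp, drule (1) LIMSEQ_subseq_LIMSEQ, simp add: comp_def)

lemma weak_star_compact_family:
  fixes X :: "'a::euclidean_space set" and \<mu> :: "nat \<Rightarrow> 'i \<Rightarrow> 'a smeasure"
  assumes X: "compact X" "convex X" "X \<noteq> {}" and I: "finite I"
    and \<mu>: "\<And>n i. i \<in> I \<Longrightarrow> \<mu> n i \<in> signed_measures X"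
    and bd: "\<And>n i h. i \<in> I \<Longrightarrow> continuous_on X h \<Longrightarrow> (\<And>x. 0 \<le> h x \<and> h x \<le> 1) \<Longrightarrow> \<bar>signed_integral X (\<mu> n i) h\<bar> \<le> C"
  shows "\<exists>r \<nu>. strict_mono r \<and> (\<forall>i\<in>I. \<nu> i \<in> signed_measures X \<and> weak_star_tendsto X (\<lambda>k. \<mu> (r k) i) (\<nu> i))"
  using I \<mu> bd
proof (induction I)
  case empty show ?case by (intro exI[of _ id] exI conjI ballI) (simp_all add: strict_mono_def)
next
  case (insert j I)
  then obtain r \<nu> where r: "strict_mono r" "\<forall>i\<in>I. \<nu> i \<in> signed_measures X \<and> weak_star_tendsto X (\<lambda>k. \<mu> (r k) i) (\<nu> i)"
    using insert.IH[OF insert.prems(1)[OF insertI2] insert.prems(2)[OF insertI2]] by blast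
  obtain r' \<nu>' where r': "strict_mono r'" "\<nu>' \<in> signed_measures X" "weak_star_tendsto X (\<lambda>k. \<mu> (r (r' k)) j) \<nu>'"
    by (rule weak_star_compact_signed[OF X, of "\<lambda>k. \<mu> (r k) j" C])
      (use insert.prems(1)[OF insertI1] insert.prems(2)[OF insertI1] that in blast)+
  have w: "weak_star_tendsto X (\<lambda>k. \<mu> (r (r' k)) i) (\<nu> i)" if "i \<in> I" for i
    by (rule weak_star_tendsto_subseq[OF conjunct2[OF bspec[OF r(2) that]] r'(1)])
  have fin: "(\<nu>(j := \<nu>')) i \<in> signed_measures X \<and> weak_star_tendsto X (\<lambda>k. \<mu> ((r \<circ> r') k) i) ((\<nu>(j := \<nu>')) i)"
    if i: "i \<in> insert j I" for i
  proof (cases "i = j")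
    case True then show ?thesis using r'(2,3) by simp
  next
    case False
    then have "i \<in> I" using i by simp
    then show ?thesis using w[of i] r(2) False by simp
  qed
  show ?case
  proof (intro exI conjI ballI)
    show "strict_mono (r \<circ> r')" by (rule strict_mono_o[OF r(1) r'(1)])
    fix i assume i: "i \<in> insert j I"
    show "(\<nu>(j := \<nu>')) i \<in> signed_measures X" by (rule conjunct1[OF fin[OF i]])
    show "weak_star_tendsto X (\<lambda>k. \<mu> ((r \<circ> r') k) i) ((\<nu>(j := \<nu>')) i)" by (rule conjunct2[OF fin[OF i]])
  qed
qed

section \<open>Testing the continuity equation with functions of time\<close>

lemma compact_cylinder: "bounded \<Omega> \<Longrightarrow> compact (cylinder \<Omega>)"
  by (intro compact_Times) auto

lemma signed_integral_const:
  assumes "\<mu> \<in> signed_measures X" shows "signed_integral X \<mu> (\<lambda>x. c) = c * \<mu> X"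
proof -
  have "signed_integral X \<mu> (\<lambda>x. c) = signed_integral X \<mu> (\<lambda>x. c * indicator X x)"
    by (rule signed_integral_cong) simp
  then show ?thesis using signed_integral_indicator[OF assms X_in_borel_on]
    by (simp add: signed_integral_cmult)
qed

lemma CE_triples: "(\<rho>, \<omega>, \<zeta>) \<in> CE \<Omega> \<rho>0 \<rho>1 \<Longrightarrow> (\<rho>, \<omega>, \<zeta>) \<in> triples \<Omega>"
  by (simp add: CE_def)

lemma C1_on_cylinder_continuous:
  assumes "C1_on_cylinder \<Omega> \<phi> \<phi>t \<phi>x"
  shows "continuous_on (cylinder \<Omega>) \<phi>" "continuous_on (cylinder \<Omega>) \<phi>t" "continuous_on (cylinder \<Omega>) \<phi>x"
proof -
  have d: "\<And>p. p \<in> cylinder \<Omega> \<Longrightarrow> (\<phi> has_derivative (\<lambda>(s, v). \<phi>t p * s + \<phi>x p \<bullet> v)) (at p within cylinder \<Omega>)"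
    using assms by (auto simp: C1_on_cylinder_def)
  then show "continuous_on (cylinder \<Omega>) \<phi>" by (rule has_derivative_continuous_on)
qed (use assms in \<open>auto simp: C1_on_cylinder_def\<close>)

lemma CE_time_test:
  fixes \<Omega> :: "(real ^ 'd::finite) set"
  assumes CE: "(\<rho>, \<omega>, \<zeta>) \<in> CE \<Omega> \<rho>0 \<rho>1"
    and \<rho>: "\<rho>0 \<in> signed_measures (closure \<Omega>)" "\<rho>1 \<in> signed_measures (closure \<Omega>)"
    and G: "\<And>t. t \<in> {0..1} \<Longrightarrow> (G has_real_derivative G' t) (at t within {0..1})" "continuous_on {0..1} G'"
  shows "signed_integral (cylinder \<Omega>) \<rho> (\<lambda>p. G' (fst p)) + signed_integral (cylinder \<Omega>) \<zeta> (\<lambda>p. G (fst p))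
    = G 1 * \<rho>1 (closure \<Omega>) - G 0 * \<rho>0 (closure \<Omega>)"
proof -
  have "C1_on_cylinder \<Omega> (\<lambda>p. G (fst p)) (\<lambda>p. G' (fst p)) (\<lambda>p. 0)"
    unfolding C1_on_cylinder_def
  proof (intro conjI ballI)
    fix p assume p: "p \<in> cylinder \<Omega>"
    then have t: "fst p \<in> {0..1}" by auto
    have "(G has_derivative (\<lambda>h. h * G' (fst p))) (at (fst p) within fst ` cylinder \<Omega>)"
      by (rule has_derivative_subset[OF G(1)[OF t, THEN has_field_derivative_imp_has_derivative, unfolded mult.commute[of "G' (fst p)"]]])
         auto
    from has_derivative_in_compose[OF has_derivative_fst[OF has_derivative_ident] this]
    show "((\<lambda>p. G (fst p)) has_derivative (\<lambda>(s, v). G' (fst p) * s + 0 \<bullet> v)) (at p within cylinder \<Omega>)"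
      by (simp add: case_prod_unfold mult.commute)
  qed (auto intro!: continuous_on_compose2[OF G(2)] continuous_on_fst continuous_on_id)
  with CE have "signed_integral (cylinder \<Omega>) \<rho> (\<lambda>p. G' (fst p))
        + (\<Sum>i\<in>UNIV. signed_integral (cylinder \<Omega>) (\<omega> i) (\<lambda>p. (0 :: real ^ 'd) $ i))
        + signed_integral (cylinder \<Omega>) \<zeta> (\<lambda>p. G (fst p))
        = signed_integral (closure \<Omega>) \<rho>1 (\<lambda>x. G (fst (1, x)))
          - signed_integral (closure \<Omega>) \<rho>0 (\<lambda>x. G (fst (0, x)))"
    unfolding CE_def by blast
  then show ?thesis by (simp add: signed_integral_const \<rho>)
qed

text \<open>Along a minimizer for the growth part the total mass is the square of this affine function of time.\<close>

definition sqrt_mass :: "real \<Rightarrow> real \<Rightarrow> real \<Rightarrow> real" where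
  "sqrt_mass s0 s1 t = (1 - t) * s0 + t * s1"

text \<open>For \<open>e = 0\<close> this is the rate of growth (\<open>growth_rate_eq\<close>). For \<open>e > 0\<close> it is continuous on the
  cylinder whatever the masses are, and still solves \<open>g' = - g\<^sup>2 / 2\<close>.\<close>

definition reg_rate :: "real \<Rightarrow> real \<Rightarrow> real \<Rightarrow> real \<Rightarrow> real" where
  "reg_rate s0 s1 e t = 2 * (s1 - s0) / (sqrt_mass s0 s1 t + e)"

text \<open>The formula with \<open>s0\<close> and \<open>s1\<close> also covers equal masses, where both sides vanish, and the time at
  which the mass is zero, where both sides are a division by zero.\<close>

lemma growth_rate_eq:
  assumes "0 \<le> m0" "0 \<le> m1"
  shows "growth_rate m0 m1 = (\<lambda>p. reg_rate (sqrt m0) (sqrt m1) 0 (fst p))"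
proof
  fix p :: "'d::finite spacetime"
  obtain t x where p: "p = (t, x)" by (cases p)
  show "growth_rate m0 m1 p = reg_rate (sqrt m0) (sqrt m1) 0 (fst p)"
  proof (cases "m0 = m1")
    case True then show ?thesis by (simp add: growth_rate_def reg_rate_def p)
  next
    case False
    then have ne: "sqrt m1 - sqrt m0 \<noteq> 0" using assms by simp
    have "t - sqrt m0 / (sqrt m0 - sqrt m1) = t + sqrt m0 / (sqrt m1 - sqrt m0)"
      using minus_divide_right[of "sqrt m0" "sqrt m1 - sqrt m0"] by simp
    also have "\<dots> = sqrt_mass (sqrt m0) (sqrt m1) t / (sqrt m1 - sqrt m0)"
      using ne by (simp add: sqrt_mass_def field_simps)
    finally have *: "t - sqrt m0 / (sqrt m0 - sqrt m1) = sqrt_mass (sqrt m0) (sqrt m1) t / (sqrt m1 - sqrt m0)" .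
    have "growth_rate m0 m1 p = 2 / (t - sqrt m0 / (sqrt m0 - sqrt m1))"
      using False by (simp add: growth_rate_def p)
    then show ?thesis unfolding * by (simp add: reg_rate_def p)
  qed
qed

lemma sqrt_mass_nonneg: "0 \<le> s0 \<Longrightarrow> 0 \<le> s1 \<Longrightarrow> t \<in> {0..1} \<Longrightarrow> 0 \<le> sqrt_mass s0 s1 t"
  by (auto simp: sqrt_mass_def)

lemma reg_rate_deriv:
  assumes "0 \<le> s0" "0 \<le> s1" "0 < e" "t \<in> {0..1}"
  shows "(reg_rate s0 s1 e has_real_derivative - (reg_rate s0 s1 e t)\<^sup>2 / 2) (at t within {0..1})"
proof -
  have ne: "sqrt_mass s0 s1 t + e \<noteq> 0" using sqrt_mass_nonneg[OF assms(1,2,4)] assms(3) by simp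
  have "((\<lambda>t. sqrt_mass s0 s1 t + e) has_real_derivative (s1 - s0)) (at t within {0..1})"
    by (auto simp: sqrt_mass_def intro!: derivative_eq_intros)
  from DERIV_divide[OF DERIV_const this ne, of "2 * (s1 - s0)"]
  have "((\<lambda>t. 2 * (s1 - s0) / (sqrt_mass s0 s1 t + e)) has_real_derivative
      (0 * (sqrt_mass s0 s1 t + e) - 2 * (s1 - s0) * (s1 - s0)) / ((sqrt_mass s0 s1 t + e) * (sqrt_mass s0 s1 t + e)))
      (at t within {0..1})" .
  moreover have eq: "(0 * L - 2 * d * d) / (L * L) = - (2 * d / L)\<^sup>2 / 2" for d L :: real
    by (simp add: power2_eq_square)
  ultimately show ?thesis unfolding reg_rate_def[abs_def] eq by blast
qed

lemma continuous_on_reg_rate: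
  assumes "0 \<le> s0" "0 \<le> s1" "0 < e"
  shows "continuous_on {0..1} (reg_rate s0 s1 e)"
  using reg_rate_deriv[OF assms] by (meson DERIV_continuous_on)

lemma continuous_on_reg_rate_fst:
  assumes "0 \<le> s0" "0 \<le> s1" "0 < e"
  shows "continuous_on (cylinder \<Omega>) (\<lambda>p. reg_rate s0 s1 e (fst p))"
  by (rule continuous_on_compose2[OF continuous_on_reg_rate[OF assms]]) (auto intro!: continuous_intros)

definition reg_action :: "real \<Rightarrow> real \<Rightarrow> real \<Rightarrow> real" where
  "reg_action s0 s1 e = reg_rate s0 s1 e 1 * s1\<^sup>2 - reg_rate s0 s1 e 0 * s0\<^sup>2"

text \<open>The differential equation for the regularized rate \<open>g\<close> turns the term \<open>\<integral> g' d\<rho>\<close> of the continuity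
  equation into \<open>- 1/2 \<integral> g\<^sup>2 d\<rho>\<close>. In the limit \<open>e = 0\<close> the boundary term is the smallest possible
  growth part (\<open>reg_action_tendsto\<close>).\<close>

lemma CE_reg_rate:
  fixes \<Omega> :: "(real ^ 'd::finite) set"
  assumes \<Omega>: "bounded \<Omega>" and CE: "(\<rho>, \<omega>, \<zeta>) \<in> CE \<Omega> \<rho>0 \<rho>1"
    and \<rho>: "\<rho>0 \<in> signed_measures (closure \<Omega>)" "\<rho>1 \<in> signed_measures (closure \<Omega>)"
    and s: "0 \<le> s0" "0 \<le> s1" "\<rho>0 (closure \<Omega>) = s0\<^sup>2" "\<rho>1 (closure \<Omega>) = s1\<^sup>2" and e: "0 < e"
  shows "signed_integral (cylinder \<Omega>) \<zeta> (\<lambda>p. reg_rate s0 s1 e (fst p))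
    = reg_action s0 s1 e + signed_integral (cylinder \<Omega>) \<rho> (\<lambda>p. (reg_rate s0 s1 e (fst p))\<^sup>2) / 2"
proof -
  have "continuous_on {0..1} (\<lambda>t. - (reg_rate s0 s1 e t)\<^sup>2 / 2)"
    by (intro continuous_intros continuous_on_reg_rate s e) simp
  from CE_time_test[OF CE \<rho> reg_rate_deriv[OF s(1,2) e] this]
  have "signed_integral (cylinder \<Omega>) \<rho> (\<lambda>p. (- 1 / 2) * (reg_rate s0 s1 e (fst p))\<^sup>2)
      + signed_integral (cylinder \<Omega>) \<zeta> (\<lambda>p. reg_rate s0 s1 e (fst p)) = reg_action s0 s1 e"
    by (simp add: reg_action_def s)
  then show ?thesis unfolding signed_integral_cmult by simp
qed

lemma reg_action_tendsto:
  assumes "0 \<le> s0" "0 \<le> s1"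
  shows "(\<lambda>n. reg_action s0 s1 (1 / real (Suc n))) \<longlonglongrightarrow> 2 * (s1 - s0)\<^sup>2"
proof -
  have e: "(\<lambda>n. 1 / real (Suc n)) \<longlonglongrightarrow> 0" by (rule LIMSEQ_Suc[OF lim_const_over_n])
  have *: "(\<lambda>n. s\<^sup>2 / (s + 1 / real (Suc n))) \<longlonglongrightarrow> s" if "0 \<le> s" for s :: real
  proof (cases "s = 0")
    case False
    have "(\<lambda>n. s\<^sup>2 / (s + 1 / real (Suc n))) \<longlonglongrightarrow> s\<^sup>2 / (s + 0)"
      using False by (intro tendsto_intros e) auto
    then show ?thesis using False by (simp add: power2_eq_square)
  qed simp
  have lim: "(\<lambda>n. 2 * (s1 - s0) * (s1\<^sup>2 / (s1 + 1 / real (Suc n)) - s0\<^sup>2 / (s0 + 1 / real (Suc n)))) \<longlonglongrightarrow> 2 * (s1 - s0) * (s1 - s0)"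
    by (intro tendsto_intros * assms)
  have eq: "2 * (s1 - s0) * (s1\<^sup>2 / (s1 + 1 / real (Suc n)) - s0\<^sup>2 / (s0 + 1 / real (Suc n))) = reg_action s0 s1 (1 / real (Suc n))" for n
    by (simp add: reg_action_def reg_rate_def sqrt_mass_def right_diff_distrib del: of_nat_Suc)
  show ?thesis using lim unfolding eq by (simp only: power2_eq_square mult.assoc)
qed

lemma nonneg_measure_of_pairing_le:
  fixes X :: "'a::euclidean_space set" and \<omega> :: "'d::finite \<Rightarrow> 'a smeasure"
  assumes X: "compact X" and \<rho>: "\<rho> \<in> signed_measures X"
    and le: "\<And>a. continuous_on X a \<Longrightarrow> (\<And>x. x \<in> X \<Longrightarrow> a x \<le> 0) \<Longrightarrow> signed_integral X \<rho> a \<le> C"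
  shows "\<rho> \<in> nonneg_measures X"
proof (rule nonneg_measureI[OF X \<rho>])
  fix h :: "'a \<Rightarrow> real" assume h: "continuous_on X h" "\<And>x. 0 \<le> h x"
  show "0 \<le> signed_integral X \<rho> h"
  proof (rule ccontr)
    assume "\<not> ?thesis"
    then have neg: "signed_integral X \<rho> h < 0" by simp
    define t where "t = (\<bar>C\<bar> + 1) / - signed_integral X \<rho> h"
    have t: "0 < t" unfolding t_def using neg by (intro divide_pos_pos) auto
    have "signed_integral X \<rho> (\<lambda>x. - t * h x) \<le> C"
      using h t by (intro le continuous_intros) auto
    then have "- t * signed_integral X \<rho> h \<le> C" unfolding signed_integral_cmult .
    moreover have "- t * signed_integral X \<rho> h = \<bar>C\<bar> + 1" using neg by (simp add: t_def)
    ultimately show False by simp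
  qed
qed

context
  fixes \<Omega> :: "(real ^ 'd::finite) set" and \<rho>0 \<rho>1 :: "(real ^ 'd) smeasure" and s0 s1 :: real
    and \<rho> :: "'d spacetime smeasure" and \<omega> :: "'d \<Rightarrow> 'd spacetime smeasure" and \<zeta> :: "'d spacetime smeasure"
  assumes \<Omega>: "bounded \<Omega>" and CE: "(\<rho>, \<omega>, \<zeta>) \<in> CE \<Omega> \<rho>0 \<rho>1"
    and bdry: "\<rho>0 \<in> signed_measures (closure \<Omega>)" "\<rho>1 \<in> signed_measures (closure \<Omega>)"
    and s: "0 \<le> s0" "0 \<le> s1" "\<rho>0 (closure \<Omega>) = s0\<^sup>2" "\<rho>1 (closure \<Omega>) = s1\<^sup>2"
    and nonneg: "\<rho> \<in> nonneg_measures (cylinder \<Omega>)"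
begin

lemma CE_signed: "\<rho> \<in> signed_measures (cylinder \<Omega>)" "\<omega> i \<in> signed_measures (cylinder \<Omega>)" "\<zeta> \<in> signed_measures (cylinder \<Omega>)"
  using CE_triples[OF CE] by (auto simp: triples_def)

lemma pos_integral: "signed_integral (cylinder \<Omega>) \<rho> f = (\<integral>p. f p \<partial>pos_part (cylinder \<Omega>) \<rho>)"
  by (rule signed_integral_nonneg_measure[OF nonneg])

lemma pos_integrable: "continuous_on (cylinder \<Omega>) f \<Longrightarrow> integrable (pos_part (cylinder \<Omega>) \<rho>) (f :: _ \<Rightarrow> real)"
  by (rule integrable_continuous_on[OF finite_measure_pos_part[OF CE_signed(1)] sets_pos_part compact_cylinder[OF \<Omega>]])

lemma continuous_on_reg: "0 < e \<Longrightarrow> continuous_on (cylinder \<Omega>) (\<lambda>p. reg_rate s0 s1 e (fst p))"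
  by (rule continuous_on_reg_rate_fst[OF s(1,2)])

text \<open>No mass sits at the time where the rate of growth is singular. In \<open>CE_reg_rate\<close>, multiplied by
  \<open>e\<^sup>2\<close>, the term with \<open>\<rho>\<close> is at least \<open>2 (s1 - s0)\<^sup>2\<close> times the mass of that time slice, while the
  other terms are of order \<open>e\<close>.\<close>

lemma AE_sqrt_mass_pos:
  assumes ne: "s0 \<noteq> s1"
  shows "AE p in pos_part (cylinder \<Omega>) \<rho>. 0 < sqrt_mass s0 s1 (fst p)"
proof -
  define X where "X = cylinder \<Omega>"
  have X: "compact X" unfolding X_def by (rule compact_cylinder[OF \<Omega>])
  define P where "P = pos_part X \<rho>"
  have sP [measurable_cong]: "sets P = borel_sets_on X" and spP: "space P = X" by (simp_all add: P_def)
  interpret P: finite_measure P unfolding P_def X_def by (rule finite_measure_pos_part[OF CE_signed(1)])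
  define V where "V = measure (variation X \<zeta>) X"
  define Z where "Z = {p \<in> X. sqrt_mass s0 s1 (fst p) = 0}"
  have "continuous_on X (\<lambda>p. sqrt_mass s0 s1 (fst p))" unfolding sqrt_mass_def by (intro continuous_intros)
  then have "closedin (top_of_set X) Z" unfolding Z_def
    using continuous_closedin_preimage_constant[of X "\<lambda>p. sqrt_mass s0 s1 (fst p)" 0] by simp
  then have "closed Z" using X closedin_closed_trans compact_imp_closed by blast
  then have Z: "Z \<in> borel_sets_on X"
    by (subst sets_restrict_space_iff) (auto simp: Z_def compact_imp_closed[OF X])
  define B where "B = 2 * \<bar>s1 - s0\<bar> * V + 2 * \<bar>s1 - s0\<bar> * (s0 + s1)"
  have main: "2 * (s1 - s0)\<^sup>2 * measure P Z \<le> e * B" if e: "0 < e" "e < 1" for e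
  proof -
    let ?g = "\<lambda>p. reg_rate s0 s1 e (fst p)"
    have cg: "continuous_on X ?g" unfolding X_def by (rule continuous_on_reg[OF e(1)])
    have den: "sqrt_mass s0 s1 (fst p) + e \<ge> e" if "p \<in> X" for p
      using sqrt_mass_nonneg[OF s(1,2), of "fst p"] that by (auto simp: X_def)
    have "Z \<inter> X = Z" by (auto simp: Z_def)
    then have "2 * (s1 - s0)\<^sup>2 * measure P Z = (\<integral>p. 2 * (s1 - s0)\<^sup>2 * indicator Z p \<partial>P)"
      using Z by (simp add: sP P.emeasure_eq_measure Int_absorb2 sets.sets_into_space spP)
    also have "\<dots> \<le> (\<integral>p. e\<^sup>2 / 2 * (?g p)\<^sup>2 \<partial>P)"
    proof (rule integral_mono)
      show "integrable P (\<lambda>p. 2 * (s1 - s0)\<^sup>2 * indicator Z p)"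
        using Z by (intro integrable_mult_right integrable_real_indicator) (auto simp: sP less_top[symmetric])
      show "integrable P (\<lambda>p. e\<^sup>2 / 2 * (?g p)\<^sup>2)"
        unfolding P_def X_def by (intro pos_integrable continuous_intros continuous_on_reg e)
      fix p assume p: "p \<in> space P"
      show "2 * (s1 - s0)\<^sup>2 * indicator Z p \<le> e\<^sup>2 / 2 * (?g p)\<^sup>2"
      proof (cases "p \<in> Z")
        case True
        then have "?g p = 2 * (s1 - s0) / e" by (simp add: Z_def reg_rate_def)
        then have "e\<^sup>2 / 2 * (?g p)\<^sup>2 = 2 * (s1 - s0)\<^sup>2"
          using e by (simp only: power_divide power_mult_distrib) simp
        then show ?thesis using True by simp
      qed simp
    qed
    also have "\<dots> = e\<^sup>2 * (signed_integral X \<rho> (\<lambda>p. (?g p)\<^sup>2) / 2)"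
      by (simp add: X_def pos_integral P_def)
    also have "\<dots> = e\<^sup>2 * (signed_integral X \<zeta> ?g - reg_action s0 s1 e)"
      using CE_reg_rate[OF \<Omega> CE bdry s e(1)] by (simp add: X_def)
    also have "\<dots> = e * signed_integral X \<zeta> (\<lambda>p. e * ?g p) - e * (e * reg_action s0 s1 e)"
      by (simp add: signed_integral_cmult power2_eq_square algebra_simps)
    also have "\<dots> \<le> e * (2 * \<bar>s1 - s0\<bar> * V) + e * (2 * \<bar>s1 - s0\<bar> * (s0 + s1))"
    proof -
      have b: "\<bar>e * ?g p\<bar> \<le> 2 * \<bar>s1 - s0\<bar>" if "p \<in> X" for p
      proof -
        have "e * 2 * \<bar>s1 - s0\<bar> \<le> 2 * \<bar>s1 - s0\<bar> * (sqrt_mass s0 s1 (fst p) + e)"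
          using den[OF that] mult_left_mono[OF den[OF that], of "2 * \<bar>s1 - s0\<bar>"] by (simp add: mult_ac)
        then have "e * 2 * \<bar>s1 - s0\<bar> / (sqrt_mass s0 s1 (fst p) + e) \<le> 2 * \<bar>s1 - s0\<bar>"
          using den[OF that] e by (simp only: pos_divide_le_eq)
        moreover have "\<bar>e * ?g p\<bar> = e * 2 * \<bar>s1 - s0\<bar> / (sqrt_mass s0 s1 (fst p) + e)"
          unfolding reg_rate_def abs_mult abs_divide using den[OF that] e by simp
        ultimately show ?thesis by simp
      qed
      have z: "\<zeta> \<in> signed_measures X" unfolding X_def by (rule CE_signed)
      interpret v: finite_measure "variation X \<zeta>" by (rule finite_measure_variation[OF z])
      have c: "continuous_on X (\<lambda>p. e * ?g p)" using cg by (intro continuous_intros)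
      have "\<bar>signed_integral X \<zeta> (\<lambda>p. e * ?g p)\<bar> \<le> (\<integral>p. \<bar>e * ?g p\<bar> \<partial>variation X \<zeta>)"
        by (rule abs_signed_integral_le[OF signed_integrable_continuous[OF z X c]])
      also have "\<dots> \<le> (\<integral>p. 2 * \<bar>s1 - s0\<bar> \<partial>variation X \<zeta>)"
        using b integrable_continuous_on[OF v.finite_measure_axioms _ X c] by (intro integral_mono) auto
      also have "\<dots> = 2 * \<bar>s1 - s0\<bar> * V" by (simp add: V_def)
      finally have 1: "signed_integral X \<zeta> (\<lambda>p. e * ?g p) \<le> 2 * \<bar>s1 - s0\<bar> * V" by simp
      have q: "0 \<le> u\<^sup>2 / (u + e) \<and> u\<^sup>2 / (u + e) \<le> u" if "0 \<le> u" for u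
        using that e by (simp add: pos_divide_le_eq power2_eq_square distrib_left)
      have "reg_action s0 s1 e = 2 * (s1 - s0) * (s1\<^sup>2 / (s1 + e) - s0\<^sup>2 / (s0 + e))"
        by (simp add: reg_action_def reg_rate_def sqrt_mass_def right_diff_distrib)
      then have "\<bar>reg_action s0 s1 e\<bar> = 2 * \<bar>s1 - s0\<bar> * \<bar>s1\<^sup>2 / (s1 + e) - s0\<^sup>2 / (s0 + e)\<bar>"
        by (simp only: abs_mult abs_numeral)
      also have "\<dots> \<le> 2 * \<bar>s1 - s0\<bar> * (s0 + s1)"
        using q[OF s(1)] q[OF s(2)] s(1,2) by (intro mult_left_mono) (auto simp: abs_le_iff)
      finally have 2: "\<bar>reg_action s0 s1 e\<bar> \<le> 2 * \<bar>s1 - s0\<bar> * (s0 + s1)" .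
      have "- (e * reg_action s0 s1 e) \<le> 1 * \<bar>reg_action s0 s1 e\<bar>"
        using e by (intro order_trans[OF abs_ge_minus_self]) (simp add: abs_mult mult_left_le_one_le)
      with 2 have "- (e * reg_action s0 s1 e) \<le> 2 * \<bar>s1 - s0\<bar> * (s0 + s1)" by simp
      from add_mono[OF mult_left_mono[OF 1, of e] mult_left_mono[OF this, of e]] e
      show ?thesis by simp
    qed
    also have "\<dots> = e * B" by (simp add: B_def distrib_left)
    finally show ?thesis .
  qed
  have "2 * (s1 - s0)\<^sup>2 * measure P Z \<le> 0"
  proof (rule tendsto_lowerbound)
    show "((\<lambda>e. e * B) \<longlongrightarrow> 0) (at_right 0)" by (auto intro!: tendsto_eq_intros)
    show "\<forall>\<^sub>F e in at_right 0. 2 * (s1 - s0)\<^sup>2 * measure P Z \<le> e * B"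
      using main unfolding eventually_at_right_field by (intro exI[of _ 1]) auto
  qed simp
  moreover have pos: "0 < 2 * (s1 - s0)\<^sup>2" using ne by simp
  ultimately have "measure P Z \<le> 0"
    using mult_le_cancel_left_pos[OF pos, of "measure P Z" 0] by simp
  then have "measure P Z = 0" by (simp add: measure_le_0_iff)
  then have "Z \<in> null_sets P" using Z by (auto simp: null_sets_def sP P.emeasure_eq_measure)
  then have "AE p in P. p \<notin> Z" by (rule AE_not_in)
  moreover have "AE p in P. p \<in> X" using spP AE_space[of P] by simp
  ultimately have "AE p in P. 0 < sqrt_mass s0 s1 (fst p)"
  proof eventually_elim
    case (elim p)
    then show ?case using sqrt_mass_nonneg[OF s(1,2), of "fst p"] by (auto simp: X_def Z_def less_le)
  qed
  then show ?thesis unfolding P_def X_def .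
qed

lemma AE_reg_rate:
  "AE p in pos_part (cylinder \<Omega>) \<rho>.
     (\<forall>e>0. (reg_rate s0 s1 e (fst p))\<^sup>2 \<le> reg_rate s0 s1 e (fst p) * reg_rate s0 s1 0 (fst p)
        \<and> \<bar>reg_rate s0 s1 e (fst p)\<bar> \<le> \<bar>reg_rate s0 s1 0 (fst p)\<bar>)
     \<and> (\<lambda>n. reg_rate s0 s1 (1 / real (Suc n)) (fst p)) \<longlonglongrightarrow> reg_rate s0 s1 0 (fst p)"
proof (cases "s0 = s1")
  case True then show ?thesis by (simp add: reg_rate_def)
next
  case False
  have e: "(\<lambda>n. 1 / real (Suc n)) \<longlonglongrightarrow> 0" by (rule LIMSEQ_Suc[OF lim_const_over_n])
  show ?thesis using AE_sqrt_mass_pos[OF False]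
  proof eventually_elim
    case (elim p)
    let ?L = "sqrt_mass s0 s1 (fst p)"
    have "(2 * (s1 - s0) / (?L + e))\<^sup>2 \<le> 2 * (s1 - s0) / (?L + e) * (2 * (s1 - s0) / ?L)" if "0 < e" for e
    proof -
      have "(2 * (s1 - s0))\<^sup>2 / ((?L + e) * (?L + e)) \<le> (2 * (s1 - s0))\<^sup>2 / ((?L + e) * ?L)"
        using elim that by (intro divide_left_mono mult_left_mono mult_pos_pos) auto
      then show ?thesis by (simp add: power2_eq_square)
    qed
    moreover have "\<bar>2 * (s1 - s0) / (?L + e)\<bar> \<le> \<bar>2 * (s1 - s0) / ?L\<bar>" if "0 < e" for e
      using elim that unfolding abs_divide by (intro divide_left_mono) auto
    moreover have "(\<lambda>n. 2 * (s1 - s0) / (?L + 1 / real (Suc n))) \<longlonglongrightarrow> 2 * (s1 - s0) / (?L + 0)"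
      using elim by (intro tendsto_intros e) auto
    ultimately show ?case unfolding reg_rate_def by simp
  qed
qed

lemma rate_measurable: "(\<lambda>p. reg_rate s0 s1 e (fst p)) \<in> borel_measurable (restrict_space borel (cylinder \<Omega>))"
proof -
  have [measurable]: "(\<lambda>p :: 'd spacetime. sqrt_mass s0 s1 (fst p)) \<in> borel_measurable borel"
    unfolding sqrt_mass_def by (intro borel_measurable_continuous_onI continuous_intros)
  show ?thesis unfolding reg_rate_def by (intro measurable_restrict_space1) measurable
qed

lemma rate_measurable' [measurable]: "(\<lambda>p. reg_rate s0 s1 e (fst p)) \<in> borel_measurable (pos_part (cylinder \<Omega>) \<rho>)"
  using rate_measurable measurable_cong_sets[OF sets_pos_part refl] by blast

text \<open>Bounds on the regularized rates pass to the singular rate by Fatou's lemma.\<close>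

lemma rate_square_integrable:
  assumes le: "\<And>n. (\<integral>p. (reg_rate s0 s1 (1 / real (Suc n)) (fst p))\<^sup>2 \<partial>pos_part (cylinder \<Omega>) \<rho>) \<le> B n" and B: "B \<longlonglongrightarrow> b"
  shows "integrable (pos_part (cylinder \<Omega>) \<rho>) (\<lambda>p. (reg_rate s0 s1 0 (fst p))\<^sup>2)"
    and "(\<integral>p. (reg_rate s0 s1 0 (fst p))\<^sup>2 \<partial>pos_part (cylinder \<Omega>) \<rho>) \<le> b"
    and "integrable (pos_part (cylinder \<Omega>) \<rho>) (\<lambda>p. reg_rate s0 s1 0 (fst p))"
proof -
  define P where "P = pos_part (cylinder \<Omega>) \<rho>"
  interpret P: finite_measure P unfolding P_def by (rule finite_measure_pos_part[OF CE_signed(1)])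
  note m [measurable] = rate_measurable'[folded P_def]
  let ?g = "\<lambda>e p. reg_rate s0 s1 e (fst p)" and ?e = "\<lambda>n. 1 / real (Suc n)"
  have b: "0 \<le> b"
  proof (rule LIMSEQ_le_const[OF B])
    show "\<exists>N. \<forall>n\<ge>N. 0 \<le> B n"
      by (intro exI[of _ 0] allI impI order_trans[OF _ le]) (auto intro!: integral_nonneg_AE)
  qed
  have "(\<integral>\<^sup>+p. ennreal ((?g 0 p)\<^sup>2) \<partial>P) = (\<integral>\<^sup>+p. liminf (\<lambda>n. ennreal ((?g (?e n) p)\<^sup>2)) \<partial>P)"
  proof (rule nn_integral_cong_AE)
    show "AE p in P. ennreal ((?g 0 p)\<^sup>2) = liminf (\<lambda>n. ennreal ((?g (?e n) p)\<^sup>2))"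
      using AE_reg_rate unfolding P_def[symmetric]
    proof eventually_elim
      case (elim p)
      then have "(\<lambda>n. ennreal ((?g (?e n) p)\<^sup>2)) \<longlonglongrightarrow> ennreal ((?g 0 p)\<^sup>2)"
        by (intro tendsto_ennrealI tendsto_power) auto
      then show ?case by (intro lim_imp_Liminf[symmetric]) auto
    qed
  qed
  also have "\<dots> \<le> liminf (\<lambda>n. \<integral>\<^sup>+p. ennreal ((?g (?e n) p)\<^sup>2) \<partial>P)"
    by (rule nn_integral_liminf) measurable
  also have "\<dots> \<le> liminf (\<lambda>n. ennreal (B n))"
  proof (intro Liminf_mono always_eventually allI)
    fix n
    have "(\<integral>\<^sup>+p. ennreal ((?g (?e n) p)\<^sup>2) \<partial>P) = ennreal (\<integral>p. (?g (?e n) p)\<^sup>2 \<partial>P)"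
      unfolding P_def
      by (intro nn_integral_eq_integral pos_integrable continuous_intros continuous_on_reg) auto
    then show "(\<integral>\<^sup>+p. ennreal ((?g (?e n) p)\<^sup>2) \<partial>P) \<le> ennreal (B n)"
      using le[of n] by (simp add: P_def ennreal_leI)
  qed
  also have "\<dots> = ennreal b"
    using tendsto_ennrealI[OF B] by (intro lim_imp_Liminf) auto
  finally have nn: "(\<integral>\<^sup>+p. ennreal ((?g 0 p)\<^sup>2) \<partial>P) \<le> ennreal b" .
  then have i: "integrable P (\<lambda>p. (?g 0 p)\<^sup>2)"
    by (intro integrableI_bounded) (auto intro: le_less_trans)
  then show "integrable (pos_part (cylinder \<Omega>) \<rho>) (\<lambda>p. (reg_rate s0 s1 0 (fst p))\<^sup>2)" by (simp add: P_def)
  have "ennreal (\<integral>p. (?g 0 p)\<^sup>2 \<partial>P) \<le> ennreal b"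
    using nn nn_integral_eq_integral[OF i] by simp
  then show "(\<integral>p. (reg_rate s0 s1 0 (fst p))\<^sup>2 \<partial>pos_part (cylinder \<Omega>) \<rho>) \<le> b" using b by (simp add: P_def)
  have "integrable P (?g 0)"
  proof (rule Bochner_Integration.integrable_bound)
    show "integrable P (\<lambda>p. (?g 0 p)\<^sup>2 + 1)" using i by simp
    have "\<bar>x\<bar> \<le> x\<^sup>2 + 1" for x :: real
      using sum_squares_bound[of "\<bar>x\<bar>" 1] abs_ge_zero[of x] by (simp add: power2_eq_square)
    then show "AE p in P. norm (?g 0 p) \<le> norm ((?g 0 p)\<^sup>2 + 1)" by (intro AE_I2) simp
  qed measurable
  then show "integrable (pos_part (cylinder \<Omega>) \<rho>) (\<lambda>p. reg_rate s0 s1 0 (fst p))" by (simp add: P_def)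
qed

lemma density_product_integral:
  assumes g: "g \<in> borel_measurable (restrict_space borel (cylinder \<Omega>))"
    and dp: "is_density_product (cylinder \<Omega>) \<zeta> g \<rho>"
  shows "integrable (pos_part (cylinder \<Omega>) \<rho>) g"
    and "f \<in> borel_measurable (restrict_space borel (cylinder \<Omega>)) \<Longrightarrow>
      integrable (pos_part (cylinder \<Omega>) \<rho>) (\<lambda>p. f p * g p) \<Longrightarrow>
      signed_integral (cylinder \<Omega>) \<zeta> f = (\<integral>p. f p * g p \<partial>pos_part (cylinder \<Omega>) \<rho>)"
proof -
  let ?X = "cylinder \<Omega>"
  show i: "integrable (pos_part ?X \<rho>) g" using dp by (simp add: is_density_product_def signed_integrable_def)
  have id: "(\<lambda>p. p) \<in> measurable (pos_part ?X \<rho>) (restrict_space borel ?X)"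
    by (rule measurable_ident_sets[OF sets_pos_part])
  have "\<zeta> = push_density ?X (pos_part ?X \<rho>) (\<lambda>p. p) g"
  proof
    fix A show "\<zeta> A = push_density ?X (pos_part ?X \<rho>) (\<lambda>p. p) g A"
      using dp CE_signed(3) by (cases "A \<in> borel_sets_on ?X")
        (simp_all add: is_density_product_def push_density_def pos_integral signed_measures_outside)
  qed
  then show "signed_integral ?X \<zeta> f = (\<integral>p. f p * g p \<partial>pos_part ?X \<rho>)"
    if "f \<in> borel_measurable (restrict_space borel ?X)" "integrable (pos_part ?X \<rho>) (\<lambda>p. f p * g p)"
    using push_density_integral[OF id i that] by simp
qed

text \<open>If \<open>\<zeta> = g \<rho>\<close>, then \<open>g\<^sub>e\<^sup>2 \<le> g\<^sub>e g\<close> gives \<open>\<integral> g\<^sub>e\<^sup>2 d\<rho> \<le> \<integral> g\<^sub>e d\<zeta>\<close>, and \<open>CE_reg_rate\<close> expresses the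
  right-hand side by half of the left-hand side.\<close>

lemma reg_rate_square_le_growth:
  assumes dp: "is_density_product (cylinder \<Omega>) \<zeta> (\<lambda>p. reg_rate s0 s1 0 (fst p)) \<rho>" and e: "0 < e"
  shows "(\<integral>p. (reg_rate s0 s1 e (fst p))\<^sup>2 \<partial>pos_part (cylinder \<Omega>) \<rho>) \<le> 2 * reg_action s0 s1 e"
proof -
  define P where "P = pos_part (cylinder \<Omega>) \<rho>"
  let ?g = "\<lambda>e p. reg_rate s0 s1 e (fst p)"
  note m [measurable] = rate_measurable'[folded P_def]
  have ig: "integrable P (?g 0)" unfolding P_def by (rule density_product_integral(1)[OF rate_measurable dp])
  have isq: "integrable P (\<lambda>p. (?g e p)\<^sup>2)"
    unfolding P_def by (intro pos_integrable continuous_intros continuous_on_reg e)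
  obtain B where B: "\<And>p. p \<in> cylinder \<Omega> \<Longrightarrow> \<bar>?g e p\<bar> \<le> B"
    using continuous_on_compact_bound[OF compact_cylinder[OF \<Omega>] continuous_on_reg[OF e]]
    by (metis real_norm_def)
  have ip: "integrable P (\<lambda>p. ?g e p * ?g 0 p)"
  proof (rule Bochner_Integration.integrable_bound)
    show "integrable P (\<lambda>p. B * ?g 0 p)" using ig by simp
    show "AE p in P. norm (?g e p * ?g 0 p) \<le> norm (B * ?g 0 p)"
    proof (rule AE_I2)
      fix p assume "p \<in> space P"
      then have "\<bar>?g e p\<bar> \<le> \<bar>B\<bar>" using B[of p] by (auto simp: P_def)
      then show "norm (?g e p * ?g 0 p) \<le> norm (B * ?g 0 p)" by (simp add: abs_mult mult_right_mono)
    qed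
  qed measurable
  have "(\<integral>p. (?g e p)\<^sup>2 \<partial>P) \<le> (\<integral>p. ?g e p * ?g 0 p \<partial>P)"
    using AE_reg_rate e unfolding P_def[symmetric] by (intro integral_mono_AE isq ip) (auto elim: eventually_mono)
  also have "\<dots> = signed_integral (cylinder \<Omega>) \<zeta> (?g e)"
    unfolding P_def by (rule density_product_integral(2)[OF rate_measurable dp rate_measurable ip[unfolded P_def], symmetric])
  also have "\<dots> = reg_action s0 s1 e + (\<integral>p. (?g e p)\<^sup>2 \<partial>P) / 2"
    using CE_reg_rate[OF \<Omega> CE bdry s e] by (simp add: pos_integral P_def)
  finally show ?thesis by (simp add: P_def)
qed

text \<open>The growth part of a competitor for \<open>d_gBB\<close> is \<open>1/2 \<integral> g\<^sup>2 d\<rho>\<close>, which is at most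
  \<open>2 (s1 - s0)\<^sup>2\<close>. On the dual side, Young's inequality for \<open>c g\<close> splits off this amount and absorbs
  the rest of \<open>\<integral> c d\<zeta>\<close> into \<open>a\<close>.\<close>

lemma D_growth_le:
  assumes dp: "is_density_product (cylinder \<Omega>) \<zeta> (\<lambda>p. reg_rate s0 s1 0 (fst p)) \<rho>"
    and C: "0 \<le> C" "D_BB \<Omega> \<rho> \<omega> \<le> ennreal C" and \<delta>: "0 < \<delta>"
  shows "D \<Omega> \<delta> (\<rho>, \<omega>, \<zeta>) \<le> ennreal (C + \<delta>\<^sup>2 * (2 * (s1 - s0)\<^sup>2))"
proof -
  define X where "X = cylinder \<Omega>"
  define P where "P = pos_part X \<rho>"
  let ?g = "\<lambda>e p. reg_rate s0 s1 e (fst p)"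
  have lim: "(\<lambda>n. 2 * reg_action s0 s1 (1 / real (Suc n))) \<longlonglongrightarrow> 2 * (2 * (s1 - s0)\<^sup>2)"
    by (intro tendsto_mult_left reg_action_tendsto s)
  note sq = rate_square_integrable[OF reg_rate_square_le_growth[OF dp] lim, folded X_def, folded P_def, simplified]
  have tr0: "(\<rho>, \<omega>, \<lambda>A. 0) \<in> triples \<Omega>" using CE_signed by (auto simp: triples_def)
  have "\<forall>a b c. admissible X \<delta> a b c \<longrightarrow> pairing X \<rho> \<omega> \<zeta> a b c \<le> C + \<delta>\<^sup>2 * (2 * (s1 - s0)\<^sup>2)"
  proof (intro allI impI)
    fix a c and b :: "'d \<Rightarrow> 'd spacetime \<Rightarrow> real" assume adm: "admissible X \<delta> a b c"
    then have ca: "continuous_on X a" "continuous_on X c" by (auto simp: admissible_def)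
    define a' where "a' p = a p + (c p)\<^sup>2 / (2 * \<delta>\<^sup>2)" for p
    have ca': "continuous_on X a'" unfolding a'_def using ca \<delta> by (intro continuous_intros) auto
    have "admissible X 1 a' b (\<lambda>p. 0)"
      using adm ca' by (auto simp: admissible_def a'_def add_divide_distrib algebra_simps)
    then have bb: "pairing X \<rho> \<omega> (\<lambda>A. 0) a' b (\<lambda>p. 0) \<le> C"
      using D_le_iff[OF \<Omega> tr0, of 1 C] C by (simp add: D_BB_def X_def)
    have i: "integrable P a" "integrable P a'" "integrable P (\<lambda>p. (c p)\<^sup>2)"
      unfolding P_def X_def by (intro pos_integrable continuous_intros ca[unfolded X_def] ca'[unfolded X_def])+
    have mc: "c \<in> borel_measurable (restrict_space borel X)" by (rule borel_measurable_continuous_on_restrict[OF ca(2)])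
    have mcP [measurable]: "c \<in> borel_measurable P"
      unfolding P_def using mc measurable_cong_sets[OF sets_pos_part refl] by blast
    have mg [measurable]: "?g 0 \<in> borel_measurable P" unfolding P_def X_def by (rule rate_measurable')
    have young: "\<bar>c p * ?g 0 p\<bar> \<le> (c p)\<^sup>2 / (2 * \<delta>\<^sup>2) + \<delta>\<^sup>2 / 2 * (?g 0 p)\<^sup>2" for p
    proof -
      have "\<bar>u * v\<bar> \<le> u\<^sup>2 / (2 * \<delta>\<^sup>2) + \<delta>\<^sup>2 / 2 * v\<^sup>2" for u v
      proof -
        have "0 \<le> (\<bar>u\<bar> / \<delta> - \<delta> * \<bar>v\<bar>)\<^sup>2 / 2" by simp
        also have "\<dots> = u\<^sup>2 / (2 * \<delta>\<^sup>2) + \<delta>\<^sup>2 / 2 * v\<^sup>2 - \<bar>u * v\<bar>"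
          using \<delta> by (simp add: power2_diff power_divide power_mult_distrib abs_mult diff_divide_distrib add_divide_distrib)
        finally show ?thesis by simp
      qed
      then show ?thesis .
    qed
    have iy: "integrable P (\<lambda>p. (c p)\<^sup>2 / (2 * \<delta>\<^sup>2) + \<delta>\<^sup>2 / 2 * (?g 0 p)\<^sup>2)"
      using i(3) sq(1) by simp
    have icg: "integrable P (\<lambda>p. c p * ?g 0 p)"
    proof (rule Bochner_Integration.integrable_bound[OF iy])
      show "AE p in P. norm (c p * ?g 0 p) \<le> norm ((c p)\<^sup>2 / (2 * \<delta>\<^sup>2) + \<delta>\<^sup>2 / 2 * (?g 0 p)\<^sup>2)"
        using young by (intro AE_I2) (auto intro: order_trans)
    qed measurable
    have "signed_integral X \<zeta> c = (\<integral>p. c p * ?g 0 p \<partial>P)"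
      unfolding P_def X_def
      by (rule density_product_integral(2)[OF rate_measurable dp mc[unfolded X_def] icg[unfolded P_def X_def]])
    also have "\<dots> \<le> (\<integral>p. (c p)\<^sup>2 / (2 * \<delta>\<^sup>2) + \<delta>\<^sup>2 / 2 * (?g 0 p)\<^sup>2 \<partial>P)"
      using young by (intro integral_mono icg iy) (auto simp: abs_le_iff)
    also have "\<dots> = (\<integral>p. a' p - a p \<partial>P) + \<delta>\<^sup>2 / 2 * (\<integral>p. (?g 0 p)\<^sup>2 \<partial>P)"
      using i(3) sq(1) by (simp add: a'_def)
    also have "\<dots> \<le> (\<integral>p. a' p \<partial>P) - (\<integral>p. a p \<partial>P) + \<delta>\<^sup>2 / 2 * (2 * (2 * (s1 - s0)\<^sup>2))"
      using i sq(2) by (intro add_mono mult_left_mono) auto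
    finally have "signed_integral X \<zeta> c + (\<integral>p. a p \<partial>P) \<le> (\<integral>p. a' p \<partial>P) + \<delta>\<^sup>2 * (2 * (s1 - s0)\<^sup>2)"
      by simp
    then show "pairing X \<rho> \<omega> \<zeta> a b c \<le> C + \<delta>\<^sup>2 * (2 * (s1 - s0)\<^sup>2)"
      using bb by (simp add: pairing_def X_def pos_integral P_def)
  qed
  moreover have "0 \<le> C + \<delta>\<^sup>2 * (2 * (s1 - s0)\<^sup>2)" using C by simp
  ultimately show ?thesis using D_le_iff[OF \<Omega> CE_triples[OF CE] \<delta>] by (simp add: X_def)
qed

text \<open>If the growth part is minimal, then perturbing the optimal multiplier \<open>g\<close> to \<open>g + t h\<close> changes the
  dual value by \<open>t (\<integral> h d\<zeta> - \<integral> h g d\<rho>)\<close> up to a term of order \<open>t\<^sup>2\<close>. As the value for \<open>g\<close> is already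
  the maximum, the linear term vanishes for every \<open>h\<close>.\<close>

lemma growth_rigidity:
  assumes le: "\<And>a c. continuous_on (cylinder \<Omega>) a \<Longrightarrow> continuous_on (cylinder \<Omega>) c \<Longrightarrow>
      (\<And>p. p \<in> cylinder \<Omega> \<Longrightarrow> a p + (c p)\<^sup>2 / 2 \<le> 0) \<Longrightarrow>
      signed_integral (cylinder \<Omega>) \<rho> a + signed_integral (cylinder \<Omega>) \<zeta> c \<le> 2 * (s1 - s0)\<^sup>2"
  shows "is_density_product (cylinder \<Omega>) \<zeta> (\<lambda>p. reg_rate s0 s1 0 (fst p)) \<rho>"
proof -
  define X where "X = cylinder \<Omega>"
  have X: "compact X" unfolding X_def by (rule compact_cylinder[OF \<Omega>])
  define P where "P = pos_part X \<rho>"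
  define K where "K = 2 * (s1 - s0)\<^sup>2"
  let ?g = "\<lambda>e p. reg_rate s0 s1 e (fst p)" and ?e = "\<lambda>n. 1 / real (Suc n)"
  have e: "0 < ?e n" for n by simp
  note m [measurable] = rate_measurable'[folded X_def, folded P_def]
  have cg: "continuous_on X (?g (?e n))" for n unfolding X_def by (rule continuous_on_reg[OF e])
  have iP: "integrable P f" if "continuous_on X f" for f :: "_ \<Rightarrow> real" using that unfolding P_def X_def by (rule pos_integrable)
  have \<zeta>: "\<zeta> \<in> signed_measures X" unfolding X_def by (rule CE_signed)
  have si: "signed_integrable X \<zeta> f" if "continuous_on X f" for f by (rule signed_integrable_continuous[OF \<zeta> X that])
  have id: "signed_integral X \<zeta> (?g (?e n)) = reg_action s0 s1 (?e n) + (\<integral>p. (?g (?e n) p)\<^sup>2 \<partial>P) / 2" for n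
    using CE_reg_rate[OF \<Omega> CE bdry s e] by (simp add: pos_integral P_def X_def)
  have le': "(\<integral>p. - (c p)\<^sup>2 / 2 \<partial>P) + signed_integral X \<zeta> c \<le> K" if c: "continuous_on X c" for c
  proof -
    have "continuous_on X (\<lambda>p. - (c p)\<^sup>2 / 2)" using c by (intro continuous_intros) simp_all
    from le[OF this[unfolded X_def] c[unfolded X_def]] show ?thesis
      by (simp add: X_def P_def K_def pos_integral)
  qed
  have "(\<integral>p. (?g (?e n) p)\<^sup>2 \<partial>P) \<le> 8 * (K - reg_action s0 s1 (?e n) / 2)" for n
  proof -
    \<comment> \<open>With the factor 1/2 the quadratic terms of the dual value and of \<open>CE_reg_rate\<close> do not cancel,
      which bounds \<open>\<integral> g\<^sub>e\<^sup>2 d\<rho>\<close>.\<close>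
    have "(\<integral>p. - (1/2 * ?g (?e n) p)\<^sup>2 / 2 \<partial>P) + signed_integral X \<zeta> (\<lambda>p. 1/2 * ?g (?e n) p) \<le> K"
      by (intro le' continuous_intros cg)
    moreover have "(\<integral>p. - (1/2 * ?g (?e n) p)\<^sup>2 / 2 \<partial>P) = - (1/8) * (\<integral>p. (?g (?e n) p)\<^sup>2 \<partial>P)"
      by (simp add: power_divide power_mult_distrib)
    moreover have "G \<le> 8 * (L - R / 2)" if "- (1/8) * G + 1/2 * (R + G / 2) \<le> L" for G R L :: real
      using that by (simp add: field_simps)
    ultimately show ?thesis by (simp only: signed_integral_cmult id)
  qed
  moreover have "(\<lambda>n. 8 * (K - reg_action s0 s1 (?e n) / 2)) \<longlonglongrightarrow> 8 * (K - K / 2)"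
    unfolding K_def by (intro tendsto_intros reg_action_tendsto s) simp
  ultimately have ig: "integrable P (?g 0)"
    unfolding P_def X_def by (rule rate_square_integrable(3))
  have main: "signed_integral X \<zeta> h = (\<integral>p. h p * ?g 0 p \<partial>P)" if h: "continuous_on X h" for h
  proof -
    obtain B where B: "\<And>p. p \<in> X \<Longrightarrow> \<bar>h p\<bar> \<le> B"
      using compact_imp_bounded[OF compact_continuous_image[OF h X]] by (auto simp: bounded_iff)
    have mh [measurable]: "h \<in> borel_measurable P"
      using iP[OF h] by simp
    have lim: "(\<lambda>n. \<integral>p. h p * ?g (?e n) p \<partial>P) \<longlonglongrightarrow> (\<integral>p. h p * ?g 0 p \<partial>P)"
    proof (rule integral_dominated_convergence[where w="\<lambda>p. \<bar>B\<bar> * \<bar>?g 0 p\<bar>"])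
      show "integrable P (\<lambda>p. \<bar>B\<bar> * \<bar>?g 0 p\<bar>)" using ig by simp
      show "AE p in P. (\<lambda>n. h p * ?g (?e n) p) \<longlonglongrightarrow> h p * ?g 0 p"
        using AE_reg_rate unfolding P_def[symmetric] X_def[symmetric]
        by eventually_elim (auto intro!: tendsto_mult_left)
      show "AE p in P. norm (h p * ?g (?e n) p) \<le> \<bar>B\<bar> * \<bar>?g 0 p\<bar>" for n
      proof -
        have "AE p in P. p \<in> X" using AE_space[of P] by (simp add: P_def)
        then show ?thesis using AE_reg_rate unfolding P_def[symmetric] X_def[symmetric]
        proof eventually_elim
          case (elim p)
          have "\<bar>h p\<bar> \<le> \<bar>B\<bar>" using B[OF elim(1)] by simp
          moreover have "\<bar>?g (?e n) p\<bar> \<le> \<bar>?g 0 p\<bar>" using elim(2) e by blast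
          ultimately show ?case by (simp add: abs_mult mult_mono)
        qed
      qed
    qed measurable
    have ineq: "t * (signed_integral X \<zeta> h - (\<integral>p. h p * ?g 0 p \<partial>P)) \<le> t\<^sup>2 * ((\<integral>p. (h p)\<^sup>2 \<partial>P) / 2)" for t
    proof -
      have "reg_action s0 s1 (?e n) + t * signed_integral X \<zeta> h - t * (\<integral>p. h p * ?g (?e n) p \<partial>P)
          - t\<^sup>2 * ((\<integral>p. (h p)\<^sup>2 \<partial>P) / 2) \<le> K" for n
      proof -
        have ii: "integrable P (\<lambda>p. (?g (?e n) p)\<^sup>2)" "integrable P (\<lambda>p. h p * ?g (?e n) p)" "integrable P (\<lambda>p. (h p)\<^sup>2)"
          by (intro iP continuous_intros cg h)+
        have "(\<integral>p. - (?g (?e n) p + t * h p)\<^sup>2 / 2 \<partial>P)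
            = (\<integral>p. (- 1/2) * (?g (?e n) p)\<^sup>2 + (- t) * (h p * ?g (?e n) p) + (- t\<^sup>2 / 2) * (h p)\<^sup>2 \<partial>P)"
          by (intro Bochner_Integration.integral_cong) (auto simp: power2_eq_square field_simps)
        also have "\<dots> = (- 1/2) * (\<integral>p. (?g (?e n) p)\<^sup>2 \<partial>P) + (- t) * (\<integral>p. h p * ?g (?e n) p \<partial>P)
            + (- t\<^sup>2 / 2) * (\<integral>p. (h p)\<^sup>2 \<partial>P)"
          using ii by simp
        finally have 1: "(\<integral>p. - (?g (?e n) p + t * h p)\<^sup>2 / 2 \<partial>P) = (- 1/2) * (\<integral>p. (?g (?e n) p)\<^sup>2 \<partial>P)
            + (- t) * (\<integral>p. h p * ?g (?e n) p \<partial>P) + (- t\<^sup>2 / 2) * (\<integral>p. (h p)\<^sup>2 \<partial>P)" .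
        have "continuous_on X (\<lambda>p. t * h p)" using h by (intro continuous_intros)
        then have 2: "signed_integral X \<zeta> (\<lambda>p. ?g (?e n) p + t * h p) = signed_integral X \<zeta> (?g (?e n)) + t * signed_integral X \<zeta> h"
          by (subst signed_integral_add[OF si[OF cg] si]) (simp_all add: signed_integral_cmult)
        have "continuous_on X (\<lambda>p. ?g (?e n) p + t * h p)" by (intro continuous_intros cg h)
        from le'[OF this] show ?thesis unfolding 1 2 id by simp
      qed
      moreover have "(\<lambda>n. reg_action s0 s1 (?e n) + t * signed_integral X \<zeta> h - t * (\<integral>p. h p * ?g (?e n) p \<partial>P)
          - t\<^sup>2 * ((\<integral>p. (h p)\<^sup>2 \<partial>P) / 2)) \<longlonglongrightarrow> K + t * signed_integral X \<zeta> h - t * (\<integral>p. h p * ?g 0 p \<partial>P)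
          - t\<^sup>2 * ((\<integral>p. (h p)\<^sup>2 \<partial>P) / 2)"
        unfolding K_def by (intro tendsto_intros reg_action_tendsto s lim)
      ultimately have "K + t * signed_integral X \<zeta> h - t * (\<integral>p. h p * ?g 0 p \<partial>P)
          - t\<^sup>2 * ((\<integral>p. (h p)\<^sup>2 \<partial>P) / 2) \<le> K"
        by (intro LIMSEQ_le_const2) auto
      then show ?thesis by (simp add: right_diff_distrib)
    qed
    define A where "A = signed_integral X \<zeta> h - (\<integral>p. h p * ?g 0 p \<partial>P)"
    define B' where "B' = \<bar>(\<integral>p. (h p)\<^sup>2 \<partial>P) / 2\<bar> + 1"
    have B': "0 < B'" unfolding B'_def by (rule add_nonneg_pos) auto
    define q where "q = A / B'"
    have q: "A = q * B'" using B' by (simp add: q_def)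
    have "q * A \<le> q\<^sup>2 * ((\<integral>p. (h p)\<^sup>2 \<partial>P) / 2)" using ineq[of q] by (simp add: A_def)
    also have "\<dots> \<le> q\<^sup>2 * (B' - 1)" by (intro mult_left_mono) (auto simp: B'_def)
    finally have "q\<^sup>2 \<le> 0" unfolding q by (simp add: power2_eq_square right_diff_distrib)
    then have "A = 0" using q by simp
    then show ?thesis by (simp add: A_def)
  qed
  have idm: "(\<lambda>p. p) \<in> measurable P (restrict_space borel X)"
    unfolding P_def by (rule measurable_ident_sets[OF sets_pos_part])
  have "\<zeta> = push_density X P (\<lambda>p. p) (?g 0)"
  proof (rule signed_measure_eqI[OF X \<zeta> push_density_signed[OF idm ig]])
    fix h :: "'d spacetime \<Rightarrow> real" assume h: "continuous_on X h"
    obtain B where B: "\<And>p. p \<in> X \<Longrightarrow> \<bar>h p\<bar> \<le> B"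
      using compact_imp_bounded[OF compact_continuous_image[OF h X]] by (auto simp: bounded_iff)
    have [measurable]: "h \<in> borel_measurable P" using iP[OF h] by simp
    have "integrable P (\<lambda>p. h p * ?g 0 p)"
    proof (rule Bochner_Integration.integrable_bound)
      show "integrable P (\<lambda>p. \<bar>B\<bar> * ?g 0 p)" using ig by simp
      show "AE p in P. norm (h p * ?g 0 p) \<le> norm (\<bar>B\<bar> * ?g 0 p)"
        using B by (intro AE_I2) (force simp: P_def abs_mult intro!: mult_right_mono)
    qed measurable
    then show "signed_integral X \<zeta> h = signed_integral X (push_density X P (\<lambda>p. p) (?g 0)) h"
      using main[OF h] push_density_integral[OF idm ig borel_measurable_continuous_on_restrict[OF h]] by simp
  qed
  then have "\<zeta> A = signed_integral X \<rho> (\<lambda>p. indicator A p * ?g 0 p)" if "A \<in> borel_sets_on X" for A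
    using that by (simp add: push_density_def pos_integral X_def P_def)
  moreover have "signed_integrable X \<rho> (?g 0)"
    using ig integrable_neg_part_nonneg_measure[OF nonneg rate_measurable]
    by (simp add: signed_integrable_def P_def X_def)
  ultimately show ?thesis by (simp add: is_density_product_def X_def)
qed

end

section \<open>Mass moving along segments\<close>

abbreviation unit_time :: "real measure" where
  "unit_time \<equiv> restrict_space lborel {0..1}"

lemma finite_unit_time: "finite_measure unit_time"
  by (rule finite_measureI) (simp add: emeasure_restrict_space)

text \<open>At time \<open>t\<close> the particle with label \<open>x\<close> is on the segment from \<open>\<alpha> x\<close> to \<open>\<beta> x\<close>.\<close>

definition segment_flow :: "('s \<Rightarrow> real ^ 'd) \<Rightarrow> ('s \<Rightarrow> real ^ 'd) \<Rightarrow> real \<times> 's \<Rightarrow> 'd spacetime" where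
  "segment_flow \<alpha> \<beta> = (\<lambda>(t, x). (t, (1 - t) *\<^sub>R \<alpha> x + t *\<^sub>R \<beta> x))"

context
  fixes \<Omega> :: "(real ^ 'd::finite) set" and M :: "'s measure" and \<alpha> \<beta> :: "'s \<Rightarrow> real ^ 'd" and k k' :: "real \<Rightarrow> real"
  assumes \<Omega>: "bounded \<Omega>" "convex \<Omega>" and M: "finite_measure M"
    and \<alpha>\<beta>: "\<alpha> \<in> borel_measurable M" "\<beta> \<in> borel_measurable M"
      "\<And>x. x \<in> space M \<Longrightarrow> \<alpha> x \<in> closure \<Omega>" "\<And>x. x \<in> space M \<Longrightarrow> \<beta> x \<in> closure \<Omega>"
    and k: "\<And>t. t \<in> {0..1} \<Longrightarrow> (k has_real_derivative k' t) (at t within {0..1})" "continuous_on {0..1} k'"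
begin

lemma flow_in_cylinder: "t \<in> {0..1} \<Longrightarrow> x \<in> space M \<Longrightarrow> segment_flow \<alpha> \<beta> (t, x) \<in> cylinder \<Omega>"
  using \<alpha>\<beta>(3,4)[of x] convex_closure[OF \<Omega>(2)]
  by (auto simp: segment_flow_def convex_def)

lemma space_time_pair: "space (unit_time \<Otimes>\<^sub>M M) = {0..1} \<times> space M"
  by (simp add: space_pair_measure space_restrict_space)

lemma finite_time_pair: "finite_measure (unit_time \<Otimes>\<^sub>M M)"
  by (rule finite_measure_pair_measure[OF M finite_unit_time])

lemma measurable_time: 
  assumes "continuous_on {0..1} f" shows "(\<lambda>p. f (fst p) :: real) \<in> borel_measurable (unit_time \<Otimes>\<^sub>M M)"
proof -
  have "f \<in> borel_measurable unit_time"
    using borel_measurable_continuous_on_restrict[OF assms]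
    by (simp add: measurable_cong_sets[OF sets_restrict_space_cong[OF sets_lborel] refl])
  then show ?thesis by (rule measurable_compose[OF measurable_fst])
qed

lemma measurable_flow: "segment_flow \<alpha> \<beta> \<in> measurable (unit_time \<Otimes>\<^sub>M M) (restrict_space borel (cylinder \<Omega>))"
proof (rule measurable_restrict_space2)
  show "segment_flow \<alpha> \<beta> \<in> space (unit_time \<Otimes>\<^sub>M M) \<rightarrow> cylinder \<Omega>"
    using flow_in_cylinder by (auto simp: space_time_pair)
  have [measurable]: "(\<lambda>p. fst p) \<in> borel_measurable (unit_time \<Otimes>\<^sub>M M)"
    by (rule measurable_time) (rule continuous_on_id)
  have [measurable]: "(\<lambda>p. \<alpha> (snd p)) \<in> borel_measurable (unit_time \<Otimes>\<^sub>M M)" "(\<lambda>p. \<beta> (snd p)) \<in> borel_measurable (unit_time \<Otimes>\<^sub>M M)"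
    by (rule measurable_compose[OF measurable_snd] \<alpha>\<beta>)+
  show "segment_flow \<alpha> \<beta> \<in> borel_measurable (unit_time \<Otimes>\<^sub>M M)"
    unfolding segment_flow_def case_prod_unfold by (intro borel_measurable_Pair) measurable
qed

lemma velocity_measurable: "(\<lambda>p. (\<beta> (snd p) - \<alpha> (snd p)) $ i) \<in> borel_measurable (unit_time \<Otimes>\<^sub>M M)"
proof -
  have [measurable]: "(\<lambda>p. \<alpha> (snd p)) \<in> borel_measurable (unit_time \<Otimes>\<^sub>M M)" "(\<lambda>p. \<beta> (snd p)) \<in> borel_measurable (unit_time \<Otimes>\<^sub>M M)"
    by (rule measurable_compose[OF measurable_snd] \<alpha>\<beta>)+
  have "(\<lambda>v :: real ^ 'd. v $ i) \<in> borel_measurable borel" by (intro borel_measurable_continuous_onI continuous_intros)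
  then show ?thesis by (rule measurable_compose[rotated]) measurable
qed

lemma velocity_bounded: obtains B where "\<And>x i. x \<in> space M \<Longrightarrow> \<bar>(\<beta> x - \<alpha> x) $ i\<bar> \<le> B"
proof -
  obtain B where B: "\<And>y. y \<in> closure \<Omega> \<Longrightarrow> norm y \<le> B"
    using bounded_closure[OF \<Omega>(1)] by (auto simp: bounded_iff)
  have "\<bar>(\<beta> x - \<alpha> x) $ i\<bar> \<le> B + B" if "x \<in> space M" for x i
    using component_le_norm_cart[of "\<beta> x - \<alpha> x" i] norm_triangle_ineq4[of "\<beta> x" "\<alpha> x"] B[OF \<alpha>\<beta>(3)[OF that]] B[OF \<alpha>\<beta>(4)[OF that]]
    by linarith
  then show thesis by (rule that)
qed

lemma k_continuous: "continuous_on {0..1} k"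
  using k(1) by (meson DERIV_continuous_on)

lemma integrable_time_pair:
  assumes "f \<in> borel_measurable (unit_time \<Otimes>\<^sub>M M)" "\<And>t x. t \<in> {0..1} \<Longrightarrow> x \<in> space M \<Longrightarrow> \<bar>f (t, x)\<bar> \<le> B"
  shows "integrable (unit_time \<Otimes>\<^sub>M M) (f :: _ \<Rightarrow> real)"
  by (rule finite_measure.integrable_const_bound[OF finite_time_pair, where B=B])
    (use assms in \<open>auto simp: space_time_pair intro!: AE_I2\<close>)

lemma integrable_flow:
  fixes v :: "real \<times> 's \<Rightarrow> real"
  assumes h: "continuous_on (cylinder \<Omega>) h" and c: "continuous_on {0..1} c"
    and v: "v \<in> borel_measurable (unit_time \<Otimes>\<^sub>M M)" "\<And>t x. t \<in> {0..1} \<Longrightarrow> x \<in> space M \<Longrightarrow> \<bar>v (t, x)\<bar> \<le> V"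
  shows "integrable (unit_time \<Otimes>\<^sub>M M) (\<lambda>p. h (segment_flow \<alpha> \<beta> p) * (c (fst p) * v p) :: real)"
proof -
  obtain A where A: "\<And>p. p \<in> cylinder \<Omega> \<Longrightarrow> \<bar>h p\<bar> \<le> A"
    using continuous_on_compact_bound[OF compact_Times[OF compact_Icc compact_closure[THEN iffD2, OF \<Omega>(1)]] h] by (metis real_norm_def)
  obtain B where B: "\<And>t. t \<in> {0..1} \<Longrightarrow> \<bar>c t\<bar> \<le> B"
    using continuous_on_compact_bound[OF compact_Icc c] by (metis real_norm_def)
  show ?thesis
  proof (rule integrable_time_pair)
    have "(\<lambda>p. h (segment_flow \<alpha> \<beta> p)) \<in> borel_measurable (unit_time \<Otimes>\<^sub>M M)"
      by (rule measurable_compose[OF measurable_flow borel_measurable_continuous_on_restrict[OF h]])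
    then show "(\<lambda>p. h (segment_flow \<alpha> \<beta> p) * (c (fst p) * v p)) \<in> borel_measurable (unit_time \<Otimes>\<^sub>M M)"
      by (intro borel_measurable_times measurable_time c v)
    fix t :: real and x assume tx: "t \<in> {0..1}" "x \<in> space M"
    show "\<bar>h (segment_flow \<alpha> \<beta> (t, x)) * (c (fst (t, x)) * v (t, x))\<bar> \<le> \<bar>A\<bar> * (\<bar>B\<bar> * \<bar>V\<bar>)"
      unfolding abs_mult
      using A[OF flow_in_cylinder[OF tx]] B[OF tx(1)] v(2)[OF tx] by (intro mult_mono) auto
  qed
qed

text \<open>Particles with common mass \<open>k t\<close> move along segments at constant speed. For a single particle the
  continuity equation is the fundamental theorem of calculus for the function
  \<open>t \<mapsto> k t * \<phi> (t, c t)\<close>, where \<open>c\<close> is its path; the general case follows by integration over the labels.\<close>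

lemma flow_continuity_equation:
  assumes \<phi>: "C1_on_cylinder \<Omega> \<phi> \<phi>t \<phi>x"
  shows "(\<integral>p. \<phi>t (segment_flow \<alpha> \<beta> p) * k (fst p) \<partial>(unit_time \<Otimes>\<^sub>M M))
    + (\<Sum>i\<in>UNIV. \<integral>p. \<phi>x (segment_flow \<alpha> \<beta> p) $ i * (k (fst p) * (\<beta> (snd p) - \<alpha> (snd p)) $ i) \<partial>(unit_time \<Otimes>\<^sub>M M))
    + (\<integral>p. \<phi> (segment_flow \<alpha> \<beta> p) * k' (fst p) \<partial>(unit_time \<Otimes>\<^sub>M M))
    = (\<integral>x. k 1 * \<phi> (1, \<beta> x) - k 0 * \<phi> (0, \<alpha> x) \<partial>M)"
proof -
  let ?N = "unit_time \<Otimes>\<^sub>M M" and ?T = "segment_flow \<alpha> \<beta>"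
  have d: "\<And>p. p \<in> cylinder \<Omega> \<Longrightarrow> (\<phi> has_derivative (\<lambda>(s, v). \<phi>t p * s + \<phi>x p \<bullet> v)) (at p within cylinder \<Omega>)"
    using \<phi> by (auto simp: C1_on_cylinder_def)
  note c\<phi> = C1_on_cylinder_continuous(1)[OF \<phi>] and ct = C1_on_cylinder_continuous(2)[OF \<phi>]
    and cx = C1_on_cylinder_continuous(3)[OF \<phi>]
  have cxi: "continuous_on (cylinder \<Omega>) (\<lambda>p. \<phi>x p $ i)" for i using cx by (intro continuous_intros)
  obtain V where V: "\<And>x i. x \<in> space M \<Longrightarrow> \<bar>(\<beta> x - \<alpha> x) $ i\<bar> \<le> V" using velocity_bounded by blast
  have i1: "integrable ?N (\<lambda>p. \<phi>t (?T p) * k (fst p))"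
    using integrable_flow[OF ct k_continuous, of "\<lambda>_. 1" 1] by simp
  have i2: "integrable ?N (\<lambda>p. \<phi>x (?T p) $ i * (k (fst p) * (\<beta> (snd p) - \<alpha> (snd p)) $ i))" for i
    using V by (intro integrable_flow[OF cxi k_continuous velocity_measurable, where V=V]) simp
  have i3: "integrable ?N (\<lambda>p. \<phi> (?T p) * k' (fst p))"
    using integrable_flow[OF c\<phi> k(2), of "\<lambda>_. 1" 1] by simp
  define \<Psi> where "\<Psi> p = \<phi>t (?T p) * k (fst p) + (\<Sum>i\<in>UNIV. \<phi>x (?T p) $ i * (k (fst p) * (\<beta> (snd p) - \<alpha> (snd p)) $ i))
     + \<phi> (?T p) * k' (fst p)" for p
  have i\<Psi>: "integrable ?N \<Psi>" unfolding \<Psi>_def using i1 i2 i3 by simp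
  have "(\<integral>p. \<phi>t (?T p) * k (fst p) \<partial>?N)
    + (\<Sum>i\<in>UNIV. \<integral>p. \<phi>x (?T p) $ i * (k (fst p) * (\<beta> (snd p) - \<alpha> (snd p)) $ i) \<partial>?N)
    + (\<integral>p. \<phi> (?T p) * k' (fst p) \<partial>?N) = (\<integral>p. \<Psi> p \<partial>?N)"
    unfolding \<Psi>_def using i1 i2 i3 by (simp add: Bochner_Integration.integral_sum)
  also have "\<dots> = (\<integral>x. (\<integral>t. \<Psi> (t, x) \<partial>unit_time) \<partial>M)"
  proof -
    interpret T: finite_measure unit_time by (rule finite_unit_time)
    interpret M: finite_measure M by (rule M)
    interpret pair_sigma_finite unit_time M ..
    show ?thesis using integral_snd[of "\<lambda>t x. \<Psi> (t, x)"] i\<Psi> by (simp add: case_prod_eta)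
  qed
  also have "\<dots> = (\<integral>x. k 1 * \<phi> (1, \<beta> x) - k 0 * \<phi> (0, \<alpha> x) \<partial>M)"
  proof (rule Bochner_Integration.integral_cong[OF refl])
    fix x assume x: "x \<in> space M"
    let ?c = "\<lambda>t. ?T (t, x)" and ?v = "\<beta> x - \<alpha> x"
    have cyl: "?c t \<in> cylinder \<Omega>" if "t \<in> {0..1}" for t using flow_in_cylinder[OF that x] .
    have dF: "((\<lambda>t. k t * \<phi> (?c t)) has_real_derivative \<Psi> (t, x)) (at t within {0..1})" if t: "t \<in> {0..1}" for t
    proof -
      have dc: "(?c has_derivative (\<lambda>h. (h, h *\<^sub>R ?v))) (at t within {0..1})"
        unfolding segment_flow_def prod.case
        by (auto intro!: derivative_eq_intros simp: algebra_simps)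
      have "(\<phi> has_derivative (\<lambda>(s, v). \<phi>t (?c t) * s + \<phi>x (?c t) \<bullet> v)) (at (?c t) within ?c ` {0..1})"
        using d[OF cyl[OF t]] by (rule has_derivative_subset) (intro image_subsetI cyl)
      from has_derivative_in_compose[OF dc this]
      have "((\<lambda>t. \<phi> (?c t)) has_derivative (\<lambda>h. (\<phi>t (?c t) + \<phi>x (?c t) \<bullet> ?v) * h)) (at t within {0..1})"
        by (simp add: algebra_simps)
      then have "((\<lambda>t. \<phi> (?c t)) has_real_derivative (\<phi>t (?c t) + \<phi>x (?c t) \<bullet> ?v)) (at t within {0..1})"
        by (simp add: has_field_derivative_def)
      from DERIV_mult[OF k(1)[OF t] this]
      show ?thesis
        by (simp add: \<Psi>_def inner_vec_def sum_distrib_left sum_distrib_right algebra_simps)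
    qed
    have cc: "continuous_on {0..1} ?c" unfolding segment_flow_def prod.case by (intro continuous_intros)
    have comp: "continuous_on {0..1} (\<lambda>t. h (?c t))" if "continuous_on (cylinder \<Omega>) h" for h :: "'d spacetime \<Rightarrow> real"
      by (rule continuous_on_compose2[OF that cc]) (intro image_subsetI cyl)
    have "continuous_on {0..1} (\<lambda>t. \<Psi> (t, x))"
      unfolding \<Psi>_def fst_conv snd_conv
      by (intro continuous_intros comp ct cxi c\<phi> k_continuous k(2))
    from integral_FTC_Icc[OF zero_le_one dF[unfolded has_real_derivative_iff_has_vector_derivative] this]
    have "(\<integral>t. indicator {0..1} t *\<^sub>R \<Psi> (t, x) \<partial>lborel) = k 1 * \<phi> (?c 1) - k 0 * \<phi> (?c 0)" by simp
    then show "(\<integral>t. \<Psi> (t, x) \<partial>unit_time) = k 1 * \<phi> (1, \<beta> x) - k 0 * \<phi> (0, \<alpha> x)"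
      by (simp add: integral_restrict_space segment_flow_def)
  qed
  finally show ?thesis .
qed

end

section \<open>Competitors of finite action\<close>

text \<open>Normalize both marginals to probability measures, transport one to the other by the product
  plan, along segments, and let the mass be \<open>sqrt_mass\<^sup>2\<close>, whose logarithmic derivative is the rate of
  growth. Speeds are bounded by the diameter, so the transport part is finite.\<close>

lemma growth_competitor:
  fixes \<Omega> :: "(real ^ 'd::finite) set"
  assumes \<Omega>: "bounded \<Omega>" "convex \<Omega>" "\<Omega> \<noteq> {}"
    and \<rho>: "\<rho>0 \<in> nonneg_measures (closure \<Omega>)" "\<rho>1 \<in> nonneg_measures (closure \<Omega>)"
  shows "\<exists>\<rho> \<omega> \<zeta> C. (\<rho>, \<omega>, \<zeta>) \<in> CE_growth \<Omega> \<rho>0 \<rho>1 \<and> 0 \<le> C \<and> D_BB \<Omega> \<rho> \<omega> \<le> ennreal C"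
proof -
  define X where "X = cylinder \<Omega>"
  define Y where "Y = closure \<Omega>"
  have Y: "Y \<noteq> {}" "compact Y" using \<Omega> by (auto simp: Y_def)
  have X: "compact X" unfolding X_def by (rule compact_cylinder[OF \<Omega>(1)])
  define m0 where "m0 = \<rho>0 Y" 
  define m1 where "m1 = \<rho>1 Y"
  have m: "0 \<le> m0" "0 \<le> m1" using \<rho> by (auto simp: m0_def m1_def nonneg_measures_def Y_def)
  define s0 where "s0 = sqrt m0"
  define s1 where "s1 = sqrt m1"
  have s: "s0\<^sup>2 = m0" "s1\<^sup>2 = m1" using m by (simp_all add: s0_def s1_def)
  note \<rho>Y = \<rho>[folded Y_def]
  obtain P0 where P0: "prob_space P0" "sets P0 = borel_sets_on Y"
    "\<And>f :: _ \<Rightarrow> real. f \<in> borel_measurable (restrict_space borel Y) \<Longrightarrow>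
      (\<integral>x. f x \<partial>pos_part Y \<rho>0) = measure (pos_part Y \<rho>0) Y * (\<integral>x. f x \<partial>P0)"
    by (rule probability_multiple[OF finite_measure_pos_part[OF nonneg_measures_signed[OF \<rho>Y(1)]] sets_pos_part Y(1)]) (rule that)
  obtain P1 where P1: "prob_space P1" "sets P1 = borel_sets_on Y"
    "\<And>f :: _ \<Rightarrow> real. f \<in> borel_measurable (restrict_space borel Y) \<Longrightarrow>
      (\<integral>x. f x \<partial>pos_part Y \<rho>1) = measure (pos_part Y \<rho>1) Y * (\<integral>x. f x \<partial>P1)"
    by (rule probability_multiple[OF finite_measure_pos_part[OF nonneg_measures_signed[OF \<rho>Y(2)]] sets_pos_part Y(1)]) (rule that)
  interpret P0: prob_space P0 by fact
  interpret P1: prob_space P1 by fact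
  interpret P01: pair_prob_space P0 P1 ..
  have sp: "space P0 = Y" "space P1 = Y" using sets_eq_imp_space_eq[OF P0(2)] sets_eq_imp_space_eq[OF P1(2)] by simp_all
  have I0: "signed_integral Y \<rho>0 f = m0 * (\<integral>x. f x \<partial>P0)" if "continuous_on Y f" for f
    using that P0(3)[OF borel_measurable_continuous_on_restrict[OF that]]
    by (simp add: signed_integral_nonneg_measure[OF \<rho>Y(1)] measure_pos_part_nonneg_measure[OF \<rho>Y(1)] m0_def)
  have I1: "signed_integral Y \<rho>1 f = m1 * (\<integral>x. f x \<partial>P1)" if "continuous_on Y f" for f
    using that P1(3)[OF borel_measurable_continuous_on_restrict[OF that]]
    by (simp add: signed_integral_nonneg_measure[OF \<rho>Y(2)] measure_pos_part_nonneg_measure[OF \<rho>Y(2)] m1_def)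
  define M where "M = P0 \<Otimes>\<^sub>M P1"
  have spM: "space M = Y \<times> Y" by (simp add: M_def space_pair_measure sp)
  have fM: "finite_measure M" unfolding M_def by (rule P01.finite_measure_axioms)
  have idm: "(\<lambda>x. x) \<in> borel_measurable P0" "(\<lambda>x. x) \<in> borel_measurable P1"
    by (subst measurable_cong_sets[OF P0(2) refl] measurable_cong_sets[OF P1(2) refl], rule measurable_restrict_space1, simp)+
  have fs: "fst \<in> borel_measurable M" "snd \<in> borel_measurable M"
    unfolding M_def
    by (rule measurable_compose[OF measurable_fst idm(1)] measurable_compose[OF measurable_snd idm(2)])+
  have fsY: "\<And>x. x \<in> space M \<Longrightarrow> fst x \<in> closure \<Omega>" "\<And>x. x \<in> space M \<Longrightarrow> snd x \<in> closure \<Omega>"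
    by (auto simp: spM Y_def)
  define k where "k t = (sqrt_mass s0 s1 t)\<^sup>2" for t
  define k' where "k' t = 2 * (s1 - s0) * sqrt_mass s0 s1 t" for t
  have kd: "(k has_real_derivative k' t) (at t within {0..1})" for t
    unfolding k_def k'_def sqrt_mass_def by (auto intro!: derivative_eq_intros simp: algebra_simps)
  have ck': "continuous_on {0..1} k'" unfolding k'_def sqrt_mass_def by (intro continuous_intros)
  note flow = \<Omega>(1,2) fM fs fsY kd ck'
  let ?N = "unit_time \<Otimes>\<^sub>M M" and ?T = "segment_flow fst snd :: real \<times> (real ^ 'd) \<times> (real ^ 'd) \<Rightarrow> 'd spacetime"
  let ?w = "\<lambda>i p. k (fst p) * (snd (snd p) - fst (snd p)) $ i"
  have T: "?T \<in> measurable ?N (restrict_space borel X)" unfolding X_def by (rule measurable_flow[OF flow])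
  have spN: "space ?N = {0..1} \<times> Y \<times> Y" using space_time_pair[OF flow] by (simp add: spM)
  have ck: "continuous_on {0..1} k" by (rule k_continuous[OF flow])
  obtain V where V: "\<And>x i. x \<in> space M \<Longrightarrow> \<bar>(snd x - fst x) $ i\<bar> \<le> V" using velocity_bounded[OF flow] by blast
  have ih: "integrable ?N (\<lambda>p. h (?T p) * k (fst p))" "integrable ?N (\<lambda>p. h (?T p) * ?w i p)"
      "integrable ?N (\<lambda>p. h (?T p) * k' (fst p))"
    if h: "continuous_on X h" for h :: "'d spacetime \<Rightarrow> real" and i
    using integrable_flow[OF flow h[unfolded X_def] ck, of "\<lambda>_. 1" 1]
      integrable_flow[OF flow h[unfolded X_def] ck velocity_measurable[OF flow, of i], of V] V
      integrable_flow[OF flow h[unfolded X_def] ck', of "\<lambda>_. 1" 1]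
    by simp_all
  have ik: "integrable ?N (\<lambda>p. k (fst p))" "integrable ?N (?w i)" "integrable ?N (\<lambda>p. k' (fst p))" for i
    using ih[of "\<lambda>_. 1"] by simp_all
  define \<rho> where "\<rho> = push_density X ?N ?T (\<lambda>p. k (fst p))"
  define \<omega> where "\<omega> i = push_density X ?N ?T (?w i)" for i
  define \<zeta> where "\<zeta> = push_density X ?N ?T (\<lambda>p. k' (fst p))"
  have sm: "\<rho> \<in> signed_measures X" "\<omega> i \<in> signed_measures X" "\<zeta> \<in> signed_measures X" for i
    unfolding \<rho>_def \<omega>_def \<zeta>_def by (intro push_density_signed[OF T] ik)+
  have int: "signed_integral X \<rho> h = (\<integral>p. h (?T p) * k (fst p) \<partial>?N)"
      "signed_integral X (\<omega> i) h = (\<integral>p. h (?T p) * ?w i p \<partial>?N)"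
      "signed_integral X \<zeta> h = (\<integral>p. h (?T p) * k' (fst p) \<partial>?N)" if h: "continuous_on X h" for h i
    unfolding \<rho>_def \<omega>_def \<zeta>_def
    by (intro push_density_integral[OF T] ik ih[OF h] borel_measurable_continuous_on_restrict[OF h])+
  have "(\<rho>, \<omega>, \<zeta>) \<in> CE \<Omega> \<rho>0 \<rho>1"
    unfolding CE_def
  proof (intro CollectI case_prodI conjI allI impI)
    show "(\<rho>, \<omega>, \<zeta>) \<in> triples \<Omega>" using sm by (simp add: triples_def X_def)
    fix \<phi> \<phi>t :: "'d spacetime \<Rightarrow> real" and \<phi>x assume \<phi>: "C1_on_cylinder \<Omega> \<phi> \<phi>t \<phi>x"
    have ct: "continuous_on X \<phi>t" "continuous_on X \<phi>x" and c\<phi>: "continuous_on X \<phi>"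
      using C1_on_cylinder_continuous[OF \<phi>] by (simp_all add: X_def)
    have cx: "continuous_on X (\<lambda>p. \<phi>x p $ i)" for i using ct(2) by (intro continuous_intros)
    have c01: "continuous_on Y (\<lambda>x. \<phi> (1, x))" "continuous_on Y (\<lambda>x. \<phi> (0, x))"
      by (rule continuous_on_compose2[OF c\<phi>]; auto simp: X_def Y_def intro!: continuous_intros)+
    have "signed_integral X \<rho> \<phi>t + (\<Sum>i\<in>UNIV. signed_integral X (\<omega> i) (\<lambda>p. \<phi>x p $ i)) + signed_integral X \<zeta> \<phi>
      = (\<integral>x. k 1 * \<phi> (1, snd x) - k 0 * \<phi> (0, fst x) \<partial>M)"
      unfolding int(1)[OF ct(1)] int(2)[OF cx] int(3)[OF c\<phi>] by (rule flow_continuity_equation[OF flow \<phi>])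
    also have "\<dots> = m1 * (\<integral>x. \<phi> (1, snd x) \<partial>M) - m0 * (\<integral>x. \<phi> (0, fst x) \<partial>M)"
    proof -
      obtain B where B: "\<And>p. p \<in> X \<Longrightarrow> \<bar>\<phi> p\<bar> \<le> B"
        using continuous_on_compact_bound[OF X c\<phi>] by (metis real_norm_def)
      have m\<phi>: "(\<lambda>x. \<phi> (0, x)) \<in> borel_measurable P0" "(\<lambda>x. \<phi> (1, x)) \<in> borel_measurable P1"
        using borel_measurable_continuous_on_restrict[OF c01(1)] borel_measurable_continuous_on_restrict[OF c01(2)]
        by (simp_all add: measurable_cong_sets[OF P0(2) refl] measurable_cong_sets[OF P1(2) refl])
      have "integrable M (\<lambda>x. \<phi> (1, snd x))"
        using B measurable_compose[OF measurable_snd m\<phi>(2), of P0]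
        by (intro finite_measure.integrable_const_bound[OF fM, where B=B] AE_I2) (auto simp: spM[unfolded M_def] X_def Y_def M_def)
      moreover have "integrable M (\<lambda>x. \<phi> (0, fst x))"
        using B measurable_compose[OF measurable_fst m\<phi>(1), of P1]
        by (intro finite_measure.integrable_const_bound[OF fM, where B=B] AE_I2) (auto simp: spM[unfolded M_def] X_def Y_def M_def)
      ultimately show ?thesis by (simp add: k_def sqrt_mass_def s)
    qed
    also have "(\<integral>x. \<phi> (1, snd x) \<partial>M) = (\<integral>x. \<phi> (1, x) \<partial>P1)"
    proof -
      have "(\<lambda>x. \<phi> (1, x)) \<in> borel_measurable P1"
        using borel_measurable_continuous_on_restrict[OF c01(1)] by (simp add: measurable_cong_sets[OF P1(2) refl])
      then have "(\<integral>x. \<phi> (1, x) \<partial>distr (P0 \<Otimes>\<^sub>M P1) P1 snd) = (\<integral>x. \<phi> (1, snd x) \<partial>M)"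
        unfolding M_def by (intro integral_distr) simp_all
      moreover have "distr (P0 \<Otimes>\<^sub>M P1) P1 snd = P1"
      proof (rule measure_eqI)
        fix A assume "A \<in> sets (distr (P0 \<Otimes>\<^sub>M P1) P1 snd)"
        then have A: "A \<in> sets P1" by simp
        have "snd -` A \<inter> space (P0 \<Otimes>\<^sub>M P1) = space P0 \<times> A"
          using sets.sets_into_space[OF A] by (auto simp: space_pair_measure)
        then show "emeasure (distr (P0 \<Otimes>\<^sub>M P1) P1 snd) A = emeasure P1 A"
          using A by (simp add: emeasure_distr P1.emeasure_pair_measure_Times[OF sets.top A] P0.emeasure_space_1)
      qed simp
      ultimately show ?thesis by simp
    qed
    also have "(\<integral>x. \<phi> (0, fst x) \<partial>M) = (\<integral>x. \<phi> (0, x) \<partial>P0)"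
    proof -
      have "(\<lambda>x. \<phi> (0, x)) \<in> borel_measurable P0"
        using borel_measurable_continuous_on_restrict[OF c01(2)] by (simp add: measurable_cong_sets[OF P0(2) refl])
      then have "(\<integral>x. \<phi> (0, x) \<partial>distr (P0 \<Otimes>\<^sub>M P1) P0 fst) = (\<integral>x. \<phi> (0, fst x) \<partial>M)"
        unfolding M_def by (intro integral_distr) simp_all
      then show ?thesis by (simp add: P1.distr_pair_fst)
    qed
    finally show "signed_integral (cylinder \<Omega>) \<rho> \<phi>t + (\<Sum>i\<in>UNIV. signed_integral (cylinder \<Omega>) (\<omega> i) (\<lambda>p. \<phi>x p $ i))
        + signed_integral (cylinder \<Omega>) \<zeta> \<phi>
        = signed_integral (closure \<Omega>) \<rho>1 (\<lambda>x. \<phi> (1, x)) - signed_integral (closure \<Omega>) \<rho>0 (\<lambda>x. \<phi> (0, x))"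
      using I0[OF c01(2)] I1[OF c01(1)] by (simp add: X_def Y_def)
  qed
  moreover have "is_density_product X \<zeta> (growth_rate m0 m1) \<rho>"
  proof -
    let ?g = "\<lambda>p. reg_rate s0 s1 0 (fst p)"
    have gr: "growth_rate m0 m1 = (?g :: 'd spacetime \<Rightarrow> real)" unfolding s0_def s1_def by (rule growth_rate_eq[OF m])
    have gk: "?g (?T p) * k (fst p) = k' (fst p)" for p
      by (cases p) (simp add: segment_flow_def reg_rate_def k_def k'_def power2_eq_square)
    have gm: "?g \<in> borel_measurable (restrict_space borel X)"
    proof -
      have [measurable]: "(\<lambda>p :: 'd spacetime. sqrt_mass s0 s1 (fst p)) \<in> borel_measurable borel"
        unfolding sqrt_mass_def by (intro borel_measurable_continuous_onI continuous_intros)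
      show ?thesis unfolding reg_rate_def by (intro measurable_restrict_space1) measurable
    qed
    have "signed_integrable X \<rho> ?g"
      unfolding \<rho>_def by (intro push_density_integrable[OF T] ik gm) (simp only: gk ik)
    moreover have "\<zeta> A = signed_integral X \<rho> (\<lambda>p. indicator A p * ?g p)" if A: "A \<in> borel_sets_on X" for A
    proof -
      have iA: "(indicator A :: _ \<Rightarrow> real) \<in> borel_measurable (restrict_space borel X)" using A by simp
      have e: "indicator A (?T p) * ?g (?T p) * k (fst p) = indicator A (?T p) * k' (fst p)" for p
        by (simp only: mult.assoc gk)
      have "integrable ?N (\<lambda>p. indicator A (?T p) * k' (fst p))"
      proof (rule Bochner_Integration.integrable_bound[OF ik(3)])
        show "(\<lambda>p. indicator A (?T p) * k' (fst p)) \<in> borel_measurable ?N"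
          using measurable_compose[OF T iA] ik(3) by (intro borel_measurable_times) simp_all
      qed (auto simp: indicator_def)
      then have "signed_integral X \<rho> (\<lambda>p. indicator A p * ?g p) = (\<integral>p. indicator A (?T p) * ?g (?T p) * k (fst p) \<partial>?N)"
        unfolding \<rho>_def by (intro push_density_integral[OF T] ik borel_measurable_times iA gm) (simp only: e)
      then show ?thesis using A by (simp only: e \<zeta>_def push_density_def if_True)
    qed
    ultimately show ?thesis by (simp add: is_density_product_def gr)
  qed
  ultimately have g: "(\<rho>, \<omega>, \<zeta>) \<in> CE_growth \<Omega> \<rho>0 \<rho>1"
    by (simp add: CE_growth_def X_def m0_def m1_def Y_def)
  define v where "v p = (\<Sum>i\<in>UNIV. ((snd (snd p) - fst (snd p)) $ i)\<^sup>2) / 2" for p :: "real \<times> (real ^ 'd) \<times> (real ^ 'd)"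
  have iv: "integrable ?N (\<lambda>p. k (fst p) * v p)"
  proof -
    have vm: "v \<in> borel_measurable ?N" unfolding v_def using velocity_measurable[OF flow] by measurable
    have vb: "\<bar>v (t, x)\<bar> \<le> (\<Sum>i\<in>(UNIV :: 'd set). V\<^sup>2)" if "x \<in> space M" for t x
    proof -
      have "(\<Sum>i\<in>UNIV. ((snd x - fst x) $ i)\<^sup>2) \<le> (\<Sum>i\<in>(UNIV :: 'd set). V\<^sup>2)"
        by (intro sum_mono abs_le_square_iff[THEN iffD1] order_trans[OF V[OF that] abs_ge_self])
      moreover have "0 \<le> (\<Sum>i\<in>UNIV. ((snd x - fst x) $ i)\<^sup>2)" by (simp add: sum_nonneg)
      ultimately show ?thesis unfolding v_def snd_conv by linarith
    qed
    have "integrable ?N (\<lambda>p. 1 * (k (fst p) * v p))"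
      by (rule integrable_flow[OF flow continuous_on_const ck vm]; (assumption | erule vb))
    then show ?thesis by simp
  qed
  define C where "C = (\<integral>p. k (fst p) * v p \<partial>?N)"
  have v0: "0 \<le> k (fst p) * v p" for p by (simp add: k_def v_def sum_nonneg)
  have C0: "0 \<le> C" unfolding C_def using v0 by (intro integral_nonneg_AE AE_I2)
  have "D_BB \<Omega> \<rho> \<omega> \<le> ennreal C"
    unfolding D_BB_def
  proof (subst D_le_iff[OF \<Omega>(1) _ zero_less_one C0])
    show "(\<rho>, \<omega>, \<lambda>A. 0) \<in> triples \<Omega>" using sm by (simp add: triples_def X_def)
    show "\<forall>a b c. admissible (cylinder \<Omega>) 1 a b c \<longrightarrow> pairing (cylinder \<Omega>) \<rho> \<omega> (\<lambda>A. 0) a b c \<le> C"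
    proof (intro allI impI)
      fix a c and b :: "'d \<Rightarrow> 'd spacetime \<Rightarrow> real" assume adm: "admissible (cylinder \<Omega>) 1 a b c"
      then have c: "continuous_on X a" "\<And>i. continuous_on X (b i)" by (auto simp: admissible_def X_def)
      have "pairing X \<rho> \<omega> (\<lambda>A. 0) a b c = (\<integral>p. a (?T p) * k (fst p) + (\<Sum>i\<in>UNIV. b i (?T p) * ?w i p) \<partial>?N)"
        unfolding pairing_def int(1)[OF c(1)] int(2)[OF c(2)] using ih[OF c(1)] ih[OF c(2)]
        by (simp add: Bochner_Integration.integral_sum)
      also have "\<dots> \<le> C" unfolding C_def
      proof (rule integral_mono[OF _ iv])
        show "integrable ?N (\<lambda>p. a (?T p) * k (fst p) + (\<Sum>i\<in>UNIV. b i (?T p) * ?w i p))"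
          using ih[OF c(1)] ih[OF c(2)] by simp
        fix p assume "p \<in> space ?N"
        then have "?T p \<in> X" using measurable_space[OF T] by simp
        then have "a (?T p) + ((\<Sum>i\<in>UNIV. (b i (?T p))\<^sup>2) + (c (?T p))\<^sup>2 / 1\<^sup>2) / 2 \<le> 0"
          unfolding X_def by (rule bspec[OF conjunct2[OF conjunct2[OF conjunct2[OF adm[unfolded admissible_def]]]]])
        moreover have "0 \<le> (c (?T p))\<^sup>2 / 2" by simp
        ultimately have a: "a (?T p) + (\<Sum>i\<in>UNIV. (b i (?T p))\<^sup>2) / 2 \<le> 0"
          by (simp only: add_divide_distrib power_one div_by_1)
        have "b i (?T p) * u \<le> (b i (?T p))\<^sup>2 / 2 + u\<^sup>2 / 2" for i u
          using sum_squares_bound[of "b i (?T p)" u] by simp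
        then have "(\<Sum>i\<in>UNIV. b i (?T p) * (snd (snd p) - fst (snd p)) $ i)
            \<le> (\<Sum>i\<in>UNIV. (b i (?T p))\<^sup>2 / 2 + ((snd (snd p) - fst (snd p)) $ i)\<^sup>2 / 2)"
          by (intro sum_mono)
        also have "\<dots> = (\<Sum>i\<in>UNIV. (b i (?T p))\<^sup>2) / 2 + v p"
          by (simp add: v_def sum.distrib sum_divide_distrib)
        finally have "a (?T p) + (\<Sum>i\<in>UNIV. b i (?T p) * (snd (snd p) - fst (snd p)) $ i) \<le> v p" using a by linarith
        then have "k (fst p) * (a (?T p) + (\<Sum>i\<in>UNIV. b i (?T p) * (snd (snd p) - fst (snd p)) $ i)) \<le> k (fst p) * v p"
          by (intro mult_left_mono) (simp_all add: k_def)
        then show "a (?T p) * k (fst p) + (\<Sum>i\<in>UNIV. b i (?T p) * ?w i p) \<le> k (fst p) * v p"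
          by (simp add: sum_distrib_left distrib_left mult_ac)
      qed
      finally show "pairing (cylinder \<Omega>) \<rho> \<omega> (\<lambda>A. 0) a b c \<le> C" by (simp add: X_def)
    qed
  qed
  with g C0 show ?thesis by blast
qed

text \<open>Mass that stays in place and is multiplied by \<open>k\<close>. The last assumption says that the growth part
  \<open>k'\<^sup>2 / (2 k)\<close> is at most 2, written in its dual form.\<close>

lemma static_piece:
  fixes \<Omega> :: "(real ^ 'd::finite) set"
  assumes \<Omega>: "bounded \<Omega>" "convex \<Omega>" and \<mu>: "\<mu> \<in> nonneg_measures (closure \<Omega>)"
    and kd: "\<And>t. t \<in> {0..1} \<Longrightarrow> (k has_real_derivative k' t) (at t within {0..1})" and ck': "continuous_on {0..1} k'"
    and k0: "\<And>t. 0 \<le> k t" and k2: "\<And>t u. u * k' t \<le> u\<^sup>2 / 2 * k t + 2"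
  shows "\<exists>\<rho> \<zeta> C. \<rho> \<in> signed_measures (cylinder \<Omega>) \<and> \<zeta> \<in> signed_measures (cylinder \<Omega>) \<and> 0 \<le> C \<and>
    (\<forall>\<phi> \<phi>t \<phi>x. C1_on_cylinder \<Omega> \<phi> \<phi>t \<phi>x \<longrightarrow>
      signed_integral (cylinder \<Omega>) \<rho> \<phi>t + signed_integral (cylinder \<Omega>) \<zeta> \<phi>
      = k 1 * signed_integral (closure \<Omega>) \<mu> (\<lambda>x. \<phi> (1, x)) - k 0 * signed_integral (closure \<Omega>) \<mu> (\<lambda>x. \<phi> (0, x))) \<and>
    (\<forall>a c. continuous_on (cylinder \<Omega>) a \<longrightarrow> continuous_on (cylinder \<Omega>) c \<longrightarrow>
      (\<forall>p\<in>cylinder \<Omega>. a p + (c p)\<^sup>2 / 2 \<le> 0) \<longrightarrow>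
      signed_integral (cylinder \<Omega>) \<rho> a + signed_integral (cylinder \<Omega>) \<zeta> c \<le> C)"
proof -
  define X where "X = cylinder \<Omega>"
  define Y where "Y = closure \<Omega>"
  have X: "compact X" unfolding X_def by (rule compact_cylinder[OF \<Omega>(1)])
  have Y: "compact Y" using \<Omega> by (simp add: Y_def)
  note \<mu>Y = \<mu>[folded Y_def]
  define M where "M = pos_part Y \<mu>"
  have sM: "sets M = borel_sets_on Y" and spM: "space M = Y" by (simp_all add: M_def)
  have fM: "finite_measure M" unfolding M_def by (rule finite_measure_pos_part[OF nonneg_measures_signed[OF \<mu>Y]])
  have idm: "(\<lambda>x. x) \<in> borel_measurable M"
    by (subst measurable_cong_sets[OF sM refl]) (rule measurable_restrict_space1, simp)
  have idY: "\<And>x. x \<in> space M \<Longrightarrow> x \<in> closure \<Omega>" by (simp add: spM Y_def)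
  note flow = \<Omega>(1,2) fM idm idm idY idY kd ck'
  let ?N = "unit_time \<Otimes>\<^sub>M M" and ?T = "segment_flow (\<lambda>x. x) (\<lambda>x. x) :: real \<times> (real ^ 'd) \<Rightarrow> 'd spacetime"
  have T: "?T \<in> measurable ?N (restrict_space borel X)" unfolding X_def by (rule measurable_flow[OF flow])
  have ck: "continuous_on {0..1} k" by (rule k_continuous[OF flow])
  have ih: "integrable ?N (\<lambda>p. h (?T p) * k (fst p))" "integrable ?N (\<lambda>p. h (?T p) * k' (fst p))"
    if h: "continuous_on X h" for h :: "'d spacetime \<Rightarrow> real"
    using integrable_flow[OF flow h[unfolded X_def] ck, of "\<lambda>_. 1" 1]
      integrable_flow[OF flow h[unfolded X_def] ck', of "\<lambda>_. 1" 1] by simp_all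
  have ik: "integrable ?N (\<lambda>p. k (fst p))" "integrable ?N (\<lambda>p. k' (fst p))"
    using ih[of "\<lambda>_. 1"] by simp_all
  define \<rho> where "\<rho> = push_density X ?N ?T (\<lambda>p. k (fst p))"
  define \<zeta> where "\<zeta> = push_density X ?N ?T (\<lambda>p. k' (fst p))"
  have sm: "\<rho> \<in> signed_measures X" "\<zeta> \<in> signed_measures X"
    unfolding \<rho>_def \<zeta>_def by (intro push_density_signed[OF T] ik)+
  have int: "signed_integral X \<rho> h = (\<integral>p. h (?T p) * k (fst p) \<partial>?N)"
      "signed_integral X \<zeta> h = (\<integral>p. h (?T p) * k' (fst p) \<partial>?N)" if h: "continuous_on X h" for h
    unfolding \<rho>_def \<zeta>_def
    by (intro push_density_integral[OF T] ik ih[OF h] borel_measurable_continuous_on_restrict[OF h])+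
  have ce: "signed_integral X \<rho> \<phi>t + signed_integral X \<zeta> \<phi>
      = k 1 * signed_integral Y \<mu> (\<lambda>x. \<phi> (1, x)) - k 0 * signed_integral Y \<mu> (\<lambda>x. \<phi> (0, x))"
    if \<phi>: "C1_on_cylinder \<Omega> \<phi> \<phi>t \<phi>x" for \<phi> \<phi>t \<phi>x
  proof -
    have ct: "continuous_on X \<phi>t" and c\<phi>: "continuous_on X \<phi>"
      using C1_on_cylinder_continuous[OF \<phi>] by (simp_all add: X_def)
    have "continuous_on Y (\<lambda>x. \<phi> (1, x))" "continuous_on Y (\<lambda>x. \<phi> (0, x))"
      by (rule continuous_on_compose2[OF c\<phi>]; auto simp: X_def Y_def intro!: continuous_intros)+
    then have "integrable M (\<lambda>x. \<phi> (1, x))" "integrable M (\<lambda>x. \<phi> (0, x))"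
      by (auto intro: integrable_continuous_on[OF fM sM Y])
    then show ?thesis
      using flow_continuity_equation[OF flow \<phi>]
      by (simp add: int(1)[OF ct] int(2)[OF c\<phi>] signed_integral_nonneg_measure[OF \<mu>Y] M_def)
  qed
  define C where "C = (\<integral>p. (2 :: real) \<partial>?N)"
  have fN: "finite_measure ?N" by (rule finite_time_pair[OF flow])
  have C0: "0 \<le> C" unfolding C_def by (intro integral_nonneg_AE AE_I2) simp
  have bd: "signed_integral X \<rho> a + signed_integral X \<zeta> c \<le> C"
    if a: "continuous_on X a" and c: "continuous_on X c" and le: "\<forall>p\<in>X. a p + (c p)\<^sup>2 / 2 \<le> 0" for a c
  proof -
    have "signed_integral X \<rho> a + signed_integral X \<zeta> c = (\<integral>p. a (?T p) * k (fst p) + c (?T p) * k' (fst p) \<partial>?N)"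
      unfolding int(1)[OF a] int(2)[OF c] using ih[OF a] ih[OF c] by simp
    also have "\<dots> \<le> C" unfolding C_def
    proof (rule integral_mono)
      show "integrable ?N (\<lambda>p. a (?T p) * k (fst p) + c (?T p) * k' (fst p))" using ih[OF a] ih[OF c] by simp
      show "integrable ?N (\<lambda>p. 2 :: real)" by (rule finite_measure.integrable_const[OF fN])
      fix p assume "p \<in> space ?N"
      then have "?T p \<in> X" using measurable_space[OF T] by simp
      then have "a (?T p) \<le> - ((c (?T p))\<^sup>2 / 2)" using le by force
      from mult_right_mono[OF this k0[of "fst p"]]
      have "a (?T p) * k (fst p) \<le> - ((c (?T p))\<^sup>2 / 2 * k (fst p))" by simp
      with k2[of "c (?T p)" "fst p"] show "a (?T p) * k (fst p) + c (?T p) * k' (fst p) \<le> 2" by linarith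
    qed
    finally show ?thesis .
  qed
  show ?thesis using sm ce bd C0 unfolding X_def Y_def by blast
qed

text \<open>The initial mass is faded out by \<open>(1 - t)\<^sup>2\<close> while the final mass is faded in by \<open>t\<^sup>2\<close>.\<close>

lemma static_competitor:
  fixes \<Omega> :: "(real ^ 'd::finite) set"
  assumes \<Omega>: "bounded \<Omega>" "convex \<Omega>"
    and \<rho>: "\<rho>0 \<in> nonneg_measures (closure \<Omega>)" "\<rho>1 \<in> nonneg_measures (closure \<Omega>)"
  shows "\<exists>\<rho> \<omega> \<zeta> C. (\<rho>, \<omega>, \<zeta>) \<in> CE_static \<Omega> \<rho>0 \<rho>1 \<and> 0 \<le> C \<and> D_FR \<Omega> \<rho> \<zeta> \<le> ennreal C"
proof -
  define X where "X = cylinder \<Omega>"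
  have X: "compact X" unfolding X_def by (rule compact_cylinder[OF \<Omega>(1)])
  have q: "u * (2 * v) \<le> u\<^sup>2 / 2 * v\<^sup>2 + 2" for u v :: real
    using zero_le_power2[of "u * v - 2"] by (simp add: power2_eq_square algebra_simps)
  have "\<exists>\<rho> \<zeta> C. \<rho> \<in> signed_measures X \<and> \<zeta> \<in> signed_measures X \<and> 0 \<le> C \<and>
    (\<forall>\<phi> \<phi>t \<phi>x. C1_on_cylinder \<Omega> \<phi> \<phi>t \<phi>x \<longrightarrow>
      signed_integral X \<rho> \<phi>t + signed_integral X \<zeta> \<phi>
      = (1 - 1)\<^sup>2 * signed_integral (closure \<Omega>) \<rho>0 (\<lambda>x. \<phi> (1, x)) - (1 - 0)\<^sup>2 * signed_integral (closure \<Omega>) \<rho>0 (\<lambda>x. \<phi> (0, x))) \<and>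
    (\<forall>a c. continuous_on X a \<longrightarrow> continuous_on X c \<longrightarrow> (\<forall>p\<in>X. a p + (c p)\<^sup>2 / 2 \<le> 0) \<longrightarrow>
      signed_integral X \<rho> a + signed_integral X \<zeta> c \<le> C)"
    unfolding X_def
  proof (rule static_piece[OF \<Omega> \<rho>(1), where k'="\<lambda>t. - 2 * (1 - t)"])
    show "((\<lambda>t. (1 - t)\<^sup>2) has_real_derivative - 2 * (1 - t)) (at t within {0..1})" for t :: real
      by (auto intro!: derivative_eq_intros)
    show "u * (- 2 * (1 - t)) \<le> u\<^sup>2 / 2 * (1 - t)\<^sup>2 + 2" for t u :: real
      using q[of "- u" "1 - t"] by (simp add: algebra_simps)
  qed (auto intro!: continuous_intros)
  then obtain \<rho>a \<zeta>a Ca where a: "\<rho>a \<in> signed_measures X" "\<zeta>a \<in> signed_measures X" "0 \<le> Ca"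
    "\<forall>\<phi> \<phi>t \<phi>x. C1_on_cylinder \<Omega> \<phi> \<phi>t \<phi>x \<longrightarrow>
      signed_integral X \<rho>a \<phi>t + signed_integral X \<zeta>a \<phi> = (1 - 1)\<^sup>2 * signed_integral (closure \<Omega>) \<rho>0 (\<lambda>x. \<phi> (1, x)) - (1 - 0)\<^sup>2 * signed_integral (closure \<Omega>) \<rho>0 (\<lambda>x. \<phi> (0, x))"
    "\<forall>a c. continuous_on X a \<longrightarrow> continuous_on X c \<longrightarrow> (\<forall>p\<in>X. a p + (c p)\<^sup>2 / 2 \<le> 0) \<longrightarrow>
      signed_integral X \<rho>a a + signed_integral X \<zeta>a c \<le> Ca"
    by (elim exE conjE) (rule that)
  have "\<exists>\<rho> \<zeta> C. \<rho> \<in> signed_measures X \<and> \<zeta> \<in> signed_measures X \<and> 0 \<le> C \<and>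
    (\<forall>\<phi> \<phi>t \<phi>x. C1_on_cylinder \<Omega> \<phi> \<phi>t \<phi>x \<longrightarrow>
      signed_integral X \<rho> \<phi>t + signed_integral X \<zeta> \<phi>
      = 1\<^sup>2 * signed_integral (closure \<Omega>) \<rho>1 (\<lambda>x. \<phi> (1, x)) - 0\<^sup>2 * signed_integral (closure \<Omega>) \<rho>1 (\<lambda>x. \<phi> (0, x))) \<and>
    (\<forall>a c. continuous_on X a \<longrightarrow> continuous_on X c \<longrightarrow> (\<forall>p\<in>X. a p + (c p)\<^sup>2 / 2 \<le> 0) \<longrightarrow>
      signed_integral X \<rho> a + signed_integral X \<zeta> c \<le> C)"
    unfolding X_def
  proof (rule static_piece[OF \<Omega> \<rho>(2), where k'="\<lambda>t. 2 * t"])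
    show "((\<lambda>t. t\<^sup>2) has_real_derivative 2 * t) (at t within {0..1})" for t :: real
      by (auto intro!: derivative_eq_intros)
    show "u * (2 * t) \<le> u\<^sup>2 / 2 * t\<^sup>2 + 2" for t u :: real by (rule q)
  qed (auto intro!: continuous_intros)
  then obtain \<rho>b \<zeta>b Cb where b: "\<rho>b \<in> signed_measures X" "\<zeta>b \<in> signed_measures X" "0 \<le> Cb"
    "\<forall>\<phi> \<phi>t \<phi>x. C1_on_cylinder \<Omega> \<phi> \<phi>t \<phi>x \<longrightarrow>
      signed_integral X \<rho>b \<phi>t + signed_integral X \<zeta>b \<phi> = 1\<^sup>2 * signed_integral (closure \<Omega>) \<rho>1 (\<lambda>x. \<phi> (1, x)) - 0\<^sup>2 * signed_integral (closure \<Omega>) \<rho>1 (\<lambda>x. \<phi> (0, x))"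
    "\<forall>a c. continuous_on X a \<longrightarrow> continuous_on X c \<longrightarrow> (\<forall>p\<in>X. a p + (c p)\<^sup>2 / 2 \<le> 0) \<longrightarrow>
      signed_integral X \<rho>b a + signed_integral X \<zeta>b c \<le> Cb"
    by (elim exE conjE) (rule that)
  define \<rho> where "\<rho> A = \<rho>a A + \<rho>b A" for A
  define \<zeta> where "\<zeta> A = \<zeta>a A + \<zeta>b A" for A
  have sm: "\<rho> \<in> signed_measures X" "\<zeta> \<in> signed_measures X"
    unfolding \<rho>_def[abs_def] \<zeta>_def[abs_def] by (intro signed_measures_add a b)+
  have int: "signed_integral X \<rho> h = signed_integral X \<rho>a h + signed_integral X \<rho>b h"
    "signed_integral X \<zeta> h = signed_integral X \<zeta>a h + signed_integral X \<zeta>b h" if "continuous_on X h" for h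
    unfolding \<rho>_def[abs_def] \<zeta>_def[abs_def]
    by (intro signed_integral_measure_add a b signed_integrable_continuous[OF _ X that])+
  have tr: "(\<rho>, \<lambda>i A. 0, \<zeta>) \<in> triples \<Omega>" using sm by (simp add: triples_def X_def)
  have "(\<rho>, \<lambda>i A. 0, \<zeta>) \<in> CE \<Omega> \<rho>0 \<rho>1"
    unfolding CE_def
  proof (intro CollectI case_prodI conjI allI impI tr)
    fix \<phi> \<phi>t :: "'d spacetime \<Rightarrow> real" and \<phi>x assume \<phi>: "C1_on_cylinder \<Omega> \<phi> \<phi>t \<phi>x"
    have "continuous_on X \<phi>t" "continuous_on X \<phi>"
      using C1_on_cylinder_continuous[OF \<phi>] by (simp_all add: X_def)
    then show "signed_integral (cylinder \<Omega>) \<rho> \<phi>t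
        + (\<Sum>i\<in>UNIV. signed_integral (cylinder \<Omega>) (\<lambda>A. 0) (\<lambda>p. \<phi>x p $ i))
        + signed_integral (cylinder \<Omega>) \<zeta> \<phi>
        = signed_integral (closure \<Omega>) \<rho>1 (\<lambda>x. \<phi> (1, x)) - signed_integral (closure \<Omega>) \<rho>0 (\<lambda>x. \<phi> (0, x))"
      using a(4)[THEN spec, THEN spec, THEN spec, THEN mp, OF \<phi>] b(4)[THEN spec, THEN spec, THEN spec, THEN mp, OF \<phi>] by (simp add: int[unfolded X_def] X_def)
  qed
  then have st: "(\<rho>, \<lambda>i A. 0, \<zeta>) \<in> CE_static \<Omega> \<rho>0 \<rho>1" by (simp add: CE_static_def)
  have C0: "0 \<le> Ca + Cb" using a(3) b(3) by simp
  have "D_FR \<Omega> \<rho> \<zeta> \<le> ennreal (Ca + Cb)"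
    unfolding D_FR_def
  proof (subst D_le_iff[OF \<Omega>(1) tr zero_less_one C0], intro allI impI)
    fix \<alpha> \<gamma> and \<beta> :: "'d \<Rightarrow> 'd spacetime \<Rightarrow> real" assume adm: "admissible (cylinder \<Omega>) 1 \<alpha> \<beta> \<gamma>"
    then have c: "continuous_on X \<alpha>" "continuous_on X \<gamma>" by (auto simp: admissible_def X_def)
    have "\<alpha> p + (\<gamma> p)\<^sup>2 / 2 \<le> 0" if "p \<in> X" for p
    proof -
      have "\<alpha> p + ((\<Sum>i\<in>UNIV. (\<beta> i p)\<^sup>2) + (\<gamma> p)\<^sup>2 / 1\<^sup>2) / 2 \<le> 0" using adm that by (auto simp: admissible_def X_def)
      moreover have "0 \<le> (\<Sum>i\<in>UNIV. (\<beta> i p)\<^sup>2)" by (simp add: sum_nonneg)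
      ultimately show ?thesis by (simp add: add_divide_distrib)
    qed
    then have "\<forall>p\<in>X. \<alpha> p + (\<gamma> p)\<^sup>2 / 2 \<le> 0" by blast
    from a(5)[THEN spec, THEN spec, THEN mp, OF c(1), THEN mp, OF c(2), THEN mp, OF this]
      b(5)[THEN spec, THEN spec, THEN mp, OF c(1), THEN mp, OF c(2), THEN mp, OF this]
    show "pairing (cylinder \<Omega>) \<rho> (\<lambda>i A. 0) \<zeta> \<alpha> \<beta> \<gamma> \<le> Ca + Cb"
      using int(1)[OF c(1)] int(2)[OF c(2)] by (simp add: pairing_def X_def)
  qed
  with st C0 show ?thesis by blast
qed

section \<open>Separate bounds for transport and growth, and their limits\<close>

text \<open>The dual forms of an upper bound on the transport part and on the growth part of the action.\<close>

definition BB_bound :: "'a::topological_space set \<Rightarrow> 'a smeasure \<Rightarrow> ('d::finite \<Rightarrow> 'a smeasure) \<Rightarrow> real \<Rightarrow> bool" where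
  "BB_bound X \<rho> \<omega> C \<longleftrightarrow> (\<forall>a b. continuous_on X a \<longrightarrow> (\<forall>i. continuous_on X (b i)) \<longrightarrow>
     (\<forall>p\<in>X. a p + (\<Sum>i\<in>UNIV. (b i p)\<^sup>2) / 2 \<le> 0) \<longrightarrow>
     signed_integral X \<rho> a + (\<Sum>i\<in>UNIV. signed_integral X (\<omega> i) (b i)) \<le> C)"

definition FR_bound :: "'a::topological_space set \<Rightarrow> 'a smeasure \<Rightarrow> 'a smeasure \<Rightarrow> real \<Rightarrow> bool" where
  "FR_bound X \<rho> \<zeta> C \<longleftrightarrow> (\<forall>a c. continuous_on X a \<longrightarrow> continuous_on X c \<longrightarrow>
     (\<forall>p\<in>X. a p + (c p)\<^sup>2 / 2 \<le> 0) \<longrightarrow> signed_integral X \<rho> a + signed_integral X \<zeta> c \<le> C)"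

lemma BB_boundD:
  "BB_bound X \<rho> \<omega> C \<Longrightarrow> continuous_on X a \<Longrightarrow> (\<And>i. continuous_on X (b i)) \<Longrightarrow>
    (\<And>p. p \<in> X \<Longrightarrow> a p + (\<Sum>i\<in>UNIV. (b i p)\<^sup>2) / 2 \<le> 0) \<Longrightarrow>
    signed_integral X \<rho> a + (\<Sum>i\<in>UNIV. signed_integral X (\<omega> i) (b i)) \<le> C"
  unfolding BB_bound_def by simp

lemma FR_boundD:
  "FR_bound X \<rho> \<zeta> C \<Longrightarrow> continuous_on X a \<Longrightarrow> continuous_on X c \<Longrightarrow>
    (\<And>p. p \<in> X \<Longrightarrow> a p + (c p)\<^sup>2 / 2 \<le> 0) \<Longrightarrow> signed_integral X \<rho> a + signed_integral X \<zeta> c \<le> C"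
  unfolding FR_bound_def by simp

text \<open>Either part of the action is obtained from admissible multipliers that ignore the other part.\<close>

lemma
  fixes \<Omega> :: "(real ^ 'd::finite) set"
  assumes \<Omega>: "bounded \<Omega>" and tr: "(\<rho>, \<omega>, \<zeta>) \<in> triples \<Omega>" and \<delta>: "0 < \<delta>" and C: "0 \<le> C"
    and le: "D \<Omega> \<delta> (\<rho>, \<omega>, \<zeta>) \<le> ennreal C"
  shows BB_bound_of_D_le: "BB_bound (cylinder \<Omega>) \<rho> \<omega> C"
    and FR_bound_of_D_le: "FR_bound (cylinder \<Omega>) \<rho> \<zeta> (C / \<delta>\<^sup>2)"
proof -
  define X where "X = cylinder \<Omega>"
  have pair: "pairing X \<rho> \<omega> \<zeta> a b c \<le> C" if "admissible X \<delta> a b c" for a b c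
    using D_le_iff[OF \<Omega> tr \<delta> C] le that by (simp add: X_def)
  show "BB_bound (cylinder \<Omega>) \<rho> \<omega> C"
    unfolding BB_bound_def X_def[symmetric]
  proof (intro allI impI)
    fix a and b :: "'d \<Rightarrow> 'd spacetime \<Rightarrow> real"
    assume "continuous_on X a" "\<forall>i. continuous_on X (b i)" "\<forall>p\<in>X. a p + (\<Sum>i\<in>UNIV. (b i p)\<^sup>2) / 2 \<le> 0"
    then have "admissible X \<delta> a b (\<lambda>p. 0)" by (simp add: admissible_def)
    from pair[OF this] show "signed_integral X \<rho> a + (\<Sum>i\<in>UNIV. signed_integral X (\<omega> i) (b i)) \<le> C"
      by (simp add: pairing_def)
  qed
  show "FR_bound (cylinder \<Omega>) \<rho> \<zeta> (C / \<delta>\<^sup>2)"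
    unfolding FR_bound_def X_def[symmetric]
  proof (intro allI impI)
    fix a c :: "'d spacetime \<Rightarrow> real" assume ac: "continuous_on X a" "continuous_on X c" "\<forall>p\<in>X. a p + (c p)\<^sup>2 / 2 \<le> 0"
    have "\<delta>\<^sup>2 * a p + ((\<Sum>i\<in>(UNIV :: 'd set). 0\<^sup>2) + (\<delta>\<^sup>2 * c p)\<^sup>2 / \<delta>\<^sup>2) / 2 \<le> 0" if "p \<in> X" for p
    proof -
      have "\<delta>\<^sup>2 * a p + ((\<Sum>i\<in>(UNIV :: 'd set). 0\<^sup>2) + (\<delta>\<^sup>2 * c p)\<^sup>2 / \<delta>\<^sup>2) / 2 = \<delta>\<^sup>2 * (a p + (c p)\<^sup>2 / 2)"
        using \<delta> by (simp add: power2_eq_square distrib_left)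
      then show ?thesis using ac(3) that by (simp add: mult_nonneg_nonpos)
    qed
    then have "admissible X \<delta> (\<lambda>p. \<delta>\<^sup>2 * a p) (\<lambda>i p. 0) (\<lambda>p. \<delta>\<^sup>2 * c p)"
      using ac by (auto simp: admissible_def intro!: continuous_intros)
    from pair[OF this] have "\<delta>\<^sup>2 * (signed_integral X \<rho> a + signed_integral X \<zeta> c) \<le> C"
      by (simp add: pairing_def signed_integral_cmult distrib_left)
    then show "signed_integral X \<rho> a + signed_integral X \<zeta> c \<le> C / \<delta>\<^sup>2"
      using \<delta> by (simp add: pos_le_divide_eq mult.commute)
  qed
qed

lemma D_BB_le_of_bound:
  fixes \<Omega> :: "(real ^ 'd::finite) set"
  assumes \<Omega>: "bounded \<Omega>" and sm: "\<rho> \<in> signed_measures (cylinder \<Omega>)" "\<And>i. \<omega> i \<in> signed_measures (cylinder \<Omega>)"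
    and C: "0 \<le> C" and b: "BB_bound (cylinder \<Omega>) \<rho> \<omega> C"
  shows "D_BB \<Omega> \<rho> \<omega> \<le> ennreal C"
proof -
  have tr: "(\<rho>, \<omega>, \<lambda>A. 0) \<in> triples \<Omega>" using sm by (simp add: triples_def)
  show ?thesis unfolding D_BB_def
  proof (subst D_le_iff[OF \<Omega> tr zero_less_one C], intro allI impI)
    fix a c and b' :: "'d \<Rightarrow> 'd spacetime \<Rightarrow> real" assume adm: "admissible (cylinder \<Omega>) 1 a b' c"
    have "a p + (\<Sum>i\<in>UNIV. (b' i p)\<^sup>2) / 2 \<le> 0" if "p \<in> cylinder \<Omega>" for p
    proof -
      have "a p + ((\<Sum>i\<in>UNIV. (b' i p)\<^sup>2) + (c p)\<^sup>2 / 1\<^sup>2) / 2 \<le> 0" using adm that unfolding admissible_def by blast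
      moreover have "0 \<le> (c p)\<^sup>2 / 2" by simp
      ultimately show ?thesis by (simp only: add_divide_distrib power_one div_by_1)
    qed
    then show "pairing (cylinder \<Omega>) \<rho> \<omega> (\<lambda>A. 0) a b' c \<le> C"
      using BB_boundD[OF b, of a b'] adm by (simp add: admissible_def pairing_def)
  qed
qed

lemma D_static_le_of_bound:
  fixes \<Omega> :: "(real ^ 'd::finite) set"
  assumes \<Omega>: "bounded \<Omega>" and sm: "\<rho> \<in> signed_measures (cylinder \<Omega>)" "\<zeta> \<in> signed_measures (cylinder \<Omega>)"
    and \<delta>: "0 < \<delta>" and C: "0 \<le> C" and b: "FR_bound (cylinder \<Omega>) \<rho> \<zeta> C"
  shows "D \<Omega> \<delta> (\<rho>, \<lambda>i A. 0, \<zeta>) \<le> ennreal (\<delta>\<^sup>2 * C)"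
proof -
  have tr: "(\<rho>, \<lambda>i A. 0, \<zeta>) \<in> triples \<Omega>" using sm by (simp add: triples_def)
  have C': "0 \<le> \<delta>\<^sup>2 * C" using C by simp
  show ?thesis
  proof (subst D_le_iff[OF \<Omega> tr \<delta> C'], intro allI impI)
    fix a c and b' :: "'d \<Rightarrow> 'd spacetime \<Rightarrow> real" assume adm: "admissible (cylinder \<Omega>) \<delta> a b' c"
    have cont: "continuous_on (cylinder \<Omega>) (\<lambda>p. 1 / \<delta>\<^sup>2 * a p)" "continuous_on (cylinder \<Omega>) (\<lambda>p. 1 / \<delta>\<^sup>2 * c p)"
      using adm \<delta> unfolding admissible_def by (intro continuous_intros; simp)+
    have "1 / \<delta>\<^sup>2 * a p + (1 / \<delta>\<^sup>2 * c p)\<^sup>2 / 2 \<le> 0" if "p \<in> cylinder \<Omega>" for p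
    proof -
      have "a p + ((\<Sum>i\<in>UNIV. (b' i p)\<^sup>2) + (c p)\<^sup>2 / \<delta>\<^sup>2) / 2 \<le> 0" using adm that unfolding admissible_def by blast
      moreover have "0 \<le> (\<Sum>i\<in>UNIV. (b' i p)\<^sup>2)" by (simp add: sum_nonneg)
      ultimately have "a p + (c p)\<^sup>2 / \<delta>\<^sup>2 / 2 \<le> 0" by (simp only: add_divide_distrib)
      then have "1 / \<delta>\<^sup>2 * (a p + (c p)\<^sup>2 / \<delta>\<^sup>2 / 2) \<le> 0" by (intro mult_nonneg_nonpos) auto
      also have "1 / \<delta>\<^sup>2 * (a p + (c p)\<^sup>2 / \<delta>\<^sup>2 / 2) = 1 / \<delta>\<^sup>2 * a p + (1 / \<delta>\<^sup>2 * c p)\<^sup>2 / 2"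
        by (simp add: power2_eq_square add_divide_distrib)
      finally show ?thesis .
    qed
    from FR_boundD[OF b cont this] have "1 / \<delta>\<^sup>2 * (signed_integral (cylinder \<Omega>) \<rho> a + signed_integral (cylinder \<Omega>) \<zeta> c) \<le> C"
      unfolding signed_integral_cmult distrib_left .
    then show "pairing (cylinder \<Omega>) \<rho> (\<lambda>i A. 0) \<zeta> a b' c \<le> \<delta>\<^sup>2 * C"
      using \<delta> by (simp add: pairing_def pos_divide_le_eq mult.commute)
  qed
qed

lemma D_FR_le_of_bound:
  fixes \<Omega> :: "(real ^ 'd::finite) set"
  assumes "bounded \<Omega>" "\<rho> \<in> signed_measures (cylinder \<Omega>)" "\<zeta> \<in> signed_measures (cylinder \<Omega>)"
    "0 \<le> C" "FR_bound (cylinder \<Omega>) \<rho> \<zeta> C"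
  shows "D_FR \<Omega> \<rho> \<zeta> \<le> ennreal C"
  using D_static_le_of_bound[OF assms(1-3) zero_less_one assms(4,5)] by (simp add: D_FR_def)

lemma nonneg_of_FR_bound:
  fixes X :: "'a::euclidean_space set"
  assumes X: "compact X" and \<rho>: "\<rho> \<in> signed_measures X" and b: "FR_bound X \<rho> \<zeta> C"
  shows "\<rho> \<in> nonneg_measures X"
proof (rule nonneg_measure_of_pairing_le[OF X \<rho>])
  fix a :: "'a \<Rightarrow> real" assume "continuous_on X a" "\<And>x. x \<in> X \<Longrightarrow> a x \<le> 0"
  then show "signed_integral X \<rho> a \<le> C" using FR_boundD[OF b, of a "\<lambda>p. 0"] by simp
qed

lemma nonneg_of_BB_bound:
  fixes X :: "'a::euclidean_space set"
  assumes X: "compact X" and \<rho>: "\<rho> \<in> signed_measures X" and b: "BB_bound X \<rho> \<omega> C"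
  shows "\<rho> \<in> nonneg_measures X"
proof (rule nonneg_measure_of_pairing_le[OF X \<rho>])
  fix a :: "'a \<Rightarrow> real" assume "continuous_on X a" "\<And>x. x \<in> X \<Longrightarrow> a x \<le> 0"
  then show "signed_integral X \<rho> a \<le> C" using BB_boundD[OF b, of a "\<lambda>i p. 0"] by simp
qed

text \<open>As the growth part is at least \<open>2 (s1 - s0)\<^sup>2\<close>, a bound on the action leaves only the excess for the
  transport part. In dual form: the optimal multiplier for the growth part is added to an arbitrary
  one for the transport part.\<close>

lemma BB_bound_of_D_growth_le:
  fixes \<Omega> :: "(real ^ 'd::finite) set"
  assumes \<Omega>: "bounded \<Omega>" and CE: "(\<rho>, \<omega>, \<zeta>) \<in> CE \<Omega> \<rho>0 \<rho>1"
    and bdry: "\<rho>0 \<in> signed_measures (closure \<Omega>)" "\<rho>1 \<in> signed_measures (closure \<Omega>)"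
    and s: "0 \<le> s0" "0 \<le> s1" "\<rho>0 (closure \<Omega>) = s0\<^sup>2" "\<rho>1 (closure \<Omega>) = s1\<^sup>2"
    and \<delta>: "0 < \<delta>" and C: "0 \<le> C" and le: "D \<Omega> \<delta> (\<rho>, \<omega>, \<zeta>) \<le> ennreal (C + \<delta>\<^sup>2 * (2 * (s1 - s0)\<^sup>2))"
  shows "BB_bound (cylinder \<Omega>) \<rho> \<omega> C"
  unfolding BB_bound_def
proof (intro allI impI)
  define X where "X = cylinder \<Omega>"
  have X: "compact X" unfolding X_def by (rule compact_cylinder[OF \<Omega>])
  fix a and b :: "'d \<Rightarrow> 'd spacetime \<Rightarrow> real"
  assume ab: "continuous_on (cylinder \<Omega>) a" "\<forall>i. continuous_on (cylinder \<Omega>) (b i)"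
    "\<forall>p\<in>cylinder \<Omega>. a p + (\<Sum>i\<in>UNIV. (b i p)\<^sup>2) / 2 \<le> 0"
  note ab = ab[folded X_def]
  have tr: "(\<rho>, \<omega>, \<zeta>) \<in> triples \<Omega>" by (rule CE_triples[OF CE])
  then have \<rho>: "\<rho> \<in> signed_measures X" by (simp add: triples_def X_def)
  define A where "A = signed_integral X \<rho> a + (\<Sum>i\<in>UNIV. signed_integral X (\<omega> i) (b i))"
  have "A + \<delta>\<^sup>2 * reg_action s0 s1 e \<le> C + \<delta>\<^sup>2 * (2 * (s1 - s0)\<^sup>2)" if e: "0 < e" for e
  proof -
    let ?g = "\<lambda>p. reg_rate s0 s1 e (fst p)"
    have cg: "continuous_on X ?g" unfolding X_def by (rule continuous_on_reg_rate_fst[OF s(1,2) e])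
    have cg2: "continuous_on X (\<lambda>p. (\<delta>\<^sup>2 / 2) * (?g p)\<^sup>2)" by (intro continuous_intros cg)
    have eq: "(a p - (\<delta>\<^sup>2 / 2) * (?g p)\<^sup>2) + ((\<Sum>i\<in>UNIV. (b i p)\<^sup>2) + (\<delta>\<^sup>2 * ?g p)\<^sup>2 / \<delta>\<^sup>2) / 2
        = a p + (\<Sum>i\<in>UNIV. (b i p)\<^sup>2) / 2" for p
      using \<delta> by (simp add: power2_eq_square add_divide_distrib)
    have "admissible X \<delta> (\<lambda>p. a p - (\<delta>\<^sup>2 / 2) * (?g p)\<^sup>2) b (\<lambda>p. \<delta>\<^sup>2 * ?g p)"
      unfolding admissible_def
    proof (intro conjI ballI)
      show "continuous_on X (\<lambda>p. a p - (\<delta>\<^sup>2 / 2) * (?g p)\<^sup>2)" by (rule continuous_on_diff[OF ab(1) cg2])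
      show "continuous_on X (\<lambda>p. \<delta>\<^sup>2 * ?g p)" by (intro continuous_intros cg)
      show "(a p - (\<delta>\<^sup>2 / 2) * (?g p)\<^sup>2) + ((\<Sum>i\<in>UNIV. (b i p)\<^sup>2) + (\<delta>\<^sup>2 * ?g p)\<^sup>2 / \<delta>\<^sup>2) / 2 \<le> 0"
        if "p \<in> X" for p unfolding eq using ab(3) that by blast
    qed (rule ab(2))
    moreover have "0 \<le> C + \<delta>\<^sup>2 * (2 * (s1 - s0)\<^sup>2)" using C by simp
    ultimately have p: "pairing X \<rho> \<omega> \<zeta> (\<lambda>p. a p - (\<delta>\<^sup>2 / 2) * (?g p)\<^sup>2) b (\<lambda>p. \<delta>\<^sup>2 * ?g p) \<le> C + \<delta>\<^sup>2 * (2 * (s1 - s0)\<^sup>2)"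
      using D_le_iff[OF \<Omega> tr \<delta>] le by (simp add: X_def)
    have 1: "signed_integral X \<rho> (\<lambda>p. a p - (\<delta>\<^sup>2 / 2) * (?g p)\<^sup>2)
        = signed_integral X \<rho> a - (\<delta>\<^sup>2 / 2) * signed_integral X \<rho> (\<lambda>p. (?g p)\<^sup>2)"
      by (subst signed_integral_sub[OF signed_integrable_continuous[OF \<rho> X ab(1)] signed_integrable_continuous[OF \<rho> X cg2]])
        (simp only: signed_integral_cmult)
    have 2: "signed_integral X \<zeta> (\<lambda>p. \<delta>\<^sup>2 * ?g p)
        = \<delta>\<^sup>2 * (reg_action s0 s1 e + signed_integral X \<rho> (\<lambda>p. (?g p)\<^sup>2) / 2)"
      unfolding signed_integral_cmult X_def CE_reg_rate[OF \<Omega> CE bdry s e] ..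
    show ?thesis using p unfolding pairing_def 1 2 A_def by (simp add: distrib_left)
  qed
  then have "A + \<delta>\<^sup>2 * reg_action s0 s1 (1 / real (Suc n)) \<le> C + \<delta>\<^sup>2 * (2 * (s1 - s0)\<^sup>2)" for n by simp
  moreover have "(\<lambda>n. A + \<delta>\<^sup>2 * reg_action s0 s1 (1 / real (Suc n))) \<longlonglongrightarrow> A + \<delta>\<^sup>2 * (2 * (s1 - s0)\<^sup>2)"
    by (intro tendsto_intros reg_action_tendsto s)
  ultimately have "A + \<delta>\<^sup>2 * (2 * (s1 - s0)\<^sup>2) \<le> C + \<delta>\<^sup>2 * (2 * (s1 - s0)\<^sup>2)"
    by (intro LIMSEQ_le_const2) auto
  then show "signed_integral (cylinder \<Omega>) \<rho> a + (\<Sum>i\<in>UNIV. signed_integral (cylinder \<Omega>) (\<omega> i) (b i)) \<le> C"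
    by (simp add: A_def X_def)
qed

lemma abs_source_le:
  assumes b: "FR_bound X \<rho> \<zeta> C" and \<rho>: "\<rho> \<in> signed_measures X" and h: "continuous_on X h" "\<And>x. x \<in> X \<Longrightarrow> \<bar>h x\<bar> \<le> 1"
  shows "\<bar>signed_integral X \<zeta> h\<bar> \<le> C + \<rho> X / 2"
proof -
  have h2: "(h p)\<^sup>2 \<le> 1" if "p \<in> X" for p using h(2)[OF that] by (simp add: abs_square_le_1)
  have "signed_integral X \<rho> (\<lambda>p. - 1/2) + signed_integral X \<zeta> h \<le> C"
    using h2 h(1) by (intro FR_boundD[OF b]) (auto intro!: continuous_intros)
  moreover have "signed_integral X \<rho> (\<lambda>p. - 1/2) + signed_integral X \<zeta> (\<lambda>p. - h p) \<le> C"
    using h2 h(1) by (intro FR_boundD[OF b]) (auto intro!: continuous_intros)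
  ultimately show ?thesis
    unfolding signed_integral_const[OF \<rho>] signed_integral_uminus by (auto simp: abs_le_iff)
qed

text \<open>The Cauchy-Schwarz inequality for the momentum in the form of Young's inequality with parameter
  \<open>t\<close>, obtained from multipliers that are multiples of \<open>h\<close> in one direction.\<close>

lemma abs_momentum_le:
  fixes \<omega> :: "'d::finite \<Rightarrow> 'a::topological_space smeasure"
  assumes b: "BB_bound X \<rho> \<omega> C" and \<rho>: "\<rho> \<in> signed_measures X" and h: "continuous_on X h" "\<And>x. x \<in> X \<Longrightarrow> \<bar>h x\<bar> \<le> 1"
    and t: "0 < t"
  shows "\<bar>signed_integral X (\<omega> j) h\<bar> \<le> C / t + t * \<rho> X / 2"
proof -
  have main: "u * signed_integral X (\<omega> j) h \<le> C + t\<^sup>2 / 2 * \<rho> X" if u: "u\<^sup>2 = t\<^sup>2" for u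
  proof -
    let ?b = "\<lambda>i p. (if i = j then u else 0) * h p"
    have sq: "(\<Sum>i\<in>UNIV. (?b i p)\<^sup>2) = u\<^sup>2 * (h p)\<^sup>2" for p
    proof -
      have "(\<Sum>i\<in>UNIV. (?b i p)\<^sup>2) = (\<Sum>i\<in>UNIV. if i = j then u\<^sup>2 * (h p)\<^sup>2 else 0)"
        by (intro sum.cong) (auto simp: power_mult_distrib)
      then show ?thesis by simp
    qed
    have "signed_integral X \<rho> (\<lambda>p. - (t\<^sup>2 / 2)) + (\<Sum>i\<in>UNIV. signed_integral X (\<omega> i) (?b i)) \<le> C"
    proof (rule BB_boundD[OF b])
      show "- (t\<^sup>2 / 2) + (\<Sum>i\<in>UNIV. (?b i p)\<^sup>2) / 2 \<le> 0" if "p \<in> X" for p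
      proof -
        have "(h p)\<^sup>2 \<le> 1" using h(2)[OF that] by (simp add: abs_square_le_1)
        then have "t\<^sup>2 * (h p)\<^sup>2 \<le> t\<^sup>2 * 1" by (intro mult_left_mono) auto
        then show ?thesis unfolding sq u by simp
      qed
    qed (use h(1) in \<open>auto intro!: continuous_intros\<close>)
    moreover have "(\<Sum>i\<in>UNIV. signed_integral X (\<omega> i) (?b i)) = u * signed_integral X (\<omega> j) h"
    proof -
      have "(\<Sum>i\<in>UNIV. signed_integral X (\<omega> i) (?b i)) = (\<Sum>i\<in>UNIV. if i = j then u * signed_integral X (\<omega> j) h else 0)"
        unfolding signed_integral_cmult by (intro sum.cong) auto
      then show ?thesis by simp
    qed
    ultimately show ?thesis unfolding signed_integral_const[OF \<rho>] by simp
  qed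
  have "t * \<bar>signed_integral X (\<omega> j) h\<bar> \<le> C + t\<^sup>2 / 2 * \<rho> X"
    using main[of t] main[of "- t"] by (simp add: abs_if)
  also have "\<dots> = t * (C / t + t * \<rho> X / 2)" using t by (simp add: power2_eq_square distrib_left)
  finally show ?thesis using t by simp
qed

text \<open>Testing with \<open>t - 1\<close> expresses the total mass in space-time by the initial mass and an integral
  against the source, which is at most a constant plus half of the total mass.\<close>

lemma mass_le_of_FR_bound:
  fixes \<Omega> :: "(real ^ 'd::finite) set"
  assumes \<Omega>: "bounded \<Omega>" and CE: "(\<rho>, \<omega>, \<zeta>) \<in> CE \<Omega> \<rho>0 \<rho>1"
    and bdry: "\<rho>0 \<in> signed_measures (closure \<Omega>)" "\<rho>1 \<in> signed_measures (closure \<Omega>)"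
    and b: "FR_bound (cylinder \<Omega>) \<rho> \<zeta> C"
  shows "\<rho> (cylinder \<Omega>) \<le> 2 * (\<rho>0 (closure \<Omega>) + C)"
proof -
  define X where "X = cylinder \<Omega>"
  have \<rho>: "\<rho> \<in> signed_measures X" using CE_triples[OF CE] by (simp add: triples_def X_def)
  have "((\<lambda>t. t - 1) has_real_derivative 1) (at t within {0..1})" for t :: real
    by (auto intro!: derivative_eq_intros)
  from CE_time_test[OF CE bdry this] have "\<rho> X + signed_integral X \<zeta> (\<lambda>p. fst p - 1) = \<rho>0 (closure \<Omega>)"
    by (simp add: X_def[symmetric] signed_integral_const[OF \<rho>])
  moreover have "signed_integral X \<zeta> (\<lambda>p. fst p - 1) = - signed_integral X \<zeta> (\<lambda>p. 1 - fst p)"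
    unfolding signed_integral_uminus[symmetric] by simp
  moreover have "\<bar>signed_integral X \<zeta> (\<lambda>p. 1 - fst p)\<bar> \<le> C + \<rho> X / 2"
    by (rule abs_source_le[OF b[folded X_def] \<rho>]) (auto simp: X_def intro!: continuous_intros)
  ultimately show ?thesis by (simp add: X_def[symmetric] abs_le_iff)
qed

lemma CE_weak_star_closed:
  fixes \<Omega> :: "(real ^ 'd::finite) set"
  assumes CE: "\<And>n. \<mu> n \<in> CE \<Omega> \<rho>0 \<rho>1" and \<nu>: "(\<rho>, \<omega>, \<zeta>) \<in> triples \<Omega>"
    and lim: "triple_weak_star_tendsto \<Omega> \<mu> (\<rho>, \<omega>, \<zeta>)"
  shows "(\<rho>, \<omega>, \<zeta>) \<in> CE \<Omega> \<rho>0 \<rho>1"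
  unfolding CE_def
proof (intro CollectI case_prodI conjI allI impI \<nu>)
  let ?X = "cylinder \<Omega>"
  fix \<phi> \<phi>t :: "'d spacetime \<Rightarrow> real" and \<phi>x assume \<phi>: "C1_on_cylinder \<Omega> \<phi> \<phi>t \<phi>x"
  have c: "continuous_on ?X \<phi>" "continuous_on ?X \<phi>t" "continuous_on ?X \<phi>x" by (rule C1_on_cylinder_continuous[OF \<phi>])+
  have cx: "continuous_on ?X (\<lambda>p. \<phi>x p $ i)" for i using c(3) by (intro continuous_intros)
  have l: "(\<lambda>n. signed_integral ?X (fst (\<mu> n)) f) \<longlonglongrightarrow> signed_integral ?X \<rho> f"
    "(\<lambda>n. signed_integral ?X (fst (snd (\<mu> n)) i) f) \<longlonglongrightarrow> signed_integral ?X (\<omega> i) f"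
    "(\<lambda>n. signed_integral ?X (snd (snd (\<mu> n))) f) \<longlonglongrightarrow> signed_integral ?X \<zeta> f" if "continuous_on ?X f" for f i
    using lim that by (auto simp: triple_weak_star_tendsto_def weak_star_tendsto_def)
  have "(\<lambda>n. signed_integral ?X (fst (\<mu> n)) \<phi>t + (\<Sum>i\<in>UNIV. signed_integral ?X (fst (snd (\<mu> n)) i) (\<lambda>p. \<phi>x p $ i))
      + signed_integral ?X (snd (snd (\<mu> n))) \<phi>) \<longlonglongrightarrow>
      signed_integral ?X \<rho> \<phi>t + (\<Sum>i\<in>UNIV. signed_integral ?X (\<omega> i) (\<lambda>p. \<phi>x p $ i)) + signed_integral ?X \<zeta> \<phi>"
    by (intro tendsto_add tendsto_sum l c cx)
  moreover have "signed_integral ?X (fst (\<mu> n)) \<phi>t + (\<Sum>i\<in>UNIV. signed_integral ?X (fst (snd (\<mu> n)) i) (\<lambda>p. \<phi>x p $ i))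
      + signed_integral ?X (snd (snd (\<mu> n))) \<phi>
      = signed_integral (closure \<Omega>) \<rho>1 (\<lambda>x. \<phi> (1, x)) - signed_integral (closure \<Omega>) \<rho>0 (\<lambda>x. \<phi> (0, x))" for n
  proof -
    obtain \<rho>' \<omega>' \<zeta>' where m: "\<mu> n = (\<rho>', \<omega>', \<zeta>')" by (cases "\<mu> n")
    show ?thesis using CE[of n] \<phi> unfolding m CE_def by simp
  qed
  ultimately show "signed_integral ?X \<rho> \<phi>t + (\<Sum>i\<in>UNIV. signed_integral ?X (\<omega> i) (\<lambda>p. \<phi>x p $ i)) + signed_integral ?X \<zeta> \<phi>
      = signed_integral (closure \<Omega>) \<rho>1 (\<lambda>x. \<phi> (1, x)) - signed_integral (closure \<Omega>) \<rho>0 (\<lambda>x. \<phi> (0, x))"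
    by (simp add: LIMSEQ_const_iff)
qed

lemma BB_bound_limit:
  fixes X :: "'a::topological_space set" and \<omega> :: "nat \<Rightarrow> 'd::finite \<Rightarrow> 'a smeasure"
  assumes b: "\<And>n. BB_bound X (\<rho> n) (\<omega> n) (C n)" and C: "C \<longlonglongrightarrow> c"
    and lim: "weak_star_tendsto X \<rho> \<rho>'" "\<And>i. weak_star_tendsto X (\<lambda>n. \<omega> n i) (\<omega>' i)"
  shows "BB_bound X \<rho>' \<omega>' c"
  unfolding BB_bound_def
proof (intro allI impI)
  fix a :: "'a \<Rightarrow> real" and b' :: "'d \<Rightarrow> 'a \<Rightarrow> real"
  assume ab: "continuous_on X a" "\<forall>i. continuous_on X (b' i)" "\<forall>p\<in>X. a p + (\<Sum>i\<in>UNIV. (b' i p)\<^sup>2) / 2 \<le> 0"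
  have "(\<lambda>n. signed_integral X (\<rho> n) a + (\<Sum>i\<in>UNIV. signed_integral X (\<omega> n i) (b' i)))
      \<longlonglongrightarrow> signed_integral X \<rho>' a + (\<Sum>i\<in>UNIV. signed_integral X (\<omega>' i) (b' i))"
    using lim ab by (intro tendsto_add tendsto_sum) (auto simp: weak_star_tendsto_def)
  then show "signed_integral X \<rho>' a + (\<Sum>i\<in>UNIV. signed_integral X (\<omega>' i) (b' i)) \<le> c"
    by (rule LIMSEQ_le[OF _ C]) (use BB_boundD[OF b] ab in auto)
qed

lemma FR_bound_limit:
  fixes X :: "'a::topological_space set"
  assumes b: "\<And>n. FR_bound X (\<rho> n) (\<zeta> n) (C n)" and C: "C \<longlonglongrightarrow> c"
    and lim: "weak_star_tendsto X \<rho> \<rho>'" "weak_star_tendsto X \<zeta> \<zeta>'"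
  shows "FR_bound X \<rho>' \<zeta>' c"
  unfolding FR_bound_def
proof (intro allI impI)
  fix a b' :: "'a \<Rightarrow> real" assume ab: "continuous_on X a" "continuous_on X b'" "\<forall>p\<in>X. a p + (b' p)\<^sup>2 / 2 \<le> 0"
  have "(\<lambda>n. signed_integral X (\<rho> n) a + signed_integral X (\<zeta> n) b')
      \<longlonglongrightarrow> signed_integral X \<rho>' a + signed_integral X \<zeta>' b'"
    using lim ab by (intro tendsto_add) (auto simp: weak_star_tendsto_def)
  then show "signed_integral X \<rho>' a + signed_integral X \<zeta>' b' \<le> c"
    by (rule LIMSEQ_le[OF _ C]) (use FR_boundD[OF b] ab in auto)
qed

text \<open>The bounds on the two parts of the action and on the total mass bound all components of the
  triples, so that a common subsequence can be extracted.\<close>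

lemma weak_star_compact_CE:
  fixes \<Omega> :: "(real ^ 'd::finite) set" and \<rho> \<zeta> :: "nat \<Rightarrow> 'd spacetime smeasure"
    and \<omega> :: "nat \<Rightarrow> 'd \<Rightarrow> 'd spacetime smeasure"
  assumes \<Omega>: "bounded \<Omega>" "convex \<Omega>" "\<Omega> \<noteq> {}" and CE: "\<And>n. (\<rho> n, \<omega> n, \<zeta> n) \<in> CE \<Omega> \<rho>0 \<rho>1"
    and bdry: "\<rho>0 \<in> signed_measures (closure \<Omega>)" "\<rho>1 \<in> signed_measures (closure \<Omega>)"
    and BB: "\<And>n. BB_bound (cylinder \<Omega>) (\<rho> n) (\<omega> n) B" and FR: "\<And>n. FR_bound (cylinder \<Omega>) (\<rho> n) (\<zeta> n) C"
  obtains r \<rho>' \<omega>' \<zeta>' where "strict_mono r" "(\<rho>', \<omega>', \<zeta>') \<in> triples \<Omega>"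
    "triple_weak_star_tendsto \<Omega> (\<lambda>k. (\<rho> (r k), \<omega> (r k), \<zeta> (r k))) (\<rho>', \<omega>', \<zeta>')"
proof -
  define X where "X = cylinder \<Omega>"
  have X: "compact X" "convex X" "X \<noteq> {}"
    unfolding X_def using \<Omega> compact_cylinder by (auto intro!: convex_Times convex_closure)
  have sm: "\<rho> n \<in> signed_measures X" "\<omega> n i \<in> signed_measures X" "\<zeta> n \<in> signed_measures X" for n i
    using CE_triples[OF CE[of n]] by (auto simp: triples_def X_def)
  note BB = BB[folded X_def] and FR = FR[folded X_def]
  have nn: "\<rho> n \<in> nonneg_measures X" for n by (rule nonneg_of_FR_bound[OF X(1) sm(1) FR])
  define R where "R = 2 * (\<rho>0 (closure \<Omega>) + C)"
  have mass: "\<rho> n X \<le> R" "0 \<le> \<rho> n X" for n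
    using mass_le_of_FR_bound[OF \<Omega>(1) CE bdry FR[of n, unfolded X_def]] nn[of n]
    by (auto simp: X_def R_def nonneg_measures_def)
  have "0 \<le> C" using FR_boundD[OF FR[of 0], where a="\<lambda>p. 0" and c="\<lambda>p. 0"] by simp
  have "0 \<le> B" using BB_boundD[OF BB[of 0], where a="\<lambda>p. 0" and b="\<lambda>i p. 0"] by simp
  have "0 \<le> R" using mass[of 0] by simp
  define m where "m n j = (case j of None \<Rightarrow> \<rho> n | Some None \<Rightarrow> \<zeta> n | Some (Some i) \<Rightarrow> \<omega> n i)" for n and j :: "'d option option"
  have "\<exists>r \<nu>. strict_mono r \<and> (\<forall>j\<in>UNIV. \<nu> j \<in> signed_measures X \<and> weak_star_tendsto X (\<lambda>k. m (r k) j) (\<nu> j))"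
  proof (rule weak_star_compact_family[OF X finite])
    show "m n j \<in> signed_measures X" for n j using sm by (auto simp: m_def split: option.split)
    fix n j and h :: "'d spacetime \<Rightarrow> real" assume h: "continuous_on X h" "\<And>x. 0 \<le> h x \<and> h x \<le> 1"
    have h1: "\<And>x. x \<in> X \<Longrightarrow> \<bar>h x\<bar> \<le> 1" using h(2) by auto
    have "\<bar>signed_integral X (\<zeta> n) h\<bar> \<le> C + \<rho> n X / 2"
      by (rule abs_source_le[OF FR sm(1) h(1) h1])
    then have 1: "\<bar>signed_integral X (\<zeta> n) h\<bar> \<le> C + R / 2" using mass(1)[of n] by linarith
    have "\<bar>signed_integral X (\<omega> n i) h\<bar> \<le> B / 1 + 1 * \<rho> n X / 2" for i
      by (rule abs_momentum_le[OF BB sm(1) h(1) h1 zero_less_one])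
    then have 2: "\<bar>signed_integral X (\<omega> n i) h\<bar> \<le> B + R / 2" for i using mass(1)[of n] by (smt (verit) div_by_1 mult_1 divide_right_mono)
    have 3: "\<bar>signed_integral X (\<rho> n) h\<bar> \<le> R"
    proof -
      interpret finite_measure "pos_part X (\<rho> n)" by (rule finite_measure_pos_part[OF sm(1)])
      have "\<bar>signed_integral X (\<rho> n) h\<bar> \<le> (\<integral>x. \<bar>h x\<bar> \<partial>pos_part X (\<rho> n))"
        unfolding signed_integral_nonneg_measure[OF nn] by (rule integral_abs_bound)
      also have "\<dots> \<le> (\<integral>x. 1 \<partial>pos_part X (\<rho> n))"
        using h1 integrable_continuous_on[OF finite_measure_axioms sets_pos_part X(1) h(1)] by (intro integral_mono) auto
      also have "\<dots> = \<rho> n X" using measure_pos_part_nonneg_measure[OF nn X_in_borel_on] by simp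
      finally show ?thesis using mass(1)[of n] by simp
    qed
    show "\<bar>signed_integral X (m n j) h\<bar> \<le> R + B + C"
    proof -
      have "\<bar>signed_integral X (\<omega> n i) h\<bar> \<le> R + B + C" for i
        using 2[of i] \<open>0 \<le> C\<close> \<open>0 \<le> R\<close> by linarith
      moreover have "\<bar>signed_integral X (\<zeta> n) h\<bar> \<le> R + B + C" "\<bar>signed_integral X (\<rho> n) h\<bar> \<le> R + B + C"
        using 1 3 \<open>0 \<le> C\<close> \<open>0 \<le> B\<close> \<open>0 \<le> R\<close> by linarith+
      ultimately show ?thesis by (simp add: m_def split: option.split)
    qed
  qed
  then obtain r \<nu> where r: "strict_mono r" "\<And>j. \<nu> j \<in> signed_measures X" "\<And>j. weak_star_tendsto X (\<lambda>k. m (r k) j) (\<nu> j)"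
    by auto
  have "triple_weak_star_tendsto \<Omega> (\<lambda>k. (\<rho> (r k), \<omega> (r k), \<zeta> (r k))) (\<nu> None, \<lambda>i. \<nu> (Some (Some i)), \<nu> (Some None))"
    using r(3)[of None] r(3)[of "Some None"] r(3)[of "Some (Some _)"]
    by (simp add: triple_weak_star_tendsto_def X_def m_def)
  moreover have "(\<nu> None, \<lambda>i. \<nu> (Some (Some i)), \<nu> (Some None)) \<in> triples \<Omega>"
    using r(2) by (simp add: triples_def X_def)
  ultimately show thesis using r(1) that by blast
qed

section \<open>Convergence of the minimizers\<close>

lemma convergent_bounded_above:
  fixes x :: "nat \<Rightarrow> real"
  assumes "x \<longlonglongrightarrow> l" obtains B where "\<And>n. x n \<le> B"
proof -
  from convergent_imp_Bseq[OF convergentI[OF assms]] obtain B where "\<forall>n. norm (x n) \<le> B"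
    unfolding Bseq_def by auto
  then have "x n \<le> B" for n using abs_le_D1[of "x n" B] by simp
  then show thesis by (rule that)
qed

lemma BB_bound_mono: "BB_bound X \<rho> \<omega> C \<Longrightarrow> C \<le> C' \<Longrightarrow> BB_bound X \<rho> \<omega> C'"
  unfolding BB_bound_def[of _ _ _ C'] by (intro allI impI) (rule order_trans[OF BB_boundD]; simp)

lemma FR_bound_mono: "FR_bound X \<rho> \<zeta> C \<Longrightarrow> C \<le> C' \<Longrightarrow> FR_bound X \<rho> \<zeta> C'"
  unfolding FR_bound_def[of _ _ _ C'] by (intro allI impI) (rule order_trans[OF FR_boundD]; simp)

text \<open>Comparison of the minimizer with all competitors for \<open>d_gBB\<close>, each of which has the minimal growth
  part \<open>2 (s1 - s0)\<^sup>2\<close>.\<close>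

lemma WF_minimizer_growth_le:
  fixes \<Omega> :: "(real ^ 'd::finite) set"
  assumes \<Omega>: "bounded \<Omega>"
    and \<rho>: "\<rho>0 \<in> nonneg_measures (closure \<Omega>)" "\<rho>1 \<in> nonneg_measures (closure \<Omega>)"
    and min: "WF_minimizer \<Omega> \<delta> \<rho>0 \<rho>1 \<mu>" and \<delta>: "0 < \<delta>"
    and C: "0 \<le> C" "d_gBB_sq \<Omega> \<rho>0 \<rho>1 = ennreal C"
  shows "D \<Omega> \<delta> \<mu> \<le> ennreal (C + \<delta>\<^sup>2 * (2 * (sqrt (\<rho>1 (closure \<Omega>)) - sqrt (\<rho>0 (closure \<Omega>)))\<^sup>2))"
    (is "_ \<le> ennreal (C + \<delta>\<^sup>2 * ?K)")
proof (rule ennreal_le_epsilon)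
  fix \<eta> :: real assume \<eta>: "0 < \<eta>"
  have m: "0 \<le> \<rho>0 (closure \<Omega>)" "0 \<le> \<rho>1 (closure \<Omega>)" using \<rho> by (auto simp: nonneg_measures_def)
  have C\<eta>: "0 \<le> C + \<eta>" using C \<eta> by simp
  have "d_gBB_sq \<Omega> \<rho>0 \<rho>1 < ennreal (C + \<eta>)" using C \<eta> by (simp add: ennreal_less_iff)
  then obtain \<nu> where \<nu>: "\<nu> \<in> CE_growth \<Omega> \<rho>0 \<rho>1" "(case \<nu> of (\<rho>, \<omega>, \<zeta>) \<Rightarrow> D_BB \<Omega> \<rho> \<omega>) < ennreal (C + \<eta>)"
    unfolding d_gBB_sq_def INF_less_iff by blast
  obtain \<rho> \<omega> \<zeta> where eq: "\<nu> = (\<rho>, \<omega>, \<zeta>)" by (cases \<nu>)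
  have CE: "(\<rho>, \<omega>, \<zeta>) \<in> CE \<Omega> \<rho>0 \<rho>1" 
    and dp: "is_density_product (cylinder \<Omega>) \<zeta> (growth_rate (\<rho>0 (closure \<Omega>)) (\<rho>1 (closure \<Omega>))) \<rho>"
    using \<nu>(1) by (auto simp: eq CE_growth_def)
  have D: "D_BB \<Omega> \<rho> \<omega> \<le> ennreal (C + \<eta>)" using \<nu>(2) by (simp add: eq)
  have sm: "\<rho> \<in> signed_measures (cylinder \<Omega>)" "\<And>i. \<omega> i \<in> signed_measures (cylinder \<Omega>)"
    using CE_triples[OF CE] by (auto simp: triples_def)
  have "(\<rho>, \<omega>, \<lambda>A. 0) \<in> triples \<Omega>" using sm by (simp add: triples_def)
  from BB_bound_of_D_le[OF \<Omega> this zero_less_one C\<eta> D[unfolded D_BB_def]]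
  have nn: "\<rho> \<in> nonneg_measures (cylinder \<Omega>)" by (rule nonneg_of_BB_bound[OF compact_cylinder[OF \<Omega>] sm(1)])
  have "D \<Omega> \<delta> \<mu> \<le> D \<Omega> \<delta> (\<rho>, \<omega>, \<zeta>)"
    using min CE by (auto simp: WF_minimizer_def WF_sq_def intro: INF_lower)
  also have "\<dots> \<le> ennreal (C + \<eta> + \<delta>\<^sup>2 * ?K)"
    by (rule D_growth_le[OF \<Omega> CE nonneg_measures_signed[OF \<rho>(1)] nonneg_measures_signed[OF \<rho>(2)] _ _ _ _ nn
          dp[unfolded growth_rate_eq[OF m]] C\<eta> D \<delta>]) (use m in auto)
  also have "\<dots> = ennreal (C + \<delta>\<^sup>2 * ?K) + ennreal \<eta>"
    using C \<eta> by (subst ennreal_plus[symmetric]) (auto simp: add_ac)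
  finally show "D \<Omega> \<delta> \<mu> \<le> ennreal (C + \<delta>\<^sup>2 * ?K) + ennreal \<eta>" .
qed

text \<open>The counterpart of \<open>WF_minimizer_growth_le\<close> for small \<open>\<delta>\<close>: now the transport part of the
  competitors is zero, and the whole action scales like \<open>\<delta>\<^sup>2\<close>.\<close>

lemma WF_minimizer_static_le:
  fixes \<Omega> :: "(real ^ 'd::finite) set"
  assumes \<Omega>: "bounded \<Omega>" and min: "WF_minimizer \<Omega> \<delta> \<rho>0 \<rho>1 \<mu>" and \<delta>: "0 < \<delta>"
    and C: "0 \<le> C" "d_FR_sq \<Omega> \<rho>0 \<rho>1 = ennreal C"
  shows "D \<Omega> \<delta> \<mu> \<le> ennreal (\<delta>\<^sup>2 * C)"
proof (rule ennreal_le_epsilon)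
  fix e :: real assume e: "0 < e"
  define \<eta> where "\<eta> = e / \<delta>\<^sup>2"
  have \<eta>: "0 < \<eta>" "\<delta>\<^sup>2 * \<eta> = e" using e \<delta> by (simp_all add: \<eta>_def)
  have C\<eta>: "0 \<le> C + \<eta>" using C \<eta> by simp
  have "d_FR_sq \<Omega> \<rho>0 \<rho>1 < ennreal (C + \<eta>)" using C \<eta> by (simp add: ennreal_less_iff)
  then obtain \<nu> where \<nu>: "\<nu> \<in> CE_static \<Omega> \<rho>0 \<rho>1" "(case \<nu> of (\<rho>, \<omega>, \<zeta>) \<Rightarrow> D_FR \<Omega> \<rho> \<zeta>) < ennreal (C + \<eta>)"
    unfolding d_FR_sq_def INF_less_iff by blast
  obtain \<rho> \<omega> \<zeta> where eq: "\<nu> = (\<rho>, \<omega>, \<zeta>)" by (cases \<nu>)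
  have CE: "(\<rho>, \<lambda>i A. 0, \<zeta>) \<in> CE \<Omega> \<rho>0 \<rho>1" using \<nu>(1) by (auto simp: eq CE_static_def)
  have D: "D_FR \<Omega> \<rho> \<zeta> \<le> ennreal (C + \<eta>)" using \<nu>(2) by (simp add: eq)
  note tr = CE_triples[OF CE]
  have sm: "\<rho> \<in> signed_measures (cylinder \<Omega>)" "\<zeta> \<in> signed_measures (cylinder \<Omega>)"
    using tr by (auto simp: triples_def)
  have fr: "FR_bound (cylinder \<Omega>) \<rho> \<zeta> (C + \<eta>)"
    using FR_bound_of_D_le[OF \<Omega> tr zero_less_one C\<eta> D[unfolded D_FR_def]] by simp
  have "D \<Omega> \<delta> \<mu> \<le> D \<Omega> \<delta> (\<rho>, \<lambda>i A. 0, \<zeta>)"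
    using min CE by (auto simp: WF_minimizer_def WF_sq_def intro: INF_lower)
  also have "\<dots> \<le> ennreal (\<delta>\<^sup>2 * (C + \<eta>))" by (rule D_static_le_of_bound[OF \<Omega> sm \<delta> C\<eta> fr])
  also have "\<dots> = ennreal (\<delta>\<^sup>2 * C) + ennreal e"
    using C e by (subst ennreal_plus[symmetric]) (auto simp: distrib_left \<eta>(2))
  finally show "D \<Omega> \<delta> \<mu> \<le> ennreal (\<delta>\<^sup>2 * C) + ennreal e" .
qed

theorem mainTheorem4:
  fixes \<Omega> :: "(real ^ 'd::finite) set"
    and \<rho>0 \<rho>1 :: "(real ^ 'd) smeasure"
    and \<delta> :: "nat \<Rightarrow> real"
    and \<mu> :: "nat \<Rightarrow> 'd triple"
  assumes "\<Omega> \<noteq> {}" and "open \<Omega>" and "bounded \<Omega>" and "convex \<Omega>"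
    and "\<rho>0 \<in> nonneg_measures (closure \<Omega>)" and "\<rho>1 \<in> nonneg_measures (closure \<Omega>)"
    and "\<And>n. \<delta> n > 0"
    and "\<And>n. WF_minimizer \<Omega> (\<delta> n) \<rho>0 \<rho>1 (\<mu> n)"
  shows "(filterlim \<delta> at_top sequentially \<longrightarrow>
            (\<exists>r \<nu>. strict_mono r \<and> triple_weak_star_tendsto \<Omega> (\<lambda>k. \<mu> (r k)) \<nu> \<and>
                   gBB_minimizer \<Omega> \<rho>0 \<rho>1 \<nu>))
       \<and> (\<delta> \<longlonglongrightarrow> 0 \<longrightarrow>
            (\<exists>r \<nu>. strict_mono r \<and> triple_weak_star_tendsto \<Omega> (\<lambda>k. \<mu> (r k)) \<nu> \<and>
                   FR_minimizer \<Omega> \<rho>0 \<rho>1 \<nu>))"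
proof (intro conjI impI)
  note \<Omega> = assms(3) and \<rho>n = assms(5,6) and \<delta> = assms(7) and min = assms(8)
  define X where "X = cylinder \<Omega>"
  have X: "compact X" unfolding X_def by (rule compact_cylinder[OF \<Omega>])
  note bdry = nonneg_measures_signed[OF \<rho>n(1)] nonneg_measures_signed[OF \<rho>n(2)]
  define m0 where "m0 = \<rho>0 (closure \<Omega>)"
  define m1 where "m1 = \<rho>1 (closure \<Omega>)"
  have m: "0 \<le> m0" "0 \<le> m1" using \<rho>n by (auto simp: nonneg_measures_def m0_def m1_def)
  define s0 where "s0 = sqrt m0"
  define s1 where "s1 = sqrt m1"
  have s: "0 \<le> s0" "0 \<le> s1" "\<rho>0 (closure \<Omega>) = s0\<^sup>2" "\<rho>1 (closure \<Omega>) = s1\<^sup>2"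
    using m by (simp_all add: s0_def s1_def m0_def m1_def)
  define K where "K = 2 * (s1 - s0)\<^sup>2"
  have K: "0 \<le> K" by (simp add: K_def)
  define \<rho> where "\<rho> n = fst (\<mu> n)" for n
  define \<omega> where "\<omega> n = fst (snd (\<mu> n))" for n
  define \<zeta> where "\<zeta> n = snd (snd (\<mu> n))" for n
  have \<mu>: "\<mu> n = (\<rho> n, \<omega> n, \<zeta> n)" for n by (simp add: \<rho>_def \<omega>_def \<zeta>_def)
  have CE: "(\<rho> n, \<omega> n, \<zeta> n) \<in> CE \<Omega> \<rho>0 \<rho>1" for n
    using min[of n] by (simp add: WF_minimizer_def \<mu>)
  note tr = CE_triples[OF CE]
  show "\<exists>r \<nu>. strict_mono r \<and> triple_weak_star_tendsto \<Omega> (\<lambda>k. \<mu> (r k)) \<nu> \<and> gBB_minimizer \<Omega> \<rho>0 \<rho>1 \<nu>"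
    if lim: "filterlim \<delta> at_top sequentially"
  proof -
    obtain \<rho>' \<omega>' \<zeta>' C' where comp: "(\<rho>', \<omega>', \<zeta>') \<in> CE_growth \<Omega> \<rho>0 \<rho>1" "D_BB \<Omega> \<rho>' \<omega>' \<le> ennreal C'"
      using growth_competitor[OF \<Omega> assms(4,1) \<rho>n] by blast
    have "d_gBB_sq \<Omega> \<rho>0 \<rho>1 \<le> (case (\<rho>', \<omega>', \<zeta>') of (\<rho>, \<omega>, \<zeta>) \<Rightarrow> D_BB \<Omega> \<rho> \<omega>)"
      unfolding d_gBB_sq_def by (rule INF_lower[OF comp(1)])
    also have "\<dots> \<le> ennreal C'" using comp(2) by simp
    also have "\<dots> < top" by simp
    finally have "d_gBB_sq \<Omega> \<rho>0 \<rho>1 < top" .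
    then obtain C where C: "0 \<le> C" "d_gBB_sq \<Omega> \<rho>0 \<rho>1 = ennreal C" by (cases "d_gBB_sq \<Omega> \<rho>0 \<rho>1") auto
    have Dle: "D \<Omega> (\<delta> n) (\<rho> n, \<omega> n, \<zeta> n) \<le> ennreal (C + (\<delta> n)\<^sup>2 * K)" for n
      using WF_minimizer_growth_le[OF \<Omega> \<rho>n min \<delta> C, of n] by (simp add: \<mu> K_def s0_def s1_def m0_def m1_def)
    have BB: "BB_bound X (\<rho> n) (\<omega> n) C" for n
      unfolding X_def by (rule BB_bound_of_D_growth_le[OF \<Omega> CE bdry s \<delta> C(1) Dle[unfolded K_def]])
    have CK: "0 \<le> C + (\<delta> n)\<^sup>2 * K" for n using C K by simp
    have FR: "FR_bound X (\<rho> n) (\<zeta> n) (K + C / (\<delta> n)\<^sup>2)" for n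
    proof -
      have "(C + (\<delta> n)\<^sup>2 * K) / (\<delta> n)\<^sup>2 = K + C / (\<delta> n)\<^sup>2" using \<delta>[of n] by (simp add: add_divide_distrib)
      then show ?thesis using FR_bound_of_D_le[OF \<Omega> tr \<delta> CK Dle, of n] by (simp add: X_def)
    qed
    have inv: "(\<lambda>n. K + C / (\<delta> n)\<^sup>2) \<longlonglongrightarrow> K"
    proof -
      have "filterlim (\<lambda>n. (\<delta> n)\<^sup>2) at_top sequentially"
        by (rule filterlim_pow_at_top[OF _ lim]) simp
      then have "(\<lambda>n. C / (\<delta> n)\<^sup>2) \<longlonglongrightarrow> 0"
        by (intro tendsto_divide_0[OF tendsto_const]) (rule filterlim_at_top_imp_at_infinity)
      from tendsto_add[OF tendsto_const this, of K] show ?thesis by simp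
    qed
    obtain M where M: "\<And>n. K + C / (\<delta> n)\<^sup>2 \<le> M"
      by (rule convergent_bounded_above[OF inv]) (rule that)
    have FRM: "FR_bound X (\<rho> n) (\<zeta> n) M" for n by (rule FR_bound_mono[OF FR M])
    obtain r \<rho>' \<omega>' \<zeta>' where r: "strict_mono r" "(\<rho>', \<omega>', \<zeta>') \<in> triples \<Omega>"
      "triple_weak_star_tendsto \<Omega> (\<lambda>k. (\<rho> (r k), \<omega> (r k), \<zeta> (r k))) (\<rho>', \<omega>', \<zeta>')"
      by (rule weak_star_compact_CE[OF \<Omega> assms(4,1) CE bdry BB[unfolded X_def] FRM[unfolded X_def]]) (rule that)
    have w: "weak_star_tendsto X (\<lambda>k. \<rho> (r k)) \<rho>'" "weak_star_tendsto X (\<lambda>k. \<omega> (r k) i) (\<omega>' i)"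
        "weak_star_tendsto X (\<lambda>k. \<zeta> (r k)) \<zeta>'" for i
      using r(3) by (auto simp: triple_weak_star_tendsto_def X_def)
    have CE': "(\<rho>', \<omega>', \<zeta>') \<in> CE \<Omega> \<rho>0 \<rho>1"
      by (rule CE_weak_star_closed[OF CE r(2,3)])
    have sm: "\<rho>' \<in> signed_measures X" "\<And>i. \<omega>' i \<in> signed_measures X" "\<zeta>' \<in> signed_measures X"
      using r(2) by (auto simp: triples_def X_def)
    have BB': "BB_bound X \<rho>' \<omega>' C" by (rule BB_bound_limit[OF BB tendsto_const w(1,2)])
    have FR': "FR_bound X \<rho>' \<zeta>' K"
      by (rule FR_bound_limit[OF FR LIMSEQ_subseq_LIMSEQ[OF inv r(1), unfolded comp_def] w(1,3)])
    have nn: "\<rho>' \<in> nonneg_measures X" by (rule nonneg_of_BB_bound[OF X sm(1) BB'])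
    have "is_density_product X \<zeta>' (\<lambda>p. reg_rate s0 s1 0 (fst p)) \<rho>'"
      unfolding X_def
      by (rule growth_rigidity[OF \<Omega> CE' bdry s nn[unfolded X_def]])
        (use FR_boundD[OF FR'] in \<open>simp add: X_def K_def\<close>)
    moreover have "growth_rate m0 m1 = (\<lambda>p :: 'd spacetime. reg_rate s0 s1 0 (fst p))"
      unfolding s0_def s1_def by (rule growth_rate_eq[OF m])
    ultimately have growth: "(\<rho>', \<omega>', \<zeta>') \<in> CE_growth \<Omega> \<rho>0 \<rho>1"
      using CE' by (simp add: CE_growth_def X_def m0_def m1_def)
    have "D_BB \<Omega> \<rho>' \<omega>' \<le> ennreal C"
      by (rule D_BB_le_of_bound[OF \<Omega> sm(1,2)[unfolded X_def] C(1) BB'[unfolded X_def]])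
    moreover have "d_gBB_sq \<Omega> \<rho>0 \<rho>1 \<le> (case (\<rho>', \<omega>', \<zeta>') of (\<rho>, \<omega>, \<zeta>) \<Rightarrow> D_BB \<Omega> \<rho> \<omega>)"
      unfolding d_gBB_sq_def by (rule INF_lower[OF growth])
    ultimately have "gBB_minimizer \<Omega> \<rho>0 \<rho>1 (\<rho>', \<omega>', \<zeta>')"
      using growth C(2) by (simp add: gBB_minimizer_def)
    then show ?thesis using r(1,3) by (auto simp: \<mu>)
  qed
  show "\<exists>r \<nu>. strict_mono r \<and> triple_weak_star_tendsto \<Omega> (\<lambda>k. \<mu> (r k)) \<nu> \<and> FR_minimizer \<Omega> \<rho>0 \<rho>1 \<nu>"
    if lim: "\<delta> \<longlonglongrightarrow> 0"
  proof -
    obtain \<rho>' \<omega>' \<zeta>' C' where comp: "(\<rho>', \<omega>', \<zeta>') \<in> CE_static \<Omega> \<rho>0 \<rho>1" "D_FR \<Omega> \<rho>' \<zeta>' \<le> ennreal C'"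
      using static_competitor[OF \<Omega> assms(4) \<rho>n] by blast
    have "d_FR_sq \<Omega> \<rho>0 \<rho>1 \<le> (case (\<rho>', \<omega>', \<zeta>') of (\<rho>, \<omega>, \<zeta>) \<Rightarrow> D_FR \<Omega> \<rho> \<zeta>)"
      unfolding d_FR_sq_def by (rule INF_lower[OF comp(1)])
    also have "\<dots> \<le> ennreal C'" using comp(2) by simp
    also have "\<dots> < top" by simp
    finally have "d_FR_sq \<Omega> \<rho>0 \<rho>1 < top" .
    then obtain C where C: "0 \<le> C" "d_FR_sq \<Omega> \<rho>0 \<rho>1 = ennreal C" by (cases "d_FR_sq \<Omega> \<rho>0 \<rho>1") auto
    have Dle: "D \<Omega> (\<delta> n) (\<rho> n, \<omega> n, \<zeta> n) \<le> ennreal ((\<delta> n)\<^sup>2 * C)" for n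
      using WF_minimizer_static_le[OF \<Omega> min \<delta> C, of n] by (simp add: \<mu>)
    have dC: "0 \<le> (\<delta> n)\<^sup>2 * C" for n using C by simp
    have BB: "BB_bound X (\<rho> n) (\<omega> n) ((\<delta> n)\<^sup>2 * C)" for n
      unfolding X_def by (rule BB_bound_of_D_le[OF \<Omega> tr \<delta> dC Dle])
    have FR: "FR_bound X (\<rho> n) (\<zeta> n) C" for n
      using FR_bound_of_D_le[OF \<Omega> tr \<delta> dC Dle, of n] \<delta>[of n] by (simp add: X_def)
    obtain B where B: "\<And>n. (\<delta> n)\<^sup>2 * C \<le> B"
      by (rule convergent_bounded_above[OF tendsto_mult[OF tendsto_power[OF lim, of 2] tendsto_const[of C]]]) (rule that)
    have BBB: "BB_bound X (\<rho> n) (\<omega> n) B" for n by (rule BB_bound_mono[OF BB B])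
    obtain r \<rho>' \<omega>' \<zeta>' where r: "strict_mono r" "(\<rho>', \<omega>', \<zeta>') \<in> triples \<Omega>"
      "triple_weak_star_tendsto \<Omega> (\<lambda>k. (\<rho> (r k), \<omega> (r k), \<zeta> (r k))) (\<rho>', \<omega>', \<zeta>')"
      by (rule weak_star_compact_CE[OF \<Omega> assms(4,1) CE bdry BBB[unfolded X_def] FR[unfolded X_def]]) (rule that)
    have w: "weak_star_tendsto X (\<lambda>k. \<rho> (r k)) \<rho>'" "weak_star_tendsto X (\<lambda>k. \<omega> (r k) i) (\<omega>' i)"
        "weak_star_tendsto X (\<lambda>k. \<zeta> (r k)) \<zeta>'" for i
      using r(3) by (auto simp: triple_weak_star_tendsto_def X_def)
    have CE': "(\<rho>', \<omega>', \<zeta>') \<in> CE \<Omega> \<rho>0 \<rho>1"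
      by (rule CE_weak_star_closed[OF CE r(2,3)])
    have sm: "\<rho>' \<in> signed_measures X" "\<And>i. \<omega>' i \<in> signed_measures X" "\<zeta>' \<in> signed_measures X"
      using r(2) by (auto simp: triples_def X_def)
    have FR': "FR_bound X \<rho>' \<zeta>' C" by (rule FR_bound_limit[OF FR tendsto_const w(1,3)])
    have sm_n: "\<rho> n \<in> signed_measures X" for n using tr[of n] by (simp add: triples_def X_def)
    have \<omega>0: "\<omega>' i = (\<lambda>A. 0)" for i
    proof (rule signed_measure_eqI[OF X sm(2) zero_signed_measure])
      fix h :: "'d spacetime \<Rightarrow> real" assume h: "continuous_on X h"
      obtain H where H: "0 \<le> H" "\<And>x. x \<in> X \<Longrightarrow> \<bar>h x\<bar> \<le> H"
        using continuous_on_compact_bound[OF X h] by (metis real_norm_def)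
      \<comment> \<open>Scaled to be bounded by 1, as \<open>abs_momentum_le\<close> requires.\<close>
      define h' where "h' x = 1 / (H + 1) * h x" for x
      have h': "continuous_on X h'" unfolding h'_def by (intro continuous_intros h)
      have h'1: "\<bar>h' x\<bar> \<le> 1" if "x \<in> X" for x
        using H(2)[OF that] H(1) by (simp add: h'_def abs_mult divide_le_eq)
      have b: "\<bar>signed_integral X (\<omega> n i) h'\<bar> \<le> \<delta> n * (C + (m0 + C))" for n
      proof -
        \<comment> \<open>The parameter \<open>t = \<delta> n\<close> balances the transport part, of order \<open>\<delta>\<^sup>2\<close>, against the mass.\<close>
        have "\<bar>signed_integral X (\<omega> n i) h'\<bar> \<le> (\<delta> n)\<^sup>2 * C / \<delta> n + \<delta> n * \<rho> n X / 2"
          by (rule abs_momentum_le[OF BB sm_n h' h'1 \<delta>])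
        also have "\<dots> = \<delta> n * (C + \<rho> n X / 2)" using \<delta>[of n] by (simp add: power2_eq_square distrib_left)
        also have "\<dots> \<le> \<delta> n * (C + (m0 + C))"
        proof (rule mult_left_mono)
          have "\<rho> n X \<le> 2 * (m0 + C)"
            unfolding X_def m0_def by (rule mass_le_of_FR_bound[OF \<Omega> CE bdry FR[unfolded X_def]])
          then show "C + \<rho> n X / 2 \<le> C + (m0 + C)" by simp
        qed (use \<delta>[of n] in simp)
        finally show ?thesis .
      qed
      have z: "(\<lambda>n. \<delta> n * (C + (m0 + C))) \<longlonglongrightarrow> 0"
        using tendsto_mult[OF lim tendsto_const] by simp
      have "(\<lambda>n. signed_integral X (\<omega> n i) h') \<longlonglongrightarrow> 0"
        by (rule Lim_null_comparison[OF always_eventually z]) (intro allI, unfold real_norm_def, rule b)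
      from LIMSEQ_subseq_LIMSEQ[OF this r(1)] have "(\<lambda>k. signed_integral X (\<omega> (r k) i) h') \<longlonglongrightarrow> 0"
        by (simp add: comp_def)
      moreover have "(\<lambda>k. signed_integral X (\<omega> (r k) i) h') \<longlonglongrightarrow> signed_integral X (\<omega>' i) h'"
        using w(2)[of i] h' by (simp add: weak_star_tendsto_def)
      ultimately have "signed_integral X (\<omega>' i) h' = 0" by (rule LIMSEQ_unique[symmetric])
      then have "1 / (H + 1) * signed_integral X (\<omega>' i) h = 0" unfolding h'_def[abs_def] signed_integral_cmult .
      then show "signed_integral X (\<omega>' i) h = signed_integral X (\<lambda>A. 0) h" using H(1) by simp
    qed
    then have static: "(\<rho>', \<omega>', \<zeta>') \<in> CE_static \<Omega> \<rho>0 \<rho>1" using CE' by (auto simp: CE_static_def)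
    have "D_FR \<Omega> \<rho>' \<zeta>' \<le> ennreal C"
      by (rule D_FR_le_of_bound[OF \<Omega> sm(1,3)[unfolded X_def] C(1) FR'[unfolded X_def]])
    moreover have "d_FR_sq \<Omega> \<rho>0 \<rho>1 \<le> (case (\<rho>', \<omega>', \<zeta>') of (\<rho>, \<omega>, \<zeta>) \<Rightarrow> D_FR \<Omega> \<rho> \<zeta>)"
      unfolding d_FR_sq_def by (rule INF_lower[OF static])
    ultimately have "FR_minimizer \<Omega> \<rho>0 \<rho>1 (\<rho>', \<omega>', \<zeta>')"
      using static C(2) by (simp add: FR_minimizer_def)
    then show ?thesis using r(1,3) by (auto simp: \<mu>)
  qed
qed

end
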